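(* Let $L$ be a closed subalgebra of $W(m,n)$. (a) Let $V$ be the projection of $L$ on $W(m,n)_{-1}=\sum_i\mathbb{C}\frac{\partial}{\partial x_i}+\sum_j\mathbb{C}\frac{\partial}{\partial \xi_j}$, and let $V^*\subset\sum_i\mathbb{C}x_i+\sum_j\mathbb{C}\xi_j$ be the annihilator of $V$, i.e. the space of all linear functions $\ell$ in the variables such that $D\ell=0$ for all $D\in V$. Then there exists a continuous automorphism of the superalgebra $\Lambda(m,n)$ such that the induced automorphism of $W(m,n)$ maps $L$ into the subalgebra $W_{V^*}$ of $W(m,n)$. (b) The algebra $\Lambda(m,n)$ has no non-trivial closed $L$-invariant ideals if and only if $L$ is a transitive subalgebra of $W(m,n)$.
   Context: The ground field is $\mathbb{C}$. $\Lambda(m,n)=\Lambda(n)[[x_1,\dots,x_m]]$, where $\Lambda(n)$ is the Grassmann algebra in anticommuting odd indeterminates $\xi_1,\dots,\xi_n$ and the $x_i$ are even; its topology is the formal one, with fundamental system of neighbourhoods of $0$ given by the powers of the ideal $(x_1,\dots,x_m,\xi_1,\dots,\xi_n)$. $W(m,n)$ is the (linearly compact) Lie superalgebra of all continuous derivations of $\Lambda(m,n)$; its elements are $\sum_i P_i\frac{\partial}{\partial x_i}+\sum_j Q_j\frac{\partial}{\partial\xi_j}$ with $P_i,Q_j\in\Lambda(m,n)$. The principal grading $W(m,n)=\prod_{j\ge -1}W(m,n)_j$ is given by $\deg x_i=\deg\xi_j=1$, $\deg\frac{\partial}{\partial x_i}=\deg\frac{\partial}{\partial\xi_j}=-1$.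 A subalgebra $L$ of $W(m,n)$ is transitive if its projection on $W(m,n)_{-1}$ is onto. For a subspace $U$ of $\sum_i\mathbb{C}x_i+\sum_j\mathbb{C}\xi_j$, $I_U$ is the ideal of $\Lambda(m,n)$ generated by $U$, and $W_U=\{X\in W(m,n)\mid XI_U\subset I_U\}$. Non-trivial ideal means different from $0$ and $\Lambda(m,n)$. *)

theory Defs
  imports "HOL-Analysis.Analysis" "HOL-Library.Multiset" "HOL-Library.FSet"
    "HOL-Library.Function_Algebras"
begin

section \<open>Formal power series in even and odd variables\<close>

text \<open>
  Elements of \<open>sps\<close> are formal series over the complex numbers in even variables
  \<open>x\<^sub>0, x\<^sub>1, \<dots>\<close> and anticommuting odd variables \<open>\<xi>\<^sub>0, \<xi>\<^sub>1, \<dots>\<close>. A monomial is a pair \<open>(A, S)\<close>: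
  the multiset \<open>A\<close> records the exponents of the even variables, and the finite set \<open>S\<close> stands for
  the product of the \<open>\<xi>\<^sub>j\<close> with \<open>j \<in> S\<close> in increasing order of indices. The algebra
  \<open>\<Lambda>(m,n)\<close> is the subalgebra \<open>Lam m n\<close> below, with variables numbered from \<open>0\<close>.
\<close>

typedef sps = "UNIV :: (nat multiset \<Rightarrow> nat fset \<Rightarrow> complex) set"
  morphisms sps_nth Sps
  by simp

lemma sps_nth_Sps [simp]: "sps_nth (Sps F) = F"
  by (simp add: Sps_inverse)

lemma sps_eqI: "(\<And>A S. sps_nth f A S = sps_nth g A S) \<Longrightarrow> f = g"
  by (metis ext sps_nth_inject)

text \<open>
  For disjoint \<open>T\<close>, \<open>R\<close> one has \<open>\<xi>\<^sub>T \<xi>\<^sub>R = wedge_sign T R \<cdot> \<xi>\<close> with \<open>\<xi>\<close> the monomial of \<open>T \<union> R\<close>: the exponent counts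
  the transpositions needed to sort the concatenation.
\<close>

definition wedge_sign :: "nat fset \<Rightarrow> nat fset \<Rightarrow> complex" where
  "wedge_sign T R = (-1) ^ card {(i, j). i |\<in>| T \<and> j |\<in>| R \<and> j < i}"

definition mdivs :: "nat multiset \<Rightarrow> nat fset \<Rightarrow> (nat multiset \<times> nat fset) set" where
  "mdivs A S = {B. B \<subseteq># A} \<times> {T. T |\<subseteq>| S}"

instantiation sps :: ring_1
begin

definition "0 = Sps (\<lambda>A S. 0)"
definition "1 = Sps (\<lambda>A S. if A = {#} \<and> S = {||} then 1 else 0)"
definition "f + g = Sps (\<lambda>A S. sps_nth f A S + sps_nth g A S)"
definition "- f = Sps (\<lambda>A S. - sps_nth f A S)"
definition "f - g = Sps (\<lambda>A S. sps_nth f A S - sps_nth g A S)"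
definition "f * g = Sps (\<lambda>A S. \<Sum>(B, T)\<in>mdivs A S.
   wedge_sign T (S |-| T) * sps_nth f B T * sps_nth g (A - B) (S |-| T))"

lemma finite_mdivs [simp]: "finite (mdivs A S)"
proof -
  have "{B. B \<subseteq># A} \<subseteq> (\<lambda>f. Abs_multiset f) ` {f. \<forall>i. (i \<in> set_mset A \<longrightarrow> f i \<in> {..size A}) \<and> (i \<notin> set_mset A \<longrightarrow> f i = 0)}"
  proof
    fix B assume "B \<in> {B. B \<subseteq># A}"
    then have B: "B \<subseteq># A" by simp
    have "count B i \<le> size A" for i
      using B by (meson count_le_size le_trans mset_subset_eq_count)
    moreover have "i \<notin># A \<Longrightarrow> count B i = 0" for i
      using B by (meson count_inI mset_subset_eqD)
    ultimately show "B \<in> (\<lambda>f. Abs_multiset f) ` {f. \<forall>i. (i \<in> set_mset A \<longrightarrow> f i \<in> {..size A}) \<and> (i \<notin> set_mset A \<longrightarrow> f i = 0)}"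
      by (intro image_eqI[of _ _ "count B"]) (auto simp: count_inverse)
  qed
  moreover have "finite {f. \<forall>i. (i \<in> set_mset A \<longrightarrow> f i \<in> {..size A}) \<and> (i \<notin> set_mset A \<longrightarrow> f i = (0::nat))}"
    by (rule finite_set_of_finite_funs) auto
  ultimately have "finite {B. B \<subseteq># A}"
    by (meson finite_imageI finite_subset)
  moreover have "{T. T |\<subseteq>| S} = fset (fPow S)"
    by auto
  ultimately show ?thesis
    by (simp add: mdivs_def)
qed

lemma wedge_sign_cocycle:
  assumes "R |\<inter>| U = {||}" "U |\<inter>| Q = {||}" "R |\<inter>| Q = {||}"
  shows "wedge_sign U R * wedge_sign (U |\<union>| R) Q = wedge_sign U (R |\<union>| Q) * wedge_sign R Q"
proof -
  define N where "N = (\<lambda>T R. {(i, j). i |\<in>| T \<and> j |\<in>| R \<and> (j::nat) < i})"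
  have fin: "finite (N T R)" for T R
    by (rule finite_subset[of _ "fset T \<times> fset R"]) (auto simp: N_def)
  have disj: "i |\<in>| R \<Longrightarrow> i |\<in>| U \<Longrightarrow> False" "i |\<in>| U \<Longrightarrow> i |\<in>| Q \<Longrightarrow> False" "i |\<in>| R \<Longrightarrow> i |\<in>| Q \<Longrightarrow> False" for i
    using assms by blast+
  have "N (U |\<union>| R) Q = N U Q \<union> N R Q" "N U (R |\<union>| Q) = N U R \<union> N U Q"
    by (auto simp: N_def)
  moreover have "N U Q \<inter> N R Q = {}" "N U R \<inter> N U Q = {}"
    using disj by (auto simp: N_def)
  ultimately have "card (N (U |\<union>| R) Q) = card (N U Q) + card (N R Q)"
    "card (N U (R |\<union>| Q)) = card (N U R) + card (N U Q)"
    by (simp_all add: card_Un_disjoint fin)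
  moreover have "wedge_sign T R = (-1) ^ card (N T R)" for T R
    by (simp add: wedge_sign_def N_def)
  ultimately show ?thesis
    by (simp add: power_add mult_ac)
qed

lemma sps_mult_assoc: "(f * g) * h = f * (g * (h :: sps))"
proof (rule sps_eqI)
  fix A S
  let ?f = "sps_nth f" and ?g = "sps_nth g" and ?h = "sps_nth h"
  let ?L = "\<lambda>((B, T), (C, U)). wedge_sign T (S |-| T) * (wedge_sign U (T |-| U) * ?f C U * ?g (B - C) (T |-| U)) * ?h (A - B) (S |-| T)"
  let ?R = "\<lambda>((C, U), (E, R)). wedge_sign U (S |-| U) * ?f C U * (wedge_sign R (S |-| U |-| R) * ?g E R * ?h (A - C - E) (S |-| U |-| R))"
  have "sps_nth ((f * g) * h) A S = (\<Sum>p\<in>(SIGMA p:mdivs A S. mdivs (fst p) (snd p)). ?L p)"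
    by (simp add: times_sps_def sum_distrib_left sum_distrib_right sum.Sigma case_prod_unfold)
  also have "\<dots> = (\<Sum>p\<in>(SIGMA p:mdivs A S. mdivs (A - fst p) (S |-| snd p)). ?R p)"
  proof (rule sum.reindex_bij_witness[where
        i = "\<lambda>((C, U), (E, R)). ((C + E, U |\<union>| R), (C, U))" and
        j = "\<lambda>((B, T), (C, U)). ((C, U), (B - C, T |-| U))"])
    fix p assume "p \<in> (SIGMA p:mdivs A S. mdivs (fst p) (snd p))"
    then obtain B T C U where p: "p = ((B, T), (C, U))"
      and le: "B \<subseteq># A" "T |\<subseteq>| S" "C \<subseteq># B" "U |\<subseteq>| T"
      by (auto simp: mdivs_def)
    show "(\<lambda>((C, U), (E, R)). ((C + E, U |\<union>| R), (C, U))) ((\<lambda>((B, T), (C, U)). ((C, U), (B - C, T |-| U))) p) = p"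
      using le by (auto simp: p)
    have "B - C \<subseteq># A - C"
      using le by (simp add: subset_mset.le_diff_conv2 subset_mset.order_trans[of C B A])
    then show "(\<lambda>((B, T), (C, U)). ((C, U), (B - C, T |-| U))) p \<in> (SIGMA p:mdivs A S. mdivs (A - fst p) (S |-| snd p))"
      using le by (auto simp: p mdivs_def intro: subset_mset.order_trans)
    have eqs: "S |-| U |-| (T |-| U) = S |-| T" "S |-| U = (T |-| U) |\<union>| (S |-| T)" "U |\<union>| (T |-| U) = T"
      using le by auto
    have A: "A - C - (B - C) = A - B"
      using le by (metis add.commute diff_diff_add_mset subset_mset.diff_add)
    have "wedge_sign U (T |-| U) * wedge_sign T (S |-| T)
        = wedge_sign U (S |-| U) * wedge_sign (T |-| U) (S |-| T)"
      using wedge_sign_cocycle[of "T |-| U" U "S |-| T"] le eqs by force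
    then show "?R ((\<lambda>((B, T), (C, U)). ((C, U), (B - C, T |-| U))) p) = ?L p"
      unfolding p prod.case eqs(1) A by (simp add: mult_ac)
  next
    fix p assume "p \<in> (SIGMA p:mdivs A S. mdivs (A - fst p) (S |-| snd p))"
    then obtain C U E R where p: "p = ((C, U), (E, R))"
      and le: "C \<subseteq># A" "U |\<subseteq>| S" "E \<subseteq># A - C" "R |\<subseteq>| S |-| U"
      by (auto simp: mdivs_def)
    show "(\<lambda>((B, T), (C, U)). ((C, U), (B - C, T |-| U))) ((\<lambda>((C, U), (E, R)). ((C + E, U |\<union>| R), (C, U))) p) = p"
      using le by (auto simp: p)
    have "C + E \<subseteq># A"
      using le by (metis subset_mset.add_diff_inverse subset_mset.add_left_mono)
    then show "(\<lambda>((C, U), (E, R)). ((C + E, U |\<union>| R), (C, U))) p \<in> (SIGMA p:mdivs A S. mdivs (fst p) (snd p))"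
      using le by (auto simp: p mdivs_def)
  qed
  also have "\<dots> = sps_nth (f * (g * h)) A S"
    by (simp add: times_sps_def sum_distrib_left sum_distrib_right sum.Sigma case_prod_unfold)
  finally show "sps_nth ((f * g) * h) A S = sps_nth (f * (g * h)) A S" .
qed

lemma wedge_sign_fempty [simp]: "wedge_sign {||} R = 1" "wedge_sign T {||} = 1"
  by (simp_all add: wedge_sign_def)

lemma sps_mult_one: "1 * f = (f :: sps)" "f * 1 = (f :: sps)"
proof -
  have "sps_nth (1 * f) A S = sps_nth f A S" for A S
  proof -
    have "sps_nth (1 * f) A S = (\<Sum>p\<in>mdivs A S. if p = ({#}, {||}) then sps_nth f A S else 0)"
      unfolding times_sps_def sps_nth_Sps
      by (intro sum.cong) (auto simp: one_sps_def split: if_splits)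
    then show ?thesis by (simp add: sum.delta) (simp add: mdivs_def)
  qed
  then show "1 * f = f" by (rule sps_eqI)
  have "sps_nth (f * 1) A S = sps_nth f A S" for A S
  proof -
    have "sps_nth (f * 1) A S = (\<Sum>p\<in>mdivs A S. if p = (A, S) then sps_nth f A S else 0)"
      unfolding times_sps_def sps_nth_Sps
      by (intro sum.cong) (auto simp: one_sps_def mdivs_def Diff_eq_empty_iff_mset split: if_splits)
    then show ?thesis by (simp add: sum.delta) (simp add: mdivs_def)
  qed
  then show "f * 1 = f" by (rule sps_eqI)
qed

instance
proof
  fix f g h :: sps
  show "(f * g) * h = f * (g * h)" by (rule sps_mult_assoc)
  show "1 * f = f" "f * 1 = f" by (rule sps_mult_one)+
  show "(f + g) * h = f * h + g * h" "f * (g + h) = f * g + f * h"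
    by (auto intro!: sps_eqI simp: times_sps_def plus_sps_def algebra_simps sum.distrib case_prod_unfold)
  have "sps_nth 0 {#} {||} \<noteq> sps_nth 1 {#} {||}" by (simp add: zero_sps_def one_sps_def)
  then show "(0::sps) \<noteq> 1" by metis
qed (auto intro!: sps_eqI simp: zero_sps_def plus_sps_def uminus_sps_def minus_sps_def)

end

definition smult :: "complex \<Rightarrow> sps \<Rightarrow> sps" where
  "smult c f = Sps (\<lambda>A S. c * sps_nth f A S)"

definition xvar :: "nat \<Rightarrow> sps" where
  "xvar i = Sps (\<lambda>A S. if A = {#i#} \<and> S = {||} then 1 else 0)"

definition xivar :: "nat \<Rightarrow> sps" where
  "xivar j = Sps (\<lambda>A S. if A = {#} \<and> S = {|j|} then 1 else 0)"

definition Lam :: "nat \<Rightarrow> nat \<Rightarrow> sps set" where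
  "Lam m n = {f. \<forall>A S. sps_nth f A S \<noteq> 0 \<longrightarrow> set_mset A \<subseteq> {..<m} \<and> fset S \<subseteq> {..<n}}"

definition has_parity :: "nat \<Rightarrow> sps \<Rightarrow> bool" where
  "has_parity p f \<longleftrightarrow> (\<forall>A S. sps_nth f A S \<noteq> 0 \<longrightarrow> fcard S mod 2 = p mod 2)"

definition parity_part :: "nat \<Rightarrow> sps \<Rightarrow> sps" where
  "parity_part p f = Sps (\<lambda>A S. if fcard S mod 2 = p mod 2 then sps_nth f A S else 0)"

definition degree_part :: "int \<Rightarrow> sps \<Rightarrow> sps" where
  "degree_part k f = Sps (\<lambda>A S. if int (size A + fcard S) = k then sps_nth f A S else 0)"


section \<open>Ideals and topology\<close>

text \<open>Following the usual convention, ideals of a superalgebra are graded by parity.\<close>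

definition super_ideal :: "nat \<Rightarrow> nat \<Rightarrow> sps set \<Rightarrow> bool" where
  "super_ideal m n I \<longleftrightarrow> I \<subseteq> Lam m n \<and> 0 \<in> I \<and> (\<forall>f\<in>I. \<forall>g\<in>I. f + g \<in> I) \<and>
     (\<forall>f\<in>I. \<forall>g\<in>Lam m n. g * f \<in> I \<and> f * g \<in> I) \<and>
     (\<forall>f\<in>I. \<forall>p. parity_part p f \<in> I)"

definition ideal_gen :: "nat \<Rightarrow> nat \<Rightarrow> sps set \<Rightarrow> sps set" where
  "ideal_gen m n U = \<Inter>{I. super_ideal m n I \<and> U \<subseteq> I}"

definition max_ideal :: "nat \<Rightarrow> nat \<Rightarrow> sps set" where
  "max_ideal m n = ideal_gen m n (xvar ` {..<m} \<union> xivar ` {..<n})"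

fun max_ideal_pow :: "nat \<Rightarrow> nat \<Rightarrow> nat \<Rightarrow> sps set" where
  "max_ideal_pow m n 0 = Lam m n"
| "max_ideal_pow m n (Suc k) =
     ideal_gen m n {f * g | f g. f \<in> max_ideal m n \<and> g \<in> max_ideal_pow m n k}"

text \<open>The translation-invariant topology on \<open>C\<close> with fundamental system of neighbourhoods \<open>N k\<close> of \<open>0\<close>.\<close>

definition filtration_topology :: "'a::minus set \<Rightarrow> (nat \<Rightarrow> 'a set) \<Rightarrow> 'a topology" where
  "filtration_topology C N =
     topology (\<lambda>U. U \<subseteq> C \<and> (\<forall>x\<in>U. \<exists>k. {y \<in> C. y - x \<in> N k} \<subseteq> U))"

lemma openin_filtration_topology:
  assumes "antimono N"
  shows "openin (filtration_topology C N) U \<longleftrightarrow>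
    U \<subseteq> C \<and> (\<forall>x\<in>U. \<exists>k. {y \<in> C. y - x \<in> N k} \<subseteq> U)"
proof -
  have "istopology (\<lambda>U. U \<subseteq> C \<and> (\<forall>x\<in>U. \<exists>k. {y \<in> C. y - x \<in> N k} \<subseteq> U))"
    unfolding istopology_def
  proof (intro conjI allI impI ballI)
    fix S T x
    assume *: "S \<subseteq> C \<and> (\<forall>x\<in>S. \<exists>k. {y \<in> C. y - x \<in> N k} \<subseteq> S)"
      "T \<subseteq> C \<and> (\<forall>x\<in>T. \<exists>k. {y \<in> C. y - x \<in> N k} \<subseteq> T)"
    then show "S \<inter> T \<subseteq> C" by blast
    assume "x \<in> S \<inter> T"
    then obtain k l where kl: "{y \<in> C. y - x \<in> N k} \<subseteq> S" "{y \<in> C. y - x \<in> N l} \<subseteq> T"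
      using * by blast
    have "N (max k l) \<subseteq> N k" "N (max k l) \<subseteq> N l"
      using assms by (simp_all add: antimono_def)
    then have "{y \<in> C. y - x \<in> N (max k l)} \<subseteq> S \<inter> T"
      using kl by blast
    then show "\<exists>k. {y \<in> C. y - x \<in> N k} \<subseteq> S \<inter> T" ..
  next
    fix K
    assume *: "\<forall>S\<in>K. S \<subseteq> C \<and> (\<forall>x\<in>S. \<exists>k. {y \<in> C. y - x \<in> N k} \<subseteq> S)"
    then show "\<Union>K \<subseteq> C" by blast
    fix x assume "x \<in> \<Union>K"
    then obtain S where S: "S \<in> K" "x \<in> S" by blast
    with * obtain k where "{y \<in> C. y - x \<in> N k} \<subseteq> S" by blast
    with S show "\<exists>k. {y \<in> C. y - x \<in> N k} \<subseteq> \<Union>K" by blast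
  qed
  then show ?thesis
    by (simp add: filtration_topology_def)
qed

lemma super_ideal_Lam: "super_ideal m n (Lam m n)"
proof -
  have "f * g \<in> Lam m n" if "f \<in> Lam m n" "g \<in> Lam m n" for f g
    unfolding Lam_def
  proof (intro CollectI allI impI)
    fix A S assume "sps_nth (f * g) A S \<noteq> 0"
    then have "(\<Sum>p\<in>mdivs A S. case p of (B, T) \<Rightarrow>
        wedge_sign T (S |-| T) * sps_nth f B T * sps_nth g (A - B) (S |-| T)) \<noteq> 0"
      by (simp add: times_sps_def)
    then obtain p where "p \<in> mdivs A S" "(case p of (B, T) \<Rightarrow>
        wedge_sign T (S |-| T) * sps_nth f B T * sps_nth g (A - B) (S |-| T)) \<noteq> 0"
      by (rule sum.not_neutral_contains_not_neutral)
    then obtain B T where BT: "B \<subseteq># A" "sps_nth f B T \<noteq> 0" "sps_nth g (A - B) (S |-| T) \<noteq> 0"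
      by (cases p) (auto simp: mdivs_def)
    have "set_mset B \<subseteq> {..<m}" "fset T \<subseteq> {..<n}"
      using that(1) BT(2) unfolding Lam_def by blast+
    moreover have "set_mset (A - B) \<subseteq> {..<m}" "fset (S |-| T) \<subseteq> {..<n}"
      using that(2) BT(3) unfolding Lam_def by blast+
    moreover have "set_mset A = set_mset B \<union> set_mset (A - B)"
      using BT(1) set_mset_union[of B "A - B"] by simp
    moreover have "fset S \<subseteq> fset T \<union> fset (S |-| T)" by auto
    ultimately show "set_mset A \<subseteq> {..<m} \<and> fset S \<subseteq> {..<n}" by blast
  qed
  moreover have "f + g \<in> Lam m n" if "f \<in> Lam m n" "g \<in> Lam m n" for f g
  proof -
    have "sps_nth f A S \<noteq> 0 \<or> sps_nth g A S \<noteq> 0" if "sps_nth (f + g) A S \<noteq> 0" for A S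
      using that by (auto simp: plus_sps_def)
    then show ?thesis
      using that unfolding Lam_def by blast
  qed
  moreover have "0 \<in> Lam m n"
    by (simp add: Lam_def zero_sps_def)
  moreover have "parity_part p f \<in> Lam m n" if "f \<in> Lam m n" for p f
    using that by (simp add: Lam_def parity_part_def)
  ultimately show ?thesis
    unfolding super_ideal_def by blast
qed

lemma super_ideal_ideal_gen: "U \<subseteq> Lam m n \<Longrightarrow> super_ideal m n (ideal_gen m n U)"
proof -
  assume U: "U \<subseteq> Lam m n"
  have "ideal_gen m n U \<subseteq> Lam m n"
    using super_ideal_Lam U by (auto simp: ideal_gen_def)
  then show ?thesis
    unfolding super_ideal_def[of m n "ideal_gen m n U"]
    by (simp add: ideal_gen_def) (simp add: super_ideal_def)
qed

lemma ideal_gen_least: "super_ideal m n I \<Longrightarrow> U \<subseteq> I \<Longrightarrow> ideal_gen m n U \<subseteq> I"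
  by (auto simp: ideal_gen_def)

lemma super_ideal_max_ideal: "super_ideal m n (max_ideal m n)"
  unfolding max_ideal_def
  by (rule super_ideal_ideal_gen) (auto simp: Lam_def xvar_def xivar_def split: if_splits)

lemma super_ideal_max_ideal_pow: "super_ideal m n (max_ideal_pow m n k)"
proof (induction k)
  case (Suc k)
  have *: "max_ideal m n \<subseteq> Lam m n"
    using super_ideal_max_ideal[of m n] by (simp add: super_ideal_def)
  have "{f * g | f g. f \<in> max_ideal m n \<and> g \<in> max_ideal_pow m n k} \<subseteq> Lam m n"
  proof clarify
    fix f g assume "f \<in> max_ideal m n" "g \<in> max_ideal_pow m n k"
    with Suc * have "f * g \<in> max_ideal_pow m n k"
      by (simp add: super_ideal_def subset_iff)
    with Suc show "f * g \<in> Lam m n"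
      by (simp add: super_ideal_def subset_iff)
  qed
  then show ?case by (simp add: super_ideal_ideal_gen)
qed (simp add: super_ideal_Lam)

lemma antimono_max_ideal_pow: "antimono (max_ideal_pow m n)"
proof -
  have "max_ideal_pow m n (Suc k) \<subseteq> max_ideal_pow m n k" for k
    unfolding max_ideal_pow.simps
  proof (rule ideal_gen_least[OF super_ideal_max_ideal_pow], clarify)
    fix f g assume "f \<in> max_ideal m n" "g \<in> max_ideal_pow m n k"
    then show "f * g \<in> max_ideal_pow m n k"
      using super_ideal_max_ideal_pow[of m n k] super_ideal_max_ideal[of m n]
      by (simp add: super_ideal_def subset_iff)
  qed
  then show ?thesis by (simp add: antimono_iff_le_Suc)
qed

definition Lam_topology :: "nat \<Rightarrow> nat \<Rightarrow> sps topology" where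
  "Lam_topology m n = filtration_topology (Lam m n) (max_ideal_pow m n)"


section \<open>Derivations\<close>

text \<open>
  Operators on \<open>\<Lambda>(m,n)\<close> are total functions on \<open>sps\<close> that vanish outside \<open>Lam m n\<close>, so that equality and
  pointwise addition of these functions are equality and addition of operators.
\<close>

definition cont_superderivation :: "nat \<Rightarrow> nat \<Rightarrow> nat \<Rightarrow> (sps \<Rightarrow> sps) \<Rightarrow> bool" where
  "cont_superderivation m n s X \<longleftrightarrow>
     (\<forall>f. f \<notin> Lam m n \<longrightarrow> X f = 0) \<and>
     (\<forall>f\<in>Lam m n. X f \<in> Lam m n) \<and>
     (\<forall>f\<in>Lam m n. \<forall>g\<in>Lam m n. X (f + g) = X f + X g) \<and>
     (\<forall>f\<in>Lam m n. \<forall>c. X (smult c f) = smult c (X f)) \<and>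
     (\<forall>f\<in>Lam m n. \<forall>p. has_parity p f \<longrightarrow> has_parity (s + p) (X f)) \<and>
     (\<forall>f\<in>Lam m n. \<forall>g\<in>Lam m n. \<forall>p. has_parity p f \<longrightarrow>
        X (f * g) = X f * g + smult ((-1) ^ (s * p)) (f * X g)) \<and>
     continuous_map (Lam_topology m n) (Lam_topology m n) X"

definition W :: "nat \<Rightarrow> nat \<Rightarrow> (sps \<Rightarrow> sps) set" where
  "W m n = {X + Y | X Y. cont_superderivation m n 0 X \<and> cont_superderivation m n 1 Y}"

text \<open>The odd partial derivatives are left derivatives.\<close>

definition dx :: "nat \<Rightarrow> sps \<Rightarrow> sps" where
  "dx i f = Sps (\<lambda>A S. of_nat (count A i + 1) * sps_nth f (add_mset i A) S)"

definition dxi :: "nat \<Rightarrow> sps \<Rightarrow> sps" where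
  "dxi j f = Sps (\<lambda>A S. if j |\<in>| S then 0
     else (-1) ^ card {i. i |\<in>| S \<and> i < j} * sps_nth f A (finsert j S))"

definition vect_field :: "nat \<Rightarrow> nat \<Rightarrow> (nat \<Rightarrow> sps) \<Rightarrow> (nat \<Rightarrow> sps) \<Rightarrow> sps \<Rightarrow> sps" where
  "vect_field m n P Q f =
     (if f \<in> Lam m n then (\<Sum>i<m. P i * dx i f) + (\<Sum>j<n. Q j * dxi j f) else 0)"

text \<open>
  The component of degree \<open>k\<close> of \<open>X\<close> in the principal grading; the coefficients of \<open>\<partial>/\<partial>x\<^sub>i\<close> and
  \<open>\<partial>/\<partial>\<xi>\<^sub>j\<close> in \<open>X\<close> are \<open>X x\<^sub>i\<close> and \<open>X \<xi>\<^sub>j\<close>.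
\<close>

definition W_proj :: "nat \<Rightarrow> nat \<Rightarrow> int \<Rightarrow> (sps \<Rightarrow> sps) \<Rightarrow> (sps \<Rightarrow> sps)" where
  "W_proj m n k X = vect_field m n
     (\<lambda>i. degree_part (k + 1) (X (xvar i))) (\<lambda>j. degree_part (k + 1) (X (xivar j)))"

definition W_minus1 :: "nat \<Rightarrow> nat \<Rightarrow> (sps \<Rightarrow> sps) set" where
  "W_minus1 m n =
     {vect_field m n (\<lambda>i. smult (c i) 1) (\<lambda>j. smult (d j) 1) | c d. True}"

text \<open>The neighbourhoods of \<open>0\<close> in \<open>W(m,n)\<close> are the products of the components of degree \<open>\<ge> k\<close>.\<close>

definition W_filtration :: "nat \<Rightarrow> nat \<Rightarrow> nat \<Rightarrow> (sps \<Rightarrow> sps) set" where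
  "W_filtration m n k = {X \<in> W m n. \<forall>j < int k. W_proj m n j X = 0}"

lemma antimono_W_filtration: "antimono (W_filtration m n)"
  by (auto simp: antimono_def W_filtration_def)

definition W_topology :: "nat \<Rightarrow> nat \<Rightarrow> (sps \<Rightarrow> sps) topology" where
  "W_topology m n = filtration_topology (W m n) (W_filtration m n)"

text \<open>
  A subalgebra is graded by parity; as the bracket is bilinear, closedness under it
  only needs to be required on homogeneous elements.
\<close>

definition lie_subalgebra :: "nat \<Rightarrow> nat \<Rightarrow> (sps \<Rightarrow> sps) set \<Rightarrow> bool" where
  "lie_subalgebra m n L \<longleftrightarrow> L \<subseteq> W m n \<and> 0 \<in> L \<and>
     (\<forall>X\<in>L. \<forall>Y\<in>L. X + Y \<in> L) \<and>
     (\<forall>X\<in>L. \<forall>c. (\<lambda>f. smult c (X f)) \<in> L) \<and>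
     (\<forall>X\<in>L. \<exists>Y\<in>L. \<exists>Z\<in>L. cont_superderivation m n 0 Y \<and> cont_superderivation m n 1 Z \<and> X = Y + Z) \<and>
     (\<forall>X\<in>L. \<forall>Y\<in>L. \<forall>s\<in>{0, 1}. \<forall>t\<in>{0, 1}.
        cont_superderivation m n s X \<longrightarrow> cont_superderivation m n t Y \<longrightarrow>
        (\<lambda>f. X (Y f) - smult ((-1) ^ (s * t)) (Y (X f))) \<in> L)"

definition transitive :: "nat \<Rightarrow> nat \<Rightarrow> (sps \<Rightarrow> sps) set \<Rightarrow> bool" where
  "transitive m n L \<longleftrightarrow> W_proj m n (-1) ` L = W_minus1 m n"

definition linear_functions :: "nat \<Rightarrow> nat \<Rightarrow> sps set" where
  "linear_functions m n =
     {(\<Sum>i<m. smult (c i) (xvar i)) + (\<Sum>j<n. smult (d j) (xivar j)) | c d. True}"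

definition annihilator :: "nat \<Rightarrow> nat \<Rightarrow> (sps \<Rightarrow> sps) set \<Rightarrow> sps set" where
  "annihilator m n V = {l \<in> linear_functions m n. \<forall>D\<in>V. D l = 0}"

definition W_stab :: "nat \<Rightarrow> nat \<Rightarrow> sps set \<Rightarrow> (sps \<Rightarrow> sps) set" where
  "W_stab m n U = {X \<in> W m n. X ` ideal_gen m n U \<subseteq> ideal_gen m n U}"

definition cont_automorphism :: "nat \<Rightarrow> nat \<Rightarrow> (sps \<Rightarrow> sps) \<Rightarrow> bool" where
  "cont_automorphism m n \<phi> \<longleftrightarrow> bij_betw \<phi> (Lam m n) (Lam m n) \<and>
     (\<forall>f\<in>Lam m n. \<forall>g\<in>Lam m n. \<phi> (f + g) = \<phi> f + \<phi> g \<and> \<phi> (f * g) = \<phi> f * \<phi> g) \<and>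
     (\<forall>f\<in>Lam m n. \<forall>c. \<phi> (smult c f) = smult c (\<phi> f)) \<and>
     (\<forall>f\<in>Lam m n. \<forall>p. has_parity p f \<longrightarrow> has_parity p (\<phi> f)) \<and>
     continuous_map (Lam_topology m n) (Lam_topology m n) \<phi>"

definition induced_aut :: "nat \<Rightarrow> nat \<Rightarrow> (sps \<Rightarrow> sps) \<Rightarrow> (sps \<Rightarrow> sps) \<Rightarrow> (sps \<Rightarrow> sps)" where
  "induced_aut m n \<phi> X f =
     (if f \<in> Lam m n then \<phi> (X (inv_into (Lam m n) \<phi> f)) else 0)"

end

theory Submission
  imports Defs
begin

text \<open>
  Let \<open>I\<close> be the largest \<open>L\<close>-invariant ideal contained in the maximal ideal of \<open>\<Lambda>(m,n)\<close>. Choose a set \<open>Y\<close> of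
  variables that is dual to a basis of the projection \<open>V\<close>. As \<open>L\<close> is closed under brackets, a formal
  Frobenius argument, with Poincare's lemma in each degree, shows that \<open>\<Lambda>(m,n)\<close> is the direct sum of
  \<open>I\<close> and the algebra \<open>\<complex>[[Y]]\<close> of series in the variables of \<open>Y\<close>. Hence for each variable \<open>v\<close> there is a
  unique \<open>\<eta>\<^sub>v \<in> \<complex>[[Y]]\<close> with \<open>v - \<eta>\<^sub>v \<in> I\<close>, and if \<open>\<lambda>\<^sub>v\<close> denotes the linear part of \<open>\<eta>\<^sub>v\<close>, the forms
  \<open>z\<^sub>v = v - \<lambda>\<^sub>v\<close> span \<open>V\<^sup>*\<close>. The even derivation \<open>\<Sum>\<^sub>v (\<eta>\<^sub>v - \<lambda>\<^sub>v) \<partial>/\<partial>v\<close>, summed over \<open>v \<notin> Y\<close>, raises the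
  degree and kills \<open>\<complex>[[Y]]\<close>; its exponential is an automorphism that maps \<open>v - \<eta>\<^sub>v\<close> to \<open>z\<^sub>v\<close>, and therefore \<open>I\<close> to the
  ideal generated by \<open>V\<^sup>*\<close>. This gives (a). For (b), \<open>I\<close> itself is a closed invariant ideal, and it is zero
  if and only if \<open>Y\<close> consists of all variables, that is, if \<open>L\<close> is transitive.
\<close>

section \<open>Coefficients, orders and parities\<close>

text \<open>The fields of \<open>L\<close> dual to \<open>Y\<close> need not commute, need not
  preserve the series in the variables of \<open>Y\<close>, and the odd ones need not square to
  zero, so they cannot simply be replaced by partial derivatives. What survives is weaker: on a
  series of order \<open>k\<close> in the variables of \<open>Y\<close> the field dual to
  \<open>a\<close> acts as \<open>pd a\<close> up to terms of order \<open>k\<close>, and the fields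
  of \<open>L\<close> that vanish at the origin preserve \<open>jet_kernel m n L k\<close> for every
  \<open>k\<close>. This forces an argument degree by degree, with the results assembled into a
  series afterwards. An exponential is used for the automorphism because it comes with its inverse,
  the exponential of the negative, and is multiplicative by the Leibniz rule, whereas a substitution
  of series with odd variables would first have to be constructed. The linear parts are subtracted
  from the coefficients for two reasons: the derivation then raises the degree, and the automorphism
  is the identity on linear parts, so that the annihilator itself appears in the result and not a
  linear image of it.\<close>

type_synonym var = "nat + nat"

text \<open>In \<open>Lam m n\<close> this describes the \<open>k\<close>-th power of the maximal
  ideal, see \<open>max_ideal_pow_eq\<close>; all statements about the topology are reduced to
  it.\<close>

definition order_ge :: "nat \<Rightarrow> sps \<Rightarrow> bool" where
  "order_ge k f \<longleftrightarrow> (\<forall>A S. sps_nth f A S \<noteq> 0 \<longrightarrow> k \<le> size A + fcard S)"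

definition homogeneous :: "nat \<Rightarrow> sps \<Rightarrow> bool" where
  "homogeneous k f \<longleftrightarrow> (\<forall>A S. sps_nth f A S \<noteq> 0 \<longrightarrow> size A + fcard S = k)"

definition Lam_on :: "var set \<Rightarrow> sps set" where
  "Lam_on Y = {f. \<forall>A S. sps_nth f A S \<noteq> 0 \<longrightarrow> Inl ` set_mset A \<union> Inr ` fset S \<subseteq> Y}"

definition variables :: "nat \<Rightarrow> nat \<Rightarrow> var set" where
  "variables m n = Inl ` {..<m} \<union> Inr ` {..<n}"

abbreviation const_coeff :: "sps \<Rightarrow> complex" where
  "const_coeff f \<equiv> sps_nth f {#} {||}"

definition gen :: "var \<Rightarrow> sps" where
  "gen v = (case v of Inl i \<Rightarrow> xvar i | Inr j \<Rightarrow> xivar j)"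

definition pd :: "var \<Rightarrow> sps \<Rightarrow> sps" where
  "pd v = (case v of Inl i \<Rightarrow> dx i | Inr j \<Rightarrow> dxi j)"

definition vpar :: "var \<Rightarrow> nat" where
  "vpar v = (case v of Inl i \<Rightarrow> 0 | Inr j \<Rightarrow> 1)"

lemma finite_variables [simp]: "finite (variables m n)"
  by (simp add: variables_def)

lemma sum_variables:
  "(\<Sum>v\<in>variables m n. F v) = (\<Sum>i<m. F (Inl i)) + (\<Sum>j<n. F (Inr j))"
  unfolding variables_def
  by (subst sum.union_disjoint) (auto simp: sum.reindex)

lemma Lam_eq_Lam_on: "Lam m n = Lam_on (variables m n)"
  unfolding Lam_def Lam_on_def variables_def by (simp add: image_subset_iff subset_iff) blast

lemma sps_nth_simps [simp]:
  "sps_nth 0 A S = 0"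
  "sps_nth (f + g) A S = sps_nth f A S + sps_nth g A S"
  "sps_nth (- f) A S = - sps_nth f A S"
  "sps_nth (f - g) A S = sps_nth f A S - sps_nth g A S"
  "sps_nth (smult c f) A S = c * sps_nth f A S"
  by (simp_all add: zero_sps_def plus_sps_def uminus_sps_def minus_sps_def smult_def)

lemma sps_nth_sum: "sps_nth (\<Sum>i\<in>I. F i) A S = (\<Sum>i\<in>I. sps_nth (F i) A S)"
  by (induction I rule: infinite_finite_induct) auto

lemma sps_nth_one: "sps_nth 1 A S = (if A = {#} \<and> S = {||} then 1 else 0)"
  by (simp add: one_sps_def)

lemma sps_nth_mult:
  "sps_nth (f * g) A S = (\<Sum>p\<in>mdivs A S.
     wedge_sign (snd p) (S |-| snd p) * sps_nth f (fst p) (snd p) * sps_nth g (A - fst p) (S |-| snd p))"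
  by (simp add: times_sps_def case_prod_unfold)

lemma sps_nth_mult_nonzero:
  assumes "sps_nth (f * g) A S \<noteq> 0"
  obtains B T where "B \<subseteq># A" "T |\<subseteq>| S" "sps_nth f B T \<noteq> 0" "sps_nth g (A - B) (S |-| T) \<noteq> 0"
proof -
  obtain p where "p \<in> mdivs A S"
    "wedge_sign (snd p) (S |-| snd p) * sps_nth f (fst p) (snd p) * sps_nth g (A - fst p) (S |-| snd p) \<noteq> 0"
    using assms unfolding sps_nth_mult by (rule sum.not_neutral_contains_not_neutral)
  then show ?thesis
    by (intro that[of "fst p" "snd p"]) (auto simp: mdivs_def)
qed

lemma mdivs_empty [simp]: "mdivs {#} {||} = {({#}, {||})}"
  by (auto simp: mdivs_def)

lemma const_coeff_mult: "const_coeff (f * g) = const_coeff f * const_coeff g"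
  by (simp add: sps_nth_mult)

lemma smult_simps [simp]:
  "smult c 0 = 0" "smult 0 f = 0" "smult 1 f = f" "smult c (smult d f) = smult (c * d) f"
  "smult c f * g = smult c (f * g)" "f * smult c g = smult c (f * g)"
  by (auto intro!: sps_eqI sum.cong simp: sps_nth_mult sum_distrib_left mult_ac)

lemma smult_add: "smult c (f + g) = smult c f + smult c g"
  and smult_diff: "smult c (f - g) = smult c f - smult c g"
  and smult_add_left: "smult (c + d) f = smult c f + smult d f"
  and smult_diff_left: "smult (c - d) f = smult c f - smult d f"
  and smult_minus: "smult c (- f) = - smult c f"
  and smult_minus_left: "smult (- c) f = - smult c f"
  by (auto intro!: sps_eqI simp: algebra_simps)

lemma smult_sum: "smult c (\<Sum>i\<in>I. F i) = (\<Sum>i\<in>I. smult c (F i))"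
  by (auto intro!: sps_eqI simp: sps_nth_sum sum_distrib_left)

lemma smult_sum_left: "smult (\<Sum>i\<in>I. c i) f = (\<Sum>i\<in>I. smult (c i) f)"
  by (auto intro!: sps_eqI simp: sps_nth_sum sum_distrib_right)

lemma fcard_mdivs:
  assumes "B \<subseteq># A" "T |\<subseteq>| S"
  shows "size A = size B + size (A - B)" "fcard S = fcard T + fcard (S |-| T)"
proof -
  show "size A = size B + size (A - B)"
    using assms(1) by (metis size_union subset_mset.add_diff_inverse)
  have "S = T |\<union>| (S |-| T)" using assms(2) by auto
  moreover have "fcard (T |\<union>| (S |-| T)) = fcard T + fcard (S |-| T)"
    by (rule fcard_funion_disjoint) auto
  ultimately show "fcard S = fcard T + fcard (S |-| T)" by simp
qed

lemma order_ge_iff: "order_ge k f \<longleftrightarrow> (\<forall>A S. size A + fcard S < k \<longrightarrow> sps_nth f A S = 0)"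
  unfolding order_ge_def by (metis not_le)

lemma homogeneous_iff: "homogeneous k f \<longleftrightarrow> (\<forall>A S. size A + fcard S \<noteq> k \<longrightarrow> sps_nth f A S = 0)"
  unfolding homogeneous_def by metis

lemma Lam_on_iff:
  "f \<in> Lam_on Y \<longleftrightarrow> (\<forall>A S. \<not> Inl ` set_mset A \<union> Inr ` fset S \<subseteq> Y \<longrightarrow> sps_nth f A S = 0)"
  unfolding Lam_on_def by blast

lemma has_parity_iff: "has_parity p f \<longleftrightarrow> (\<forall>A S. fcard S mod 2 \<noteq> p mod 2 \<longrightarrow> sps_nth f A S = 0)"
  unfolding has_parity_def by metis

lemma order_ge_0 [simp]: "order_ge 0 f"
  by (simp add: order_ge_def)

lemma order_ge_zero [simp]: "order_ge k 0"
  by (simp add: order_ge_def)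

lemma order_ge_add: "order_ge k f \<Longrightarrow> order_ge k g \<Longrightarrow> order_ge k (f + g)"
  and order_ge_diff: "order_ge k f \<Longrightarrow> order_ge k g \<Longrightarrow> order_ge k (f - g)"
  and order_ge_smult: "order_ge k f \<Longrightarrow> order_ge k (smult c f)"
  and order_ge_uminus: "order_ge k f \<Longrightarrow> order_ge k (- f)"
  by (simp_all add: order_ge_iff)

lemma order_ge_sum: "(\<And>i. i \<in> I \<Longrightarrow> order_ge k (F i)) \<Longrightarrow> order_ge k (\<Sum>i\<in>I. F i)"
  by (induction I rule: infinite_finite_induct) (auto intro: order_ge_add)

lemma order_ge_mono: "order_ge k f \<Longrightarrow> j \<le> k \<Longrightarrow> order_ge j f"
  by (simp add: order_ge_iff)

lemma size_plus_fcard_eq_0: "size A + fcard S = 0 \<longleftrightarrow> A = {#} \<and> S = {||}"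
  by (metis add_is_0 fcard_fempty fcard_seteq fempty_fsubsetI le_0_eq size_empty size_eq_0_iff_empty)

lemma order_ge_1_iff: "order_ge (Suc 0) f \<longleftrightarrow> const_coeff f = 0"
  unfolding order_ge_iff less_Suc0 size_plus_fcard_eq_0 by blast

lemma order_ge_mult: "order_ge j f \<Longrightarrow> order_ge k g \<Longrightarrow> order_ge (j + k) (f * g)"
  unfolding order_ge_def
proof (intro allI impI)
  fix A S
  assume *: "\<forall>A S. sps_nth f A S \<noteq> 0 \<longrightarrow> j \<le> size A + fcard S"
    "\<forall>A S. sps_nth g A S \<noteq> 0 \<longrightarrow> k \<le> size A + fcard S" "sps_nth (f * g) A S \<noteq> 0"
  from *(3) obtain B T where BT: "B \<subseteq># A" "T |\<subseteq>| S" "sps_nth f B T \<noteq> 0" "sps_nth g (A - B) (S |-| T) \<noteq> 0"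
    by (rule sps_nth_mult_nonzero)
  with * have "j \<le> size B + fcard T" "k \<le> size (A - B) + fcard (S |-| T)" by blast+
  with fcard_mdivs[OF BT(1,2)] show "j + k \<le> size A + fcard S" by linarith
qed

lemma order_ge_eq_zero: "(\<And>k. order_ge k f) \<Longrightarrow> f = 0"
  unfolding order_ge_iff by (intro sps_eqI) (metis lessI sps_nth_simps(1))

lemma order_ge_homogeneous: "homogeneous k f \<Longrightarrow> order_ge k f"
  by (simp add: homogeneous_def order_ge_def)

lemma homogeneous_add: "homogeneous k f \<Longrightarrow> homogeneous k g \<Longrightarrow> homogeneous k (f + g)"
  and homogeneous_diff: "homogeneous k f \<Longrightarrow> homogeneous k g \<Longrightarrow> homogeneous k (f - g)"
  and homogeneous_smult: "homogeneous k f \<Longrightarrow> homogeneous k (smult c f)"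
  and homogeneous_zero [simp]: "homogeneous k 0"
  by (simp_all add: homogeneous_iff)

lemma homogeneous_sum: "(\<And>i. i \<in> I \<Longrightarrow> homogeneous k (F i)) \<Longrightarrow> homogeneous k (\<Sum>i\<in>I. F i)"
  by (induction I rule: infinite_finite_induct) (auto intro: homogeneous_add)

lemma homogeneous_mult: "homogeneous j f \<Longrightarrow> homogeneous k g \<Longrightarrow> homogeneous (j + k) (f * g)"
  unfolding homogeneous_def
proof (intro allI impI)
  fix A S
  assume *: "\<forall>A S. sps_nth f A S \<noteq> 0 \<longrightarrow> size A + fcard S = j"
    "\<forall>A S. sps_nth g A S \<noteq> 0 \<longrightarrow> size A + fcard S = k" "sps_nth (f * g) A S \<noteq> 0"
  from *(3) obtain B T where BT: "B \<subseteq># A" "T |\<subseteq>| S" "sps_nth f B T \<noteq> 0" "sps_nth g (A - B) (S |-| T) \<noteq> 0"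
    by (rule sps_nth_mult_nonzero)
  with * have "size B + fcard T = j" "size (A - B) + fcard (S |-| T) = k" by blast+
  with fcard_mdivs[OF BT(1,2)] show "size A + fcard S = j + k" by linarith
qed

lemma homogeneous_degree_part: "homogeneous k (degree_part (int k) f)"
  by (auto simp: homogeneous_def degree_part_def)

lemma sps_nth_degree_part:
  "sps_nth (degree_part k f) A S = (if int (size A + fcard S) = k then sps_nth f A S else 0)"
  by (simp add: degree_part_def)

lemma order_ge_diff_degree_part:
  "order_ge k f \<Longrightarrow> order_ge (Suc k) (f - degree_part (int k) f)"
  by (auto simp: order_ge_iff sps_nth_degree_part less_Suc_eq)

lemma degree_part_0: "degree_part 0 f = smult (const_coeff f) 1"
  by (rule sps_eqI) (simp only: sps_nth_degree_part of_nat_eq_0_iff size_plus_fcard_eq_0, simp add: sps_nth_one)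

lemma homogeneous_0_eq: "homogeneous 0 f \<Longrightarrow> f = smult (const_coeff f) 1"
  unfolding homogeneous_iff size_plus_fcard_eq_0 by (rule sps_eqI) (auto simp: sps_nth_one)

text \<open>The sum of the series \<open>p 0 + p 1 + ...\<close> when each \<open>p k\<close> is
  homogeneous of degree \<open>k\<close>. A monomial receives its coefficient from a single summand,
  so no limit is involved.\<close>

definition assemble :: "(nat \<Rightarrow> sps) \<Rightarrow> sps" where
  "assemble p = Sps (\<lambda>A S. sps_nth (p (size A + fcard S)) A S)"

lemma sps_nth_assemble: "sps_nth (assemble p) A S = sps_nth (p (size A + fcard S)) A S"
  by (simp add: assemble_def)

lemma assemble_Lam_on: "(\<And>k. p k \<in> Lam_on Y) \<Longrightarrow> assemble p \<in> Lam_on Y"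
  by (simp add: Lam_on_def assemble_def)

lemma order_ge_assemble_diff:
  assumes "\<And>k. homogeneous k (p k)"
  shows "order_ge k (assemble p - (\<Sum>i<k. p i))"
  unfolding order_ge_def
proof (intro allI impI)
  fix A S assume nz: "sps_nth (assemble p - (\<Sum>i<k. p i)) A S \<noteq> 0"
  show "k \<le> size A + fcard S"
  proof (rule ccontr)
    assume "\<not> k \<le> size A + fcard S"
    moreover have "(\<Sum>i<k. sps_nth (p i) A S)
        = (\<Sum>i<k. if i = size A + fcard S then sps_nth (p i) A S else 0)"
      using assms by (intro sum.cong) (auto simp: homogeneous_def)
    ultimately show False
      using nz by (simp add: sps_nth_sum sps_nth_assemble)
  qed
qed

lemma sps_nth_parity_part:
  "sps_nth (parity_part p f) A S = (if fcard S mod 2 = p mod 2 then sps_nth f A S else 0)"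
  by (simp add: parity_part_def)

lemma Lam_on_zero [simp]: "0 \<in> Lam_on Y"
  and Lam_on_one [simp]: "1 \<in> Lam_on Y"
  and Lam_on_add: "f \<in> Lam_on Y \<Longrightarrow> g \<in> Lam_on Y \<Longrightarrow> f + g \<in> Lam_on Y"
  and Lam_on_diff: "f \<in> Lam_on Y \<Longrightarrow> g \<in> Lam_on Y \<Longrightarrow> f - g \<in> Lam_on Y"
  and Lam_on_smult: "f \<in> Lam_on Y \<Longrightarrow> smult c f \<in> Lam_on Y"
  and Lam_on_parity_part: "f \<in> Lam_on Y \<Longrightarrow> parity_part p f \<in> Lam_on Y"
  and Lam_on_degree_part: "f \<in> Lam_on Y \<Longrightarrow> degree_part d f \<in> Lam_on Y"
  by (auto simp: Lam_on_iff sps_nth_one sps_nth_parity_part sps_nth_degree_part)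

lemma Lam_on_sum: "(\<And>i. i \<in> I \<Longrightarrow> F i \<in> Lam_on Y) \<Longrightarrow> (\<Sum>i\<in>I. F i) \<in> Lam_on Y"
  by (induction I rule: infinite_finite_induct) (auto intro: Lam_on_add)

lemma Lam_on_mono: "Y \<subseteq> Z \<Longrightarrow> Lam_on Y \<subseteq> Lam_on Z"
  unfolding Lam_on_def by blast

lemma Lam_on_mult:
  assumes "f \<in> Lam_on Y" "g \<in> Lam_on Y"
  shows "f * g \<in> Lam_on Y"
  unfolding Lam_on_def
proof (intro CollectI allI impI)
  fix A S assume "sps_nth (f * g) A S \<noteq> 0"
  then obtain B T where BT: "B \<subseteq># A" "T |\<subseteq>| S" "sps_nth f B T \<noteq> 0" "sps_nth g (A - B) (S |-| T) \<noteq> 0"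
    by (rule sps_nth_mult_nonzero)
  have "set_mset A = set_mset B \<union> set_mset (A - B)"
    using BT(1) set_mset_union[of B "A - B"] by simp
  moreover have "fset S = fset T \<union> fset (S |-| T)" using BT(2) by auto
  moreover have "Inl ` set_mset B \<union> Inr ` fset T \<subseteq> Y"
    "Inl ` set_mset (A - B) \<union> Inr ` fset (S |-| T) \<subseteq> Y"
    using assms BT(3,4) unfolding Lam_on_def by blast+
  ultimately show "Inl ` set_mset A \<union> Inr ` fset S \<subseteq> Y" by blast
qed

lemma has_parity_zero [simp]: "has_parity p 0"
  and has_parity_add: "has_parity p f \<Longrightarrow> has_parity p g \<Longrightarrow> has_parity p (f + g)"
  and has_parity_diff: "has_parity p f \<Longrightarrow> has_parity p g \<Longrightarrow> has_parity p (f - g)"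
  and has_parity_smult: "has_parity p f \<Longrightarrow> has_parity p (smult c f)"
  and has_parity_parity_part [simp]: "has_parity p (parity_part p f)"
  and has_parity_one [simp]: "has_parity 0 1"
  by (auto simp: has_parity_iff sps_nth_parity_part sps_nth_one fcard_fempty)

lemma has_parity_mod: "p mod 2 = q mod 2 \<Longrightarrow> has_parity p f \<longleftrightarrow> has_parity q f"
  by (simp add: has_parity_def)

lemma has_parity_sum: "(\<And>i. i \<in> I \<Longrightarrow> has_parity p (F i)) \<Longrightarrow> has_parity p (\<Sum>i\<in>I. F i)"
  by (induction I rule: infinite_finite_induct) (auto intro: has_parity_add)

lemma has_parity_mult: "has_parity p f \<Longrightarrow> has_parity q g \<Longrightarrow> has_parity (p + q) (f * g)"
  unfolding has_parity_def
proof (intro allI impI)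
  fix A S
  assume *: "\<forall>A S. sps_nth f A S \<noteq> 0 \<longrightarrow> fcard S mod 2 = p mod 2"
    "\<forall>A S. sps_nth g A S \<noteq> 0 \<longrightarrow> fcard S mod 2 = q mod 2" "sps_nth (f * g) A S \<noteq> 0"
  from *(3) obtain B T where BT: "B \<subseteq># A" "T |\<subseteq>| S" "sps_nth f B T \<noteq> 0" "sps_nth g (A - B) (S |-| T) \<noteq> 0"
    by (rule sps_nth_mult_nonzero)
  with * fcard_mdivs(2)[OF BT(1,2)] have "fcard S = fcard T + fcard (S |-| T)"
    "fcard T mod 2 = p mod 2" "fcard (S |-| T) mod 2 = q mod 2" by blast+
  then show "fcard S mod 2 = (p + q) mod 2" by (metis mod_add_cong)
qed

lemma parity_decomp: "f = parity_part 0 f + parity_part 1 f"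
  by (rule sps_eqI) (auto simp: sps_nth_parity_part)

lemma parity_part_simps:
  "parity_part p (f + g) = parity_part p f + parity_part p g"
  "parity_part p (f - g) = parity_part p f - parity_part p g"
  "parity_part p (smult c f) = smult c (parity_part p f)"
  "parity_part p 0 = 0"
  by (auto intro!: sps_eqI simp: sps_nth_parity_part)

lemma parity_part_eq: "has_parity p f \<Longrightarrow> parity_part q f = (if p mod 2 = q mod 2 then f else 0)"
  by (auto intro!: sps_eqI simp: sps_nth_parity_part has_parity_iff)

lemma order_ge_parity_part: "order_ge k f \<Longrightarrow> order_ge k (parity_part p f)"
  by (auto simp: order_ge_def sps_nth_parity_part)

section \<open>Supercommutativity and partial derivatives\<close>

lemma minus_one_power_parity:
  "a mod 2 = b mod 2 \<Longrightarrow> (-1 :: complex) ^ a = (-1) ^ b"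
  by (simp add: minus_one_power_iff even_iff_mod_2_eq_zero)

lemma finite_inversions: "finite {(i, j). i |\<in>| T \<and> j |\<in>| R \<and> (j::nat) < i}"
  by (rule finite_subset[of _ "fset T \<times> fset R"]) auto

lemma wedge_sign_union_right:
  assumes "R |\<inter>| Q = {||}"
  shows "wedge_sign U (R |\<union>| Q) = wedge_sign U R * wedge_sign U Q"
proof -
  have "{(i, j). i |\<in>| U \<and> j |\<in>| R |\<union>| Q \<and> j < i}
      = {(i, j). i |\<in>| U \<and> j |\<in>| R \<and> j < i} \<union> {(i, j). i |\<in>| U \<and> j |\<in>| Q \<and> j < i}" by auto
  moreover have "{(i, j). i |\<in>| U \<and> j |\<in>| R \<and> j < i} \<inter> {(i, j). i |\<in>| U \<and> j |\<in>| Q \<and> j < i} = {}"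
    using assms by auto
  ultimately show ?thesis
    unfolding wedge_sign_def by (simp add: card_Un_disjoint finite_inversions power_add)
qed

lemma wedge_sign_union_left:
  assumes "R |\<inter>| Q = {||}"
  shows "wedge_sign (R |\<union>| Q) U = wedge_sign R U * wedge_sign Q U"
proof -
  have "{(i, j). i |\<in>| R |\<union>| Q \<and> j |\<in>| U \<and> j < i}
      = {(i, j). i |\<in>| R \<and> j |\<in>| U \<and> j < i} \<union> {(i, j). i |\<in>| Q \<and> j |\<in>| U \<and> j < i}" by auto
  moreover have "{(i, j). i |\<in>| R \<and> j |\<in>| U \<and> j < i} \<inter> {(i, j). i |\<in>| Q \<and> j |\<in>| U \<and> j < i} = {}"
    using assms by auto
  ultimately show ?thesis
    unfolding wedge_sign_def by (simp add: card_Un_disjoint finite_inversions power_add)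
qed

lemma wedge_sign_square [simp]: "wedge_sign T R * wedge_sign T R = 1"
  by (simp add: wedge_sign_def flip: power_add)

lemma wedge_sign_square_left [simp]: "wedge_sign T R * (wedge_sign T R * x) = x"
  by (metis mult.assoc mult_1 wedge_sign_square)

text \<open>For disjoint sets each pair in \<open>T \<times> R\<close> is an inversion in exactly
  one of the two orders, so the two inversion counts add up to
  \<open>fcard T * fcard R\<close>.\<close>

lemma wedge_sign_commute:
  assumes "T |\<inter>| R = {||}"
  shows "wedge_sign R T = (-1) ^ (fcard T * fcard R) * wedge_sign T R"
proof -
  let ?I = "\<lambda>T R. {(i, j). i |\<in>| T \<and> j |\<in>| R \<and> (j::nat) < i}"
  have "?I T R \<union> (\<lambda>(i, j). (j, i)) ` ?I R T = fset T \<times> fset R"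
    using assms by (auto simp: image_iff)
  moreover have "?I T R \<inter> (\<lambda>(i, j). (j, i)) ` ?I R T = {}" by auto
  moreover have "card ((\<lambda>(i, j). (j, i)) ` ?I R T) = card (?I R T)"
    by (rule card_image) (auto simp: inj_on_def)
  ultimately have "card (?I T R) + card (?I R T) = fcard T * fcard R"
    using card_Un_disjoint[of "?I T R" "(\<lambda>(i, j). (j, i)) ` ?I R T"]
    by (simp add: card_cartesian_product fcard.rep_eq finite_inversions)
  then have "wedge_sign T R * wedge_sign R T = (-1) ^ (fcard T * fcard R)"
    by (simp add: wedge_sign_def flip: power_add)
  then have "wedge_sign T R * (wedge_sign T R * wedge_sign R T) = wedge_sign T R * (-1) ^ (fcard T * fcard R)"
    by simp
  then show ?thesis by simp
qed

text \<open>Passing to the complementary divisor \<open>(A - B, S |-| T)\<close> exchanges the two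
  factors. On the supports of \<open>f\<close> and \<open>g\<close> the cardinalities have parities
  \<open>p\<close> and \<open>q\<close>, which turns the sign of \<open>wedge_sign_commute\<close>
  into a constant.\<close>

lemma supercommute:
  assumes f: "has_parity p f" and g: "has_parity q g"
  shows "f * g = smult ((-1) ^ (p * q)) (g * f)"
proof (rule sps_eqI)
  fix A S
  have "sps_nth (f * g) A S = (\<Sum>r\<in>mdivs A S. (-1) ^ (p * q) *
      (wedge_sign (S |-| snd r) (snd r) * sps_nth g (A - fst r) (S |-| snd r) * sps_nth f (fst r) (snd r)))"
    unfolding sps_nth_mult
  proof (rule sum.cong[OF refl])
    fix r assume "r \<in> mdivs A S"
    obtain B T where r: "r = (B, T)" by (cases r)
    show "wedge_sign (snd r) (S |-| snd r) * sps_nth f (fst r) (snd r) * sps_nth g (A - fst r) (S |-| snd r)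
      = (-1) ^ (p * q) *
      (wedge_sign (S |-| snd r) (snd r) * sps_nth g (A - fst r) (S |-| snd r) * sps_nth f (fst r) (snd r))"
    proof (cases "sps_nth f B T = 0 \<or> sps_nth g (A - B) (S |-| T) = 0")
      case False
      then have "fcard T mod 2 = p mod 2" "fcard (S |-| T) mod 2 = q mod 2"
        using f g unfolding has_parity_def by blast+
      then have "(fcard T * fcard (S |-| T)) mod 2 = (p * q) mod 2"
        by (metis mod_mult_eq)
      then have "(-1 :: complex) ^ (fcard T * fcard (S |-| T)) = (-1) ^ (p * q)"
        by (rule minus_one_power_parity)
      moreover have "wedge_sign (S |-| T) T = (-1) ^ (fcard T * fcard (S |-| T)) * wedge_sign T (S |-| T)"
        by (rule wedge_sign_commute) auto
      ultimately show ?thesis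
        by (simp add: r mult_ac flip: power_mult_distrib)
    qed (auto simp: r)
  qed
  also have "\<dots> = (-1) ^ (p * q) * (\<Sum>r\<in>mdivs A S.
      wedge_sign (S |-| snd r) (snd r) * sps_nth g (A - fst r) (S |-| snd r) * sps_nth f (fst r) (snd r))"
    by (simp add: sum_distrib_left)
  also have "(\<Sum>r\<in>mdivs A S.
      wedge_sign (S |-| snd r) (snd r) * sps_nth g (A - fst r) (S |-| snd r) * sps_nth f (fst r) (snd r))
     = sps_nth (g * f) A S"
    unfolding sps_nth_mult
  proof (rule sum.reindex_bij_witness[where i = "\<lambda>r. (A - fst r, S |-| snd r)"
        and j = "\<lambda>r. (A - fst r, S |-| snd r)"])
    have *: "A - (A - B) = B" "S |-| (S |-| T) = T" if "B \<subseteq># A" "T |\<subseteq>| S" for B T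
      using that by (auto simp: double_diff multiset_eq_iff mset_subset_eq_count subseteq_mset_def)
    fix r assume "r \<in> mdivs A S"
    then have r: "fst r \<subseteq># A" "snd r |\<subseteq>| S" by (auto simp: mdivs_def)
    show "(A - fst (A - fst r, S |-| snd r), S |-| snd (A - fst r, S |-| snd r)) = r"
      "(A - fst (A - fst r, S |-| snd r), S |-| snd (A - fst r, S |-| snd r)) = r"
      using *[OF r] by simp_all
    show "(A - fst r, S |-| snd r) \<in> mdivs A S" "(A - fst r, S |-| snd r) \<in> mdivs A S"
      by (auto simp: mdivs_def)
    show "wedge_sign (snd (A - fst r, S |-| snd r)) (S |-| snd (A - fst r, S |-| snd r)) *
         sps_nth g (fst (A - fst r, S |-| snd r)) (snd (A - fst r, S |-| snd r)) *
         sps_nth f (A - fst (A - fst r, S |-| snd r)) (S |-| snd (A - fst r, S |-| snd r)) =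
         wedge_sign (S |-| snd r) (snd r) * sps_nth g (A - fst r) (S |-| snd r) * sps_nth f (fst r) (snd r)"
      using *[OF r] by simp
  qed
  finally show "sps_nth (f * g) A S = sps_nth (smult ((-1) ^ (p * q)) (g * f)) A S" by simp
qed

section \<open>Generators and left partial derivatives, coefficient by coefficient\<close>

lemma vpar_cases: "vpar v = 0 \<or> vpar v = 1"
  by (cases v) (simp_all add: vpar_def)

lemma gen_nth:
  "sps_nth (gen (Inl i)) A S = (if A = {#i#} \<and> S = {||} then 1 else 0)"
  "sps_nth (gen (Inr j)) A S = (if A = {#} \<and> S = {|j|} then 1 else 0)"
  by (simp_all add: gen_def xvar_def xivar_def)

lemma pd_nth_even: "sps_nth (pd (Inl i) f) A S = of_nat (count A i + 1) * sps_nth f (add_mset i A) S"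
  by (simp add: pd_def dx_def)

text \<open>The sign in \<open>dxi\<close> is that of sorting \<open>j\<close> into
  \<open>S\<close>; in the form of a \<open>wedge_sign\<close> it obeys the same union rules as the
  signs of a product.\<close>

lemma pd_nth_odd: "sps_nth (pd (Inr j) f) A S
    = (if j |\<in>| S then 0 else wedge_sign {|j|} S * sps_nth f A (finsert j S))"
proof -
  have "{(i, k). i |\<in>| {|j|} \<and> k |\<in>| S \<and> k < i} = Pair j ` {i. i |\<in>| S \<and> i < j}" by auto
  then have "card {(i, k). i |\<in>| {|j|} \<and> k |\<in>| S \<and> k < i} = card {i. i |\<in>| S \<and> i < j}"
    by (simp add: card_image inj_on_def)
  then show ?thesis by (simp add: pd_def dxi_def wedge_sign_def)
qed

lemma gen_Lam_on: "v \<in> Y \<Longrightarrow> gen v \<in> Lam_on Y"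
  by (cases v) (auto simp: Lam_on_iff gen_nth)

lemma homogeneous_gen: "homogeneous 1 (gen v)"
  by (cases v) (auto simp: homogeneous_def gen_nth fcard_fempty fcard_finsert_if)

lemma has_parity_gen: "has_parity (vpar v) (gen v)"
  by (cases v) (auto simp: has_parity_def gen_nth vpar_def fcard_fempty fcard_finsert_if)

lemma const_coeff_gen [simp]: "const_coeff (gen v) = 0"
  by (cases v) (auto simp: gen_nth)

lemma order_ge_gen: "order_ge (Suc 0) (gen v)"
  by (simp add: order_ge_1_iff)

lemma pd_gen: "pd v (gen w) = (if v = w then 1 else 0)"
  by (rule sps_eqI; cases v; cases w)
    (auto simp: pd_nth_even pd_nth_odd gen_nth sps_nth_one)

lemma pd_add: "pd v (f + g) = pd v f + pd v g"
  and pd_diff: "pd v (f - g) = pd v f - pd v g"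
  and pd_smult: "pd v (smult c f) = smult c (pd v f)"
  and pd_zero [simp]: "pd v 0 = 0"
  by (rule sps_eqI; cases v; simp add: pd_nth_even pd_nth_odd algebra_simps)+

lemma pd_sum: "pd v (\<Sum>i\<in>I. F i) = (\<Sum>i\<in>I. pd v (F i))"
  by (induction I rule: infinite_finite_induct) (simp_all add: pd_add)

lemma pd_one [simp]: "pd v 1 = 0"
  by (rule sps_eqI; cases v; simp add: pd_nth_even pd_nth_odd sps_nth_one)

lemma pd_Lam_on: "f \<in> Lam_on Y \<Longrightarrow> pd v f \<in> Lam_on Y"
  by (cases v) (auto simp: Lam_on_iff pd_nth_even pd_nth_odd)

lemma pd_Lam_on_eq_0: "f \<in> Lam_on Y \<Longrightarrow> v \<notin> Y \<Longrightarrow> pd v f = 0"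
  by (rule sps_eqI; cases v) (auto simp: Lam_on_iff pd_nth_even pd_nth_odd)

lemma has_parity_pd: "has_parity p f \<Longrightarrow> has_parity (vpar v + p) (pd v f)"
proof (cases v)
  case (Inr j)
  assume f: "has_parity p f"
  show ?thesis
    unfolding has_parity_def Inr pd_nth_odd
  proof (intro allI impI)
    fix A S
    assume "(if j |\<in>| S then 0 else wedge_sign {|j|} S * sps_nth f A (finsert j S)) \<noteq> 0"
    then have "j |\<notin>| S" "sps_nth f A (finsert j S) \<noteq> 0" by (auto split: if_splits)
    then have "Suc (fcard S) mod 2 = p mod 2"
      using f unfolding has_parity_def by (metis fcard_finsert_disjoint)
    then show "fcard S mod 2 = (vpar (Inr j) + p) mod 2"
      unfolding vpar_def by simp presburger
  qed
qed (auto simp: has_parity_iff pd_nth_even vpar_def)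

lemma order_ge_pd: "order_ge (Suc k) f \<Longrightarrow> order_ge k (pd v f)"
  by (cases v) (auto simp: order_ge_iff pd_nth_even pd_nth_odd fcard_finsert_disjoint)

lemma homogeneous_pd: "homogeneous (Suc k) f \<Longrightarrow> homogeneous k (pd v f)"
  by (cases v) (auto simp: homogeneous_iff pd_nth_even pd_nth_odd fcard_finsert_disjoint)

lemma gen_mult_nth_even:
  "sps_nth (gen (Inl i) * f) A S = (if i \<in># A then sps_nth f (A - {#i#}) S else 0)"
proof -
  have "sps_nth (gen (Inl i) * f) A S
      = (\<Sum>p\<in>mdivs A S. if p = ({#i#}, {||}) then sps_nth f (A - {#i#}) S else 0)"
    unfolding sps_nth_mult by (rule sum.cong) (auto simp: gen_nth)
  then show ?thesis by (simp add: sum.delta) (simp add: mdivs_def)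
qed

lemma gen_mult_nth_odd:
  "sps_nth (gen (Inr j) * f) A S
    = (if j |\<in>| S then wedge_sign {|j|} (S |-| {|j|}) * sps_nth f A (S |-| {|j|}) else 0)"
proof -
  have "sps_nth (gen (Inr j) * f) A S
      = (\<Sum>p\<in>mdivs A S. if p = ({#}, {|j|}) then wedge_sign {|j|} (S |-| {|j|}) * sps_nth f A (S |-| {|j|}) else 0)"
    unfolding sps_nth_mult by (rule sum.cong[OF refl]) (simp add: gen_nth prod_eq_iff)
  then show ?thesis by (simp add: sum.delta) (simp add: mdivs_def)
qed

text \<open>\<open>gen v * pd v\<close> multiplies each monomial by its exponent of
  \<open>v\<close>, which is \<open>0\<close> or \<open>1\<close> for odd \<open>v\<close>. All
  variables of a monomial in the support of \<open>f\<close> lie in \<open>Y\<close>, so these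
  exponents add up to the total degree.\<close>

lemma euler:
  assumes "finite Y" and f: "f \<in> Lam_on Y"
  shows "sps_nth (\<Sum>v\<in>Y. gen v * pd v f) A S = of_nat (size A + fcard S) * sps_nth f A S"
proof (cases "sps_nth f A S = 0")
  case False
  define wt where "wt = (\<lambda>v. case v of Inl i \<Rightarrow> count A i | Inr j \<Rightarrow> if j |\<in>| S then 1 else 0)"
  have sub: "Inl ` set_mset A \<union> Inr ` fset S \<subseteq> Y"
    using f False unfolding Lam_on_def by blast
  have "sps_nth (gen v * pd v f) A S = of_nat (wt v) * sps_nth f A S" for v
  proof (cases v)
    case (Inl i)
    then show ?thesis
      by (auto simp: gen_mult_nth_even pd_nth_even wt_def not_in_iff)
  next
    case (Inr j)
    then show ?thesis
      by (simp add: gen_mult_nth_odd pd_nth_odd wt_def finsert_absorb)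
  qed
  then have "sps_nth (\<Sum>v\<in>Y. gen v * pd v f) A S = of_nat (\<Sum>v\<in>Y. wt v) * sps_nth f A S"
    by (simp add: sps_nth_sum sum_distrib_right)
  also have "(\<Sum>v\<in>Y. wt v) = (\<Sum>v\<in>Inl ` set_mset A \<union> Inr ` fset S. wt v)"
    using sub assms(1) by (intro sum.mono_neutral_right) (auto simp: wt_def not_in_iff image_iff split: sum.splits)
  also have "\<dots> = (\<Sum>i\<in>set_mset A. count A i) + (\<Sum>j\<in>fset S. 1)"
    by (subst sum.union_disjoint) (auto simp: sum.reindex wt_def)
  also have "\<dots> = size A + fcard S"
    by (simp add: size_multiset_overloaded_eq fcard.rep_eq)
  finally show ?thesis .
next
  case True
  have "sps_nth (gen v * pd v f) A S = 0" for v
    by (cases v) (auto simp: gen_mult_nth_odd pd_nth_odd gen_mult_nth_even pd_nth_even True finsert_absorb)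
  with True show ?thesis by (simp add: sps_nth_sum)
qed

lemma euler_homogeneous:
  assumes "finite Y" "f \<in> Lam_on Y" "homogeneous k f"
  shows "(\<Sum>v\<in>Y. gen v * pd v f) = smult (of_nat k) f"
proof (rule sps_eqI)
  fix A S
  show "sps_nth (\<Sum>v\<in>Y. gen v * pd v f) A S = sps_nth (smult (of_nat k) f) A S"
    unfolding euler[OF assms(1,2)] using assms(3) by (cases "sps_nth f A S = 0") (auto simp: homogeneous_def)
qed

text \<open>Dividing the coefficients of \<open>f\<close> by their degrees turns Euler's formula into an expansion of \<open>f\<close>.\<close>

lemma gen_expansion:
  assumes Y: "finite Y" and f: "f \<in> Lam_on Y" "order_ge (Suc k) f"
  obtains q where "\<And>v. q v \<in> Lam_on Y" "\<And>v. order_ge k (q v)" "f = (\<Sum>v\<in>Y. gen v * q v)"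
proof -
  define f' where "f' = Sps (\<lambda>A S. sps_nth f A S / of_nat (size A + fcard S))"
  have f': "sps_nth f' A S = sps_nth f A S / of_nat (size A + fcard S)" for A S
    by (simp add: f'_def)
  have "f' \<in> Lam_on Y" "order_ge (Suc k) f'"
    using f by (simp_all add: Lam_on_iff order_ge_iff f')
  moreover have "f = (\<Sum>v\<in>Y. gen v * pd v f')"
  proof (rule sps_eqI)
    fix A S
    \<comment> \<open>At the constant monomial the quotient is a division by \<open>0\<close> and
      has the value \<open>0\<close>; this is harmless since \<open>f\<close> has no constant
      term.\<close>
    show "sps_nth f A S = sps_nth (\<Sum>v\<in>Y. gen v * pd v f') A S"
      unfolding euler[OF Y \<open>f' \<in> Lam_on Y\<close>] f'
      using order_ge_mono[OF f(2), of "Suc 0"] by (cases "size A + fcard S = 0")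
        (simp_all add: size_plus_fcard_eq_0 order_ge_1_iff del: of_nat_add)
  qed
  ultimately show ?thesis
    by (intro that[of "\<lambda>v. pd v f'"]) (auto intro: pd_Lam_on order_ge_pd)
qed

section \<open>The Leibniz rule for even and odd left derivatives\<close>

lemma sum_mdivs_finsert:
  assumes "j |\<notin>| S"
  shows "(\<Sum>p\<in>mdivs A (finsert j S). F p)
    = (\<Sum>p\<in>mdivs A S. F p) + (\<Sum>p\<in>mdivs A S. F (fst p, finsert j (snd p)))"
proof -
  let ?h = "\<lambda>p. (fst p, finsert j (snd p))"
  have "T \<in> (\<lambda>p. snd (?h p)) ` mdivs A S \<or> T |\<subseteq>| S" if "T |\<subseteq>| finsert j S" for T
  proof (cases "j |\<in>| T")
    case True
    then have "T = snd (?h ({#}, T |-| {|j|}))" by auto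
    moreover have "({#}, T |-| {|j|}) \<in> mdivs A S" using that by (auto simp: mdivs_def)
    ultimately show ?thesis by blast
  qed (use that in auto)
  have "mdivs A (finsert j S) = mdivs A S \<union> ?h ` mdivs A S"
  proof (intro equalityI subsetI)
    fix p assume "p \<in> mdivs A (finsert j S)"
    then have p: "fst p \<subseteq># A" "snd p |\<subseteq>| finsert j S" by (auto simp: mdivs_def)
    show "p \<in> mdivs A S \<union> ?h ` mdivs A S"
    proof (cases "j |\<in>| snd p")
      case True
      then have "p = ?h (fst p, snd p |-| {|j|})" by (cases p) auto
      moreover have "(fst p, snd p |-| {|j|}) \<in> mdivs A S" using p by (auto simp: mdivs_def)
      ultimately show ?thesis by blast
    next
      case False
      then have "p \<in> mdivs A S" using p by (cases p) (auto simp: mdivs_def)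
      then show ?thesis by blast
    qed
  next
    fix p assume "p \<in> mdivs A S \<union> ?h ` mdivs A S"
    then show "p \<in> mdivs A (finsert j S)" by (auto simp: mdivs_def)
  qed
  moreover have "mdivs A S \<inter> ?h ` mdivs A S = {}"
    using assms by (auto simp: mdivs_def)
  moreover have "inj_on ?h (mdivs A S)"
  proof (rule inj_onI)
    fix p q assume "p \<in> mdivs A S" "q \<in> mdivs A S" "?h p = ?h q"
    moreover from this have "j |\<notin>| snd p" "j |\<notin>| snd q"
      using assms by (auto simp: mdivs_def)
    ultimately have "fst p = fst q" "snd p = snd q"
      by (simp, metis finsert_ident Pair_inject)
    then show "p = q" by (simp add: prod_eq_iff)
  qed
  ultimately show ?thesis
    by (simp add: sum.union_disjoint sum.reindex)
qed

lemma wedge_sign_finsert: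
  "j |\<notin>| T \<Longrightarrow> wedge_sign (finsert j T) R = wedge_sign {|j|} R * wedge_sign T R"
  "j |\<notin>| R \<Longrightarrow> wedge_sign T (finsert j R) = wedge_sign T {|j|} * wedge_sign T R"
  using wedge_sign_union_left[of "{|j|}" T R] wedge_sign_union_right[of "{|j|}" R T]
  by auto

text \<open>The exponent of the variable \<open>i\<close> in a monomial is the sum of its exponents
  in a divisor and in the complement. Weighting the terms of the product by these two exponents
  splits the sum into the two terms of the rule.\<close>

lemma pd_mult_even: "pd (Inl i) (f * g) = pd (Inl i) f * g + f * pd (Inl i) g"
proof (rule sps_eqI)
  fix A S
  let ?A = "add_mset i A"
  let ?G = "\<lambda>p. wedge_sign (snd p) (S |-| snd p) * sps_nth f (fst p) (snd p) * sps_nth g (?A - fst p) (S |-| snd p)"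
  have "sps_nth (pd (Inl i) (f * g)) A S = of_nat (count ?A i) * (\<Sum>p\<in>mdivs ?A S. ?G p)"
    by (simp add: pd_nth_even sps_nth_mult)
  also have "\<dots> = (\<Sum>p\<in>mdivs ?A S. of_nat (count (fst p) i) * ?G p)
      + (\<Sum>p\<in>mdivs ?A S. of_nat (count (?A - fst p) i) * ?G p)"
    unfolding sum_distrib_left sum.distrib[symmetric]
  proof (rule sum.cong[OF refl])
    fix p assume "p \<in> mdivs ?A S"
    then have "fst p \<subseteq># ?A" by (auto simp: mdivs_def)
    then have "count ?A i = count (fst p) i + count (?A - fst p) i"
      by (metis count_union subset_mset.add_diff_inverse)
    then show "of_nat (count ?A i) * ?G p
        = of_nat (count (fst p) i) * ?G p + of_nat (count (?A - fst p) i) * ?G p"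
      by (simp add: ring_distribs)
  qed
  also have "(\<Sum>p\<in>mdivs ?A S. of_nat (count (fst p) i) * ?G p)
      = (\<Sum>p\<in>{p \<in> mdivs ?A S. i \<in># fst p}. of_nat (count (fst p) i) * ?G p)"
    by (rule sum.mono_neutral_right) (auto simp: not_in_iff)
  also have "\<dots> = sps_nth (pd (Inl i) f * g) A S"
    unfolding sps_nth_mult
  proof (rule sum.reindex_bij_witness[
        where i = "\<lambda>p. (add_mset i (fst p), snd p)" and j = "\<lambda>p. (fst p - {#i#}, snd p)"])
    fix p assume p: "p \<in> {p \<in> mdivs ?A S. i \<in># fst p}"
    then show "(add_mset i (fst (fst p - {#i#}, snd p)), snd (fst p - {#i#}, snd p)) = p"
      by (cases p) auto
    show "(fst p - {#i#}, snd p) \<in> mdivs A S"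
      using p by (auto simp: mdivs_def subset_eq_diff_conv)
    obtain B T where BT: "p = (add_mset i B, T)"
      using p by (cases p) (auto dest!: multi_member_split)
    show "wedge_sign (snd (fst p - {#i#}, snd p)) (S |-| snd (fst p - {#i#}, snd p)) *
         sps_nth (pd (Inl i) f) (fst (fst p - {#i#}, snd p)) (snd (fst p - {#i#}, snd p)) *
         sps_nth g (A - fst (fst p - {#i#}, snd p)) (S |-| snd (fst p - {#i#}, snd p)) =
         of_nat (count (fst p) i) * ?G p"
      unfolding BT by (simp add: pd_nth_even)
  qed (auto simp: mdivs_def)
  also have "(\<Sum>p\<in>mdivs ?A S. of_nat (count (?A - fst p) i) * ?G p)
      = (\<Sum>p\<in>mdivs A S. of_nat (count (?A - fst p) i) * ?G p)"
  proof (rule sum.mono_neutral_right)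
    show "mdivs A S \<subseteq> mdivs ?A S"
      by (auto simp: mdivs_def intro: subset_mset.order_trans)
    show "\<forall>p\<in>mdivs ?A S - mdivs A S. of_nat (count (?A - fst p) i) * ?G p = 0"
    proof
      fix p assume p: "p \<in> mdivs ?A S - mdivs A S"
      \<comment> \<open>A divisor of \<open>?A\<close> that does not divide \<open>A\<close> uses up
        all copies of \<open>i\<close>, so the weight of its complement is \<open>0\<close>.\<close>
      have "count ?A i \<le> count (fst p) i"
      proof (rule ccontr)
        assume lt: "\<not> count ?A i \<le> count (fst p) i"
        have "count (fst p) k \<le> count ?A k" for k
          using p mset_subset_eq_count[of "fst p" ?A k] by (simp only: mdivs_def mem_Times_iff Diff_iff mem_Collect_eq)
        then have "count (fst p) k \<le> count A k" for k
          using lt by (metis count_add_mset not_less_eq_eq nle_le)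
        then have "fst p \<subseteq># A" by (simp add: subseteq_mset_def)
        then show False using p by (simp add: mdivs_def mem_Times_iff)
      qed
      then show "of_nat (count (?A - fst p) i) * ?G p = 0" by simp
    qed
  qed simp
  also have "\<dots> = sps_nth (f * pd (Inl i) g) A S"
    unfolding sps_nth_mult
  proof (rule sum.cong[OF refl])
    fix p assume "p \<in> mdivs A S"
    then have "?A - fst p = add_mset i (A - fst p)"
      using multiset_diff_union_assoc[of "fst p" A "{#i#}"] by (simp add: mdivs_def mem_Times_iff)
    then show "of_nat (count (?A - fst p) i) * ?G p = wedge_sign (snd p) (S |-| snd p) *
         sps_nth f (fst p) (snd p) * sps_nth (pd (Inl i) g) (A - fst p) (S |-| snd p)"
      by (simp add: pd_nth_even)
  qed
  finally show "sps_nth (pd (Inl i) (f * g)) A S = sps_nth (pd (Inl i) f * g + f * pd (Inl i) g) A S"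
    by simp
qed

text \<open>The terms are sorted by the factor that contains \<open>j\<close>. For
  \<open>j |\<notin>| S\<close> they match the two terms of the rule; for \<open>j |\<in>| S\<close>
  the derivative of the product has no such monomial, and the two terms on the right cancel.\<close>

lemma pd_mult_odd:
  assumes f: "has_parity p f"
  shows "pd (Inr j) (f * g) = pd (Inr j) f * g + smult ((-1) ^ p) (f * pd (Inr j) g)"
proof (rule sps_eqI)
  fix A S
  have sgn: "(-1) ^ p * sps_nth f B T = (-1) ^ fcard T * sps_nth f B T" for B T
    using f minus_one_power_parity[of "fcard T" p] by (cases "sps_nth f B T = 0") (auto simp: has_parity_def)
  \<comment> \<open>The two identities isolate the sign bookkeeping: \<open>a\<close>,
    \<open>b\<close>, \<open>c\<close> stand for \<open>wedge_sign T Q\<close>,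
    \<open>wedge_sign {|j|} T\<close>, \<open>wedge_sign {|j|} Q\<close>, and \<open>N\<close>,
    \<open>P\<close> for \<open>(-1) ^ fcard T\<close>, \<open>(-1) ^ p\<close>. On the support of
    \<open>f\<close> the last two agree in the first identity and differ by a sign in the second,
    where \<open>f\<close> is evaluated at \<open>finsert j T\<close>.\<close>
  have shuffle1: "b * c * (N * b * a * x * y) = P * (a * x * (c * y))"
    if "b * b = 1" "P * x = N * x" for a b c x y P N :: complex
    using that by algebra
  have shuffle2: "N * b * a * (b * x) * y = - (P * (c * a * x * (c * y)))"
    if "b * b = 1" "c * c = 1" "P * x = - 1 * N * x" for a b c x y P N :: complex
    using that by algebra
  show "sps_nth (pd (Inr j) (f * g)) A S
      = sps_nth (pd (Inr j) f * g + smult ((-1) ^ p) (f * pd (Inr j) g)) A S"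
  proof (cases "j |\<in>| S")
    case False
    have "sps_nth (pd (Inr j) (f * g)) A S = wedge_sign {|j|} S * sps_nth (f * g) A (finsert j S)"
      using False by (simp add: pd_nth_odd)
    also have "\<dots> = (\<Sum>r\<in>mdivs A S. (-1) ^ p * (wedge_sign (snd r) (S |-| snd r) * sps_nth f (fst r) (snd r) *
          sps_nth (pd (Inr j) g) (A - fst r) (S |-| snd r))) +
        (\<Sum>r\<in>mdivs A S. wedge_sign (snd r) (S |-| snd r) * sps_nth (pd (Inr j) f) (fst r) (snd r) *
          sps_nth g (A - fst r) (S |-| snd r))"
      unfolding sps_nth_mult sum_mdivs_finsert[OF False] distrib_left sum_distrib_left
    proof (intro arg_cong2[where f = "(+)"] sum.cong refl)
      fix r assume "r \<in> mdivs A S"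
      obtain B T where r: "r = (B, T)" by (cases r)
      have T: "T |\<subseteq>| S" using \<open>r \<in> mdivs A S\<close> by (simp add: r mdivs_def)
      define Q where "Q = S |-| T"
      have S: "S = T |\<union>| Q" and disj: "T |\<inter>| Q = {||}" and j: "j |\<notin>| T" "j |\<notin>| Q"
        using T False by (auto simp: Q_def)
      have e: "finsert j S |-| T = finsert j Q" "finsert j S |-| finsert j T = Q"
        using T False by (auto simp: Q_def)
      have w: "wedge_sign {|j|} S = wedge_sign {|j|} T * wedge_sign {|j|} Q"
        unfolding S by (rule wedge_sign_union_right[OF disj])
      have c: "wedge_sign T {|j|} = (-1) ^ fcard T * wedge_sign {|j|} T"
        using wedge_sign_commute[of "{|j|}" T] j by (simp add: fcard_finsert_disjoint fcard_fempty)
      show "wedge_sign {|j|} S * (wedge_sign (snd r) (finsert j S |-| snd r) * sps_nth f (fst r) (snd r) *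
             sps_nth g (A - fst r) (finsert j S |-| snd r)) =
            (-1) ^ p * (wedge_sign (snd r) (S |-| snd r) * sps_nth f (fst r) (snd r) *
             sps_nth (pd (Inr j) g) (A - fst r) (S |-| snd r))"
        unfolding r prod.sel e Q_def[symmetric] w pd_nth_odd wedge_sign_finsert(2)[OF j(2)] c if_not_P[OF j(2)]
        by (rule shuffle1[OF wedge_sign_square sgn])
      show "wedge_sign {|j|} S * (wedge_sign (snd (fst r, finsert j (snd r))) (finsert j S |-| snd (fst r, finsert j (snd r))) *
             sps_nth f (fst (fst r, finsert j (snd r))) (snd (fst r, finsert j (snd r))) *
             sps_nth g (A - fst (fst r, finsert j (snd r))) (finsert j S |-| snd (fst r, finsert j (snd r)))) =
            wedge_sign (snd r) (S |-| snd r) * sps_nth (pd (Inr j) f) (fst r) (snd r) *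
            sps_nth g (A - fst r) (S |-| snd r)"
        unfolding r prod.sel e Q_def[symmetric] w pd_nth_odd wedge_sign_finsert(1)[OF j(1)] if_not_P[OF j(1)]
        using wedge_sign_square[of "{|j|}" Q] by algebra
    qed
    finally show ?thesis
      by (simp add: sps_nth_mult sum_distrib_left add.commute)
  next
    case True
    define S0 where "S0 = S |-| {|j|}"
    have S: "S = finsert j S0" "j |\<notin>| S0" using True by (auto simp: S0_def)
    have 1: "sps_nth (pd (Inr j) f * g) A S = (\<Sum>r\<in>mdivs A S0. wedge_sign (snd r) (S |-| snd r) *
        sps_nth (pd (Inr j) f) (fst r) (snd r) * sps_nth g (A - fst r) (S |-| snd r))"
      unfolding sps_nth_mult S(1) sum_mdivs_finsert[OF S(2)] by (simp add: pd_nth_odd)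
    have z: "sps_nth (pd (Inr j) g) (A - fst r) (finsert j S0 |-| snd r) = 0" if "r \<in> mdivs A S0" for r
    proof -
      have "j |\<notin>| snd r" using that S(2) by (auto simp: mdivs_def)
      then show ?thesis by (simp add: pd_nth_odd)
    qed
    have 2: "sps_nth (f * pd (Inr j) g) A S = (\<Sum>r\<in>mdivs A S0. wedge_sign (finsert j (snd r)) (S |-| finsert j (snd r)) *
        sps_nth f (fst r) (finsert j (snd r)) * sps_nth (pd (Inr j) g) (A - fst r) (S |-| finsert j (snd r)))"
      unfolding sps_nth_mult S(1) sum_mdivs_finsert[OF S(2)] by (simp add: z)
    have "sps_nth (pd (Inr j) f * g) A S = - ((-1) ^ p * sps_nth (f * pd (Inr j) g) A S)"
      unfolding 1 2 sum_distrib_left sum_negf[symmetric]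
    proof (rule sum.cong[OF refl])
      fix r assume "r \<in> mdivs A S0"
      obtain B T where r: "r = (B, T)" by (cases r)
      have T: "T |\<subseteq>| S0" using \<open>r \<in> mdivs A S0\<close> by (simp add: r mdivs_def)
      define Q where "Q = S0 |-| T"
      have disj: "T |\<inter>| Q = {||}" and j: "j |\<notin>| T" "j |\<notin>| Q"
        using T S(2) by (auto simp: Q_def)
      have e: "S |-| T = finsert j Q" "S |-| finsert j T = Q"
        using T S by (auto simp: Q_def)
      have c: "wedge_sign T {|j|} = (-1) ^ fcard T * wedge_sign {|j|} T"
        using wedge_sign_commute[of "{|j|}" T] j by (simp add: fcard_finsert_disjoint fcard_fempty)
      show "wedge_sign (snd r) (S |-| snd r) * sps_nth (pd (Inr j) f) (fst r) (snd r) *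
          sps_nth g (A - fst r) (S |-| snd r) =
         - ((-1) ^ p * (wedge_sign (finsert j (snd r)) (S |-| finsert j (snd r)) *
            sps_nth f (fst r) (finsert j (snd r)) * sps_nth (pd (Inr j) g) (A - fst r) (S |-| finsert j (snd r))))"
        unfolding r prod.sel e pd_nth_odd wedge_sign_finsert(1)[OF j(1)] wedge_sign_finsert(2)[OF j(2)]
          c if_not_P[OF j(1)] if_not_P[OF j(2)]
        by (rule shuffle2[OF wedge_sign_square wedge_sign_square
            sgn[of B "finsert j T", unfolded fcard_finsert_disjoint[OF j(1)] power_Suc]])
    qed
    with True show ?thesis by (simp add: pd_nth_odd)
  qed
qed

lemma pd_mult:
  assumes "has_parity p f"
  shows "pd v (f * g) = pd v f * g + smult ((-1) ^ (vpar v * p)) (f * pd v g)"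
  using pd_mult_even pd_mult_odd[OF assms] by (cases v) (simp_all add: vpar_def)

section \<open>Ideals and topology\<close>

lemma Lam_closed:
  "0 \<in> Lam m n" "1 \<in> Lam m n"
  "f \<in> Lam m n \<Longrightarrow> g \<in> Lam m n \<Longrightarrow> f + g \<in> Lam m n"
  "f \<in> Lam m n \<Longrightarrow> g \<in> Lam m n \<Longrightarrow> f - g \<in> Lam m n"
  "f \<in> Lam m n \<Longrightarrow> g \<in> Lam m n \<Longrightarrow> f * g \<in> Lam m n"
  "f \<in> Lam m n \<Longrightarrow> smult c f \<in> Lam m n"
  "f \<in> Lam m n \<Longrightarrow> parity_part p f \<in> Lam m n"
  "f \<in> Lam m n \<Longrightarrow> pd v f \<in> Lam m n"
  "v \<in> variables m n \<Longrightarrow> gen v \<in> Lam m n"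
  by (simp_all add: Lam_eq_Lam_on Lam_on_add Lam_on_diff Lam_on_mult Lam_on_smult
      Lam_on_parity_part pd_Lam_on gen_Lam_on)

lemma Lam_sum: "(\<And>i. i \<in> I \<Longrightarrow> F i \<in> Lam m n) \<Longrightarrow> (\<Sum>i\<in>I. F i) \<in> Lam m n"
  by (simp add: Lam_eq_Lam_on Lam_on_sum)

lemma super_idealD:
  assumes "super_ideal m n I"
  shows "I \<subseteq> Lam m n" "0 \<in> I" "f \<in> I \<Longrightarrow> g \<in> I \<Longrightarrow> f + g \<in> I"
    "f \<in> I \<Longrightarrow> g \<in> Lam m n \<Longrightarrow> g * f \<in> I" "f \<in> I \<Longrightarrow> g \<in> Lam m n \<Longrightarrow> f * g \<in> I"
    "f \<in> I \<Longrightarrow> parity_part p f \<in> I" "f \<in> I \<Longrightarrow> smult c f \<in> I" "f \<in> I \<Longrightarrow> g \<in> I \<Longrightarrow> f - g \<in> I"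
proof -
  note I = assms[unfolded super_ideal_def]
  show "I \<subseteq> Lam m n" "0 \<in> I" "f \<in> I \<Longrightarrow> g \<in> Lam m n \<Longrightarrow> g * f \<in> I"
    "f \<in> I \<Longrightarrow> g \<in> Lam m n \<Longrightarrow> f * g \<in> I" "f \<in> I \<Longrightarrow> parity_part p f \<in> I"
    using I by blast+
  show add: "f \<in> I \<Longrightarrow> g \<in> I \<Longrightarrow> f + g \<in> I" for f g
    using I by blast
  show sm: "f \<in> I \<Longrightarrow> smult c f \<in> I" for f c
  proof -
    assume "f \<in> I"
    moreover have "smult c 1 \<in> Lam m n" by (simp add: Lam_closed)
    ultimately have "smult c 1 * f \<in> I" using I by blast
    then show "smult c f \<in> I" by simp
  qed
  assume "f \<in> I" "g \<in> I"
  then have "f + smult (-1) g \<in> I" by (intro add sm)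
  then show "f - g \<in> I" by (simp add: smult_minus_left)
qed

lemma super_ideal_sum: "super_ideal m n I \<Longrightarrow> (\<And>i. i \<in> J \<Longrightarrow> F i \<in> I) \<Longrightarrow> (\<Sum>i\<in>J. F i) \<in> I"
  by (induction J rule: infinite_finite_induct) (auto intro: super_idealD)

lemma super_ideal_order_ge: "super_ideal m n {f \<in> Lam m n. order_ge k f}"
  unfolding super_ideal_def
  using order_ge_mult[of k _ 0] order_ge_mult[of 0 _ k]
  by (auto simp: Lam_closed order_ge_add order_ge_parity_part)

lemma max_ideal_eq: "max_ideal m n = ideal_gen m n (gen ` variables m n)"
  by (simp add: max_ideal_def variables_def image_Un image_image gen_def)

text \<open>One inclusion holds because orders add under multiplication. For the other, Euler's
  expansion writes a series of order \<open>k + 1\<close> as a finite sum of products of a variable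
  and a series of order \<open>k\<close>.\<close>

lemma max_ideal_pow_eq: "max_ideal_pow m n k = {f \<in> Lam m n. order_ge k f}"
proof (induction k)
  case (Suc k)
  let ?M = "max_ideal_pow m n (Suc k)"
  have "max_ideal m n \<subseteq> {f \<in> Lam m n. order_ge 1 f}"
    unfolding max_ideal_eq using super_ideal_order_ge
    by (rule ideal_gen_least) (auto simp: Lam_closed order_ge_gen)
  then have "?M \<subseteq> {f \<in> Lam m n. order_ge (Suc k) f}"
    unfolding max_ideal_pow.simps
    using order_ge_mult[of 1 _ k]
    by (intro ideal_gen_least[OF super_ideal_order_ge]) (auto simp: Suc Lam_closed)
  moreover have "f \<in> ?M" if f: "f \<in> Lam m n" "order_ge (Suc k) f" for f
  proof -
    obtain q where q: "\<And>v. q v \<in> Lam m n" "\<And>v. order_ge k (q v)" "f = (\<Sum>v\<in>variables m n. gen v * q v)"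
      using gen_expansion[of "variables m n" f k] f by (auto simp: Lam_eq_Lam_on)
    have "gen v * q v \<in> ?M" if "v \<in> variables m n" for v
    proof -
      have "gen v \<in> max_ideal m n" using that by (auto simp: max_ideal_eq ideal_gen_def)
      then have "gen v * q v \<in> {f * g | f g. f \<in> max_ideal m n \<and> g \<in> max_ideal_pow m n k}"
        using q by (auto simp: Suc)
      then show ?thesis by (auto simp: ideal_gen_def)
    qed
    then show ?thesis unfolding q(3) by (intro super_ideal_sum[OF super_ideal_max_ideal_pow])
  qed
  ultimately show ?case by blast
qed simp

lemma openin_Lam_topology:
  "openin (Lam_topology m n) U \<longleftrightarrow>
    U \<subseteq> Lam m n \<and> (\<forall>x\<in>U. \<exists>k. \<forall>y\<in>Lam m n. order_ge k (y - x) \<longrightarrow> y \<in> U)"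
proof -
  have "{y \<in> Lam m n. y - x \<in> max_ideal_pow m n k} \<subseteq> U \<longleftrightarrow>
      (\<forall>y\<in>Lam m n. order_ge k (y - x) \<longrightarrow> y \<in> U)" if "x \<in> Lam m n" for x k
    using that by (auto simp: max_ideal_pow_eq Lam_closed)
  then show ?thesis
    unfolding Lam_topology_def openin_filtration_topology[OF antimono_max_ideal_pow] by blast
qed

lemma topspace_Lam_topology [simp]: "topspace (Lam_topology m n) = Lam m n"
proof -
  have "openin (Lam_topology m n) (Lam m n)" by (auto simp: openin_Lam_topology)
  moreover have "openin (Lam_topology m n) (topspace (Lam_topology m n))" by simp
  then have "topspace (Lam_topology m n) \<subseteq> Lam m n" by (simp only: openin_Lam_topology)
  ultimately show ?thesis by (meson openin_subset subset_antisym)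
qed

lemma closedin_Lam_topology:
  "closedin (Lam_topology m n) C \<longleftrightarrow>
    C \<subseteq> Lam m n \<and> (\<forall>x\<in>Lam m n - C. \<exists>k. \<forall>y\<in>C. \<not> order_ge k (y - x))"
  unfolding closedin_def openin_Lam_topology topspace_Lam_topology by blast

text \<open>Meant for the exponentials below, which do not lower the order; a derivation may lower
  it by one, and its continuity is part of its definition.\<close>

lemma continuous_map_Lam:
  assumes "\<And>f. f \<in> Lam m n \<Longrightarrow> T f \<in> Lam m n"
    and "\<And>f g. f \<in> Lam m n \<Longrightarrow> g \<in> Lam m n \<Longrightarrow> T (f - g) = T f - T g"
    and "\<And>k f. f \<in> Lam m n \<Longrightarrow> order_ge k f \<Longrightarrow> order_ge k (T f)"
  shows "continuous_map (Lam_topology m n) (Lam_topology m n) T"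
  unfolding continuous_map_def topspace_Lam_topology
proof (intro conjI allI impI)
  fix U assume U: "openin (Lam_topology m n) U"
  show "openin (Lam_topology m n) {x \<in> Lam m n. T x \<in> U}"
    unfolding openin_Lam_topology
  proof (intro conjI ballI)
    fix x assume x: "x \<in> {x \<in> Lam m n. T x \<in> U}"
    then obtain k where k: "\<And>y. y \<in> Lam m n \<Longrightarrow> order_ge k (y - T x) \<Longrightarrow> y \<in> U"
      using U unfolding openin_Lam_topology by blast
    have "T y \<in> U" if "y \<in> Lam m n" "order_ge k (y - x)" for y
      using assms(1,2,3)[of "y - x"] assms(1,2) that x k by (metis Lam_closed(4) mem_Collect_eq assms(3))
    then show "\<exists>k. \<forall>y\<in>Lam m n. order_ge k (y - x) \<longrightarrow> y \<in> {x \<in> Lam m n. T x \<in> U}"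
      by blast
  qed blast
qed (use assms(1) in auto)

section \<open>Vector fields\<close>

text \<open>Two signs meet: \<open>pd v\<close> passes \<open>f\<close> with
  \<open>(-1) ^ (vpar v * p)\<close>, and the coefficient \<open>P v\<close> passes it with
  \<open>(-1) ^ ((s + vpar v) * p)\<close>. The dependence on \<open>v\<close> cancels in their
  product.\<close>

lemma vector_field_mult:
  assumes P: "\<And>v. v \<in> V \<Longrightarrow> has_parity (s + vpar v) (P v)" and f: "has_parity p f"
  shows "(\<Sum>v\<in>V. P v * pd v (f * g))
    = (\<Sum>v\<in>V. P v * pd v f) * g + smult ((-1) ^ (s * p)) (f * (\<Sum>v\<in>V. P v * pd v g))"
proof -
  have "P v * pd v (f * g) = P v * pd v f * g + smult ((-1) ^ (s * p)) (f * (P v * pd v g))" if "v \<in> V" for v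
  proof -
    have "P v * f = smult ((-1) ^ ((s + vpar v) * p)) (f * P v)"
      by (rule supercommute[OF P[OF that] f])
    then have "P v * (smult ((-1) ^ (vpar v * p)) (f * pd v g))
        = smult ((-1) ^ (vpar v * p) * (-1) ^ ((s + vpar v) * p)) (f * (P v * pd v g))"
      by (simp flip: mult.assoc)
    also have "(-1 :: complex) ^ (vpar v * p) * (-1) ^ ((s + vpar v) * p) = (-1) ^ (s * p)"
      by (simp add: ring_distribs power_add flip: power_mult_distrib)
    finally show ?thesis
      unfolding pd_mult[OF f] by (simp add: distrib_left mult.assoc)
  qed
  then show ?thesis
    by (simp add: sum.distrib sum_distrib_left sum_distrib_right smult_sum)
qed

lemma vector_field_add:
  "(\<Sum>v\<in>V. P v * pd v (f + g)) = (\<Sum>v\<in>V. P v * pd v f) + (\<Sum>v\<in>V. P v * pd v g)"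
  by (simp add: pd_add distrib_left sum.distrib)

lemma vector_field_smult:
  "(\<Sum>v\<in>V. P v * pd v (smult c f)) = smult c (\<Sum>v\<in>V. P v * pd v f)"
  by (simp add: pd_smult smult_sum)

section \<open>Continuous superderivations are vector fields\<close>

lemma csdD:
  assumes "cont_superderivation m n s X"
  shows "f \<notin> Lam m n \<Longrightarrow> X f = 0" "f \<in> Lam m n \<Longrightarrow> X f \<in> Lam m n"
    "f \<in> Lam m n \<Longrightarrow> g \<in> Lam m n \<Longrightarrow> X (f + g) = X f + X g"
    "f \<in> Lam m n \<Longrightarrow> X (smult c f) = smult c (X f)"
    "f \<in> Lam m n \<Longrightarrow> has_parity p f \<Longrightarrow> has_parity (s + p) (X f)"
    "f \<in> Lam m n \<Longrightarrow> g \<in> Lam m n \<Longrightarrow> has_parity p f \<Longrightarrow>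
      X (f * g) = X f * g + smult ((-1) ^ (s * p)) (f * X g)"
    "continuous_map (Lam_topology m n) (Lam_topology m n) X"
  using assms unfolding cont_superderivation_def by blast+

lemma gen_expansion_const:
  assumes "f \<in> Lam m n"
  obtains q where "\<And>v. q v \<in> Lam m n"
    "f = smult (const_coeff f) 1 + (\<Sum>v\<in>variables m n. gen v * q v)"
proof -
  have "f - smult (const_coeff f) 1 \<in> Lam_on (variables m n)"
    using assms by (simp add: Lam_closed flip: Lam_eq_Lam_on)
  moreover have "order_ge (Suc 0) (f - smult (const_coeff f) 1)"
    by (simp add: order_ge_1_iff sps_nth_one)
  ultimately obtain q where q: "\<And>v. q v \<in> Lam_on (variables m n)"
    "f - smult (const_coeff f) 1 = (\<Sum>v\<in>variables m n. gen v * q v)"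
    using gen_expansion[OF finite_variables] by blast
  show ?thesis
  proof
    show "f = smult (const_coeff f) 1 + (\<Sum>v\<in>variables m n. gen v * q v)"
      using q(2) by (metis add.commute diff_add_cancel)
  qed (use q(1) in \<open>simp add: Lam_eq_Lam_on\<close>)
qed

text \<open>
  The difference of both sides is a superderivation that kills the variables, so by the Leibniz rule its
  values have arbitrarily high order.
\<close>

lemma superderivation_eq_vector_field:
  assumes X: "cont_superderivation m n s X" and f: "f \<in> Lam m n"
  shows "X f = (\<Sum>v\<in>variables m n. X (gen v) * pd v f)"
proof -
  define Z where "Z = (\<lambda>f. X f - (\<Sum>v\<in>variables m n. X (gen v) * pd v f))"
  have P: "has_parity (s + vpar v) (X (gen v))" if "v \<in> variables m n" for v
    using csdD(5)[OF X Lam_closed(9)[OF that] has_parity_gen] .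
  have add: "Z (f + g) = Z f + Z g" if "f \<in> Lam m n" "g \<in> Lam m n" for f g
    using that by (simp add: Z_def vector_field_add csdD(3)[OF X])
  have sm: "Z (smult c f) = smult c (Z f)" if "f \<in> Lam m n" for f c
    using that by (simp add: Z_def vector_field_smult csdD(4)[OF X] smult_diff)
  have zero: "Z 0 = 0"
    using sm[of 0 0] by (simp add: Lam_closed)
  have leib: "Z (f * g) = Z f * g + smult ((-1) ^ (s * p)) (f * Z g)"
    if "f \<in> Lam m n" "g \<in> Lam m n" "has_parity p f" for f g p
  proof -
    have V: "(\<Sum>v\<in>variables m n. X (gen v) * pd v (f * g)) = (\<Sum>v\<in>variables m n. X (gen v) * pd v f) * g
        + smult ((-1) ^ (s * p)) (f * (\<Sum>v\<in>variables m n. X (gen v) * pd v g))"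
      by (rule vector_field_mult[OF P that(3)])
    show ?thesis
      unfolding Z_def csdD(6)[OF X that] V by (simp add: algebra_simps smult_diff)
  qed
  have sum: "Z (\<Sum>v\<in>I. F v) = (\<Sum>v\<in>I. Z (F v))" if "\<And>v. v \<in> I \<Longrightarrow> F v \<in> Lam m n" for I :: "var set" and F
    using that by (induction I rule: infinite_finite_induct) (auto simp: zero add Lam_sum)
  have one: "Z 1 = 0"
    using leib[of 1 1 0] by (simp add: Lam_closed)
  have gen: "Z (gen v) = 0" if "v \<in> variables m n" for v
    using that by (simp add: Z_def pd_gen if_distrib[where f = "\<lambda>x. _ * x"] cong: if_cong)
  have "order_ge k (Z f)" if "f \<in> Lam m n" for k f
    using that
  proof (induction k arbitrary: f)
    case (Suc k)
    obtain q where q: "\<And>v. q v \<in> Lam m n"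
      and f: "f = smult (const_coeff f) 1 + (\<Sum>v\<in>variables m n. gen v * q v)"
      using gen_expansion_const[OF Suc.prems] by blast
    have "Z f = (\<Sum>v\<in>variables m n. smult ((-1) ^ (s * vpar v)) (gen v * Z (q v)))"
      by (subst f) (simp add: add sm one sum Lam_sum Lam_closed q leib[OF _ _ has_parity_gen] gen)
    moreover have "order_ge (Suc k) (gen v * Z (q v))" for v
      using order_ge_mult[OF order_ge_gen Suc.IH[OF q]] by simp
    ultimately show ?case by (simp add: order_ge_sum order_ge_smult)
  qed simp
  then have "Z f = 0" using f by (intro order_ge_eq_zero)
  then show ?thesis by (simp add: Z_def)
qed

lemma W_decomp:
  assumes "X \<in> W m n"
  obtains Y Z where "cont_superderivation m n 0 Y" "cont_superderivation m n 1 Z"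
    "\<And>f. X f = Y f + Z f"
  using assms unfolding W_def by (auto simp: plus_fun_def)

lemma W_eq_vector_field:
  assumes "X \<in> W m n" "f \<in> Lam m n"
  shows "X f = (\<Sum>v\<in>variables m n. X (gen v) * pd v f)"
proof -
  obtain Y Z where YZ: "cont_superderivation m n 0 Y" "cont_superderivation m n 1 Z" "\<And>f. X f = Y f + Z f"
    using W_decomp[OF assms(1)] by blast
  show ?thesis
    using superderivation_eq_vector_field[OF YZ(1) assms(2)] superderivation_eq_vector_field[OF YZ(2) assms(2)]
    by (simp add: YZ(3) distrib_right sum.distrib)
qed

lemma W_closed:
  assumes "X \<in> W m n"
  shows "f \<in> Lam m n \<Longrightarrow> X f \<in> Lam m n"
    "f \<in> Lam m n \<Longrightarrow> g \<in> Lam m n \<Longrightarrow> X (f + g) = X f + X g"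
    "f \<in> Lam m n \<Longrightarrow> g \<in> Lam m n \<Longrightarrow> X (f - g) = X f - X g"
    "f \<in> Lam m n \<Longrightarrow> X (smult c f) = smult c (X f)"
    "f \<notin> Lam m n \<Longrightarrow> X f = 0"
proof -
  obtain Y Z where YZ: "cont_superderivation m n 0 Y" "cont_superderivation m n 1 Z" "\<And>f. X f = Y f + Z f"
    using W_decomp[OF assms] by blast
  show "f \<in> Lam m n \<Longrightarrow> X f \<in> Lam m n" "f \<notin> Lam m n \<Longrightarrow> X f = 0"
    by (simp_all add: YZ(3) csdD[OF YZ(1)] csdD[OF YZ(2)] Lam_closed)
  show a: "f \<in> Lam m n \<Longrightarrow> g \<in> Lam m n \<Longrightarrow> X (f + g) = X f + X g" for f g
    by (simp add: YZ(3) csdD[OF YZ(1)] csdD[OF YZ(2)])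
  show s: "f \<in> Lam m n \<Longrightarrow> X (smult c f) = smult c (X f)" for f c
    by (simp add: YZ(3) csdD(4)[OF YZ(1)] csdD(4)[OF YZ(2)] smult_add)
  show "f \<in> Lam m n \<Longrightarrow> g \<in> Lam m n \<Longrightarrow> X (f - g) = X f - X g"
    using a[of f "smult (-1) g"] s[of g "-1"] Lam_closed(6)[of g m n "-1"]
    by (simp add: smult_minus_left)
qed

lemma W_sum:
  "X \<in> W m n \<Longrightarrow> (\<And>i. i \<in> I \<Longrightarrow> F i \<in> Lam m n) \<Longrightarrow> X (\<Sum>i\<in>I. F i) = (\<Sum>i\<in>I. X (F i))"
  using W_closed(4)[of X m n 0 0]
  by (induction I rule: infinite_finite_induct) (auto simp: W_closed Lam_sum Lam_closed)

text \<open>The coefficient of the partial derivative by \<open>v\<close> in the component of degree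
  \<open>-1\<close>; in geometric terms a coordinate of the tangent vector of \<open>X\<close> at
  the origin.\<close>

definition value_at_0 :: "(sps \<Rightarrow> sps) \<Rightarrow> var \<Rightarrow> complex" where
  "value_at_0 X v = const_coeff (X (gen v))"

lemma const_coeff_W:
  assumes "X \<in> W m n" "f \<in> Lam m n"
  shows "const_coeff (X f) = (\<Sum>v\<in>variables m n. value_at_0 X v * const_coeff (pd v f))"
  by (subst W_eq_vector_field[OF assms]) (simp add: sps_nth_sum const_coeff_mult value_at_0_def)

text \<open>After subtraction of their constant terms the coefficients of the field have order at
  least \<open>1\<close>, which makes up for the order lost in a partial derivative.\<close>

lemma W_leading_part:
  assumes X: "X \<in> W m n" and f: "f \<in> Lam m n" "order_ge k f"
  shows "order_ge k (X f - (\<Sum>v\<in>variables m n. smult (value_at_0 X v) (pd v f)))"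
proof (cases k)
  case (Suc j)
  have "order_ge k ((X (gen v) - smult (value_at_0 X v) 1) * pd v f)" for v
  proof -
    have "order_ge (Suc 0) (X (gen v) - smult (value_at_0 X v) 1)"
      by (simp add: order_ge_1_iff value_at_0_def sps_nth_one)
    then show ?thesis
      using order_ge_mult[of "Suc 0" _ j] order_ge_pd f(2) by (simp add: Suc)
  qed
  then show ?thesis
    by (subst W_eq_vector_field[OF X f(1)])
      (simp add: order_ge_sum left_diff_distrib flip: sum_subtractf)
qed simp

lemma order_ge_W: "X \<in> W m n \<Longrightarrow> f \<in> Lam m n \<Longrightarrow> order_ge (Suc k) f \<Longrightarrow> order_ge k (X f)"
  using order_ge_mult[of 0 _ k]
  by (subst W_eq_vector_field) (auto intro!: order_ge_sum order_ge_pd)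

text \<open>Constants are even, whereas \<open>X (gen v)\<close> is odd when the parities of
  \<open>X\<close> and \<open>v\<close> differ.\<close>

lemma value_at_0_parity:
  assumes "cont_superderivation m n s X" "v \<in> variables m n" "s \<noteq> vpar v" "s \<in> {0, 1}"
  shows "value_at_0 X v = 0"
proof -
  have "has_parity (s + vpar v) (X (gen v))"
    using csdD(5)[OF assms(1) Lam_closed(9)[OF assms(2)] has_parity_gen] .
  moreover have "(s + vpar v) mod 2 = 1"
    using assms(3,4) vpar_cases[of v] by auto
  ultimately show ?thesis
    by (simp add: value_at_0_def has_parity_iff fcard_fempty)
qed

section \<open>The projection to degree -1\<close>

lemma linear_functions_eq:
  "linear_functions m n = {\<Sum>v\<in>variables m n. smult (c v) (gen v) | c. True}"
proof (intro equalityI subsetI)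
  fix l assume "l \<in> linear_functions m n"
  then obtain c d where "l = (\<Sum>i<m. smult (c i) (xvar i)) + (\<Sum>j<n. smult (d j) (xivar j))"
    unfolding linear_functions_def by blast
  then have "l = (\<Sum>v\<in>variables m n. smult (case_sum c d v) (gen v))"
    by (simp add: sum_variables gen_def)
  then show "l \<in> {\<Sum>v\<in>variables m n. smult (c v) (gen v) | c. True}" by blast
next
  fix l assume "l \<in> {\<Sum>v\<in>variables m n. smult (c v) (gen v) | c. True}"
  then show "l \<in> linear_functions m n"
    unfolding linear_functions_def by (auto simp: sum_variables gen_def)
qed

lemma vect_field_const:
  assumes "f \<in> Lam m n"
  shows "vect_field m n (\<lambda>i. smult (c (Inl i)) 1) (\<lambda>j. smult (c (Inr j)) 1) f
    = (\<Sum>v\<in>variables m n. smult (c v) (pd v f))"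
  using assms by (simp add: vect_field_def sum_variables pd_def)

lemma W_proj_minus1:
  "W_proj m n (-1) X
    = vect_field m n (\<lambda>i. smult (value_at_0 X (Inl i)) 1) (\<lambda>j. smult (value_at_0 X (Inr j)) 1)"
  by (simp add: W_proj_def degree_part_0 value_at_0_def gen_def)

lemma linear_function_Lam: "(\<Sum>v\<in>variables m n. smult (c v) (gen v)) \<in> Lam m n"
  by (simp add: Lam_sum Lam_closed)

lemma pd_linear_function:
  "w \<in> variables m n \<Longrightarrow> pd w (\<Sum>v\<in>variables m n. smult (c v) (gen v)) = smult (c w) 1"
  by (simp add: pd_sum pd_smult pd_gen if_distrib[where f = "smult _"] cong: if_cong)

lemma smult_one_eq_0_iff: "smult c 1 = 0 \<longleftrightarrow> c = 0"
  by (metis mult.right_neutral smult_simps(2) sps_nth_one sps_nth_simps(1,5))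

lemma annihilator_eq:
  "annihilator m n (W_proj m n (-1) ` L) =
    {\<Sum>v\<in>variables m n. smult (c v) (gen v) | c. \<forall>X\<in>L. (\<Sum>v\<in>variables m n. value_at_0 X v * c v) = 0}"
proof -
  have "W_proj m n (-1) X (\<Sum>v\<in>variables m n. smult (c v) (gen v))
      = smult (\<Sum>v\<in>variables m n. value_at_0 X v * c v) 1" for X c
    unfolding W_proj_minus1 vect_field_const[OF linear_function_Lam]
    by (simp add: pd_linear_function smult_sum_left)
  then show ?thesis
    unfolding annihilator_def linear_functions_eq by (auto simp: smult_one_eq_0_iff)
qed

lemma transitive_iff:
  "transitive m n L \<longleftrightarrow> (\<forall>c. \<exists>X\<in>L. \<forall>v\<in>variables m n. value_at_0 X v = c v)"
proof -
  let ?C = "\<lambda>c. vect_field m n (\<lambda>i. smult (c (Inl i)) 1) (\<lambda>j. smult (c (Inr j)) 1)"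
  have C: "?C c = ?C d \<longleftrightarrow> (\<forall>v\<in>variables m n. c v = d v)" for c d
  proof
    assume *: "?C c = ?C d"
    show "\<forall>v\<in>variables m n. c v = d v"
    proof
      fix v assume v: "v \<in> variables m n"
      have "?C e (gen v) = smult (e v) 1" for e
        using v by (subst vect_field_const)
          (auto simp: Lam_closed pd_gen if_distrib[where f = "smult _"] cong: if_cong)
      then have "smult (c v) 1 = smult (d v) (1 :: sps)" using * by metis
      then have "smult (c v - d v) 1 = 0" by (simp add: smult_diff_left)
      then show "c v = d v" by (simp add: smult_one_eq_0_iff)
    qed
  next
    assume "\<forall>v\<in>variables m n. c v = d v"
    then show "?C c = ?C d"
      by (intro ext) (auto simp: vect_field_def variables_def)
  qed
  have proj: "W_proj m n (-1) X = ?C (value_at_0 X)" for X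
    by (rule W_proj_minus1)
  have W: "W_minus1 m n = range ?C"
  proof (intro equalityI subsetI)
    fix D assume "D \<in> W_minus1 m n"
    then obtain c d where "D = vect_field m n (\<lambda>i. smult (c i) 1) (\<lambda>j. smult (d j) 1)"
      unfolding W_minus1_def by blast
    then have "D = ?C (case_sum c d)" by simp
    then show "D \<in> range ?C" by blast
  qed (auto simp: W_minus1_def)
  have "transitive m n L \<longleftrightarrow> (\<forall>c. \<exists>X\<in>L. ?C c = ?C (value_at_0 X))"
    unfolding transitive_def W proj by blast
  then show ?thesis unfolding C by metis
qed

section \<open>The largest invariant ideal without constant terms\<close>

text \<open>
  \<open>jet_kernel m n L k\<close> consists of the \<open>f\<close> such that \<open>X\<^sub>1 \<dots> X\<^sub>j f\<close> has no constant term for all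
  \<open>j < k\<close> and \<open>X\<^sub>1, \<dots>, X\<^sub>j \<in> L\<close>.
\<close>

fun jet_kernel :: "nat \<Rightarrow> nat \<Rightarrow> (sps \<Rightarrow> sps) set \<Rightarrow> nat \<Rightarrow> sps set" where
  "jet_kernel m n L 0 = Lam m n"
| "jet_kernel m n L (Suc k) =
    {f \<in> jet_kernel m n L k. const_coeff f = 0 \<and> (\<forall>X\<in>L. X f \<in> jet_kernel m n L k)}"

definition invariant_ideal :: "nat \<Rightarrow> nat \<Rightarrow> (sps \<Rightarrow> sps) set \<Rightarrow> sps set" where
  "invariant_ideal m n L = (\<Inter>k. jet_kernel m n L k)"

lemma csd_parity_part:
  assumes X: "cont_superderivation m n s X" and f: "f \<in> Lam m n"
  shows "X (parity_part p f) = parity_part (s + p) (X f)"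
proof -
  have "f = parity_part p f + parity_part (Suc p) f"
    by (rule sps_eqI) (auto simp: sps_nth_parity_part mod_Suc)
  then have "X f = X (parity_part p f) + X (parity_part (Suc p) f)"
    using csdD(3)[OF X, of "parity_part p f" "parity_part (Suc p) f"] f by (simp add: Lam_closed)
  moreover have "has_parity (s + q) (X (parity_part q f))" for q
    using csdD(5)[OF X Lam_closed(7)[OF f] has_parity_parity_part] .
  moreover have "(s + Suc p) mod 2 \<noteq> (s + p) mod 2" by presburger
  ultimately show ?thesis
    using parity_part_eq[of "s + p" "X (parity_part p f)" "s + p"]
      parity_part_eq[of "s + Suc p" "X (parity_part (Suc p) f)" "s + p"]
    by (simp only: parity_part_simps if_False simp_thms if_True add_0_right)
qed

locale subalgebra =
  fixes m n :: nat and L :: "(sps \<Rightarrow> sps) set"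
  assumes lie: "lie_subalgebra m n L"
begin

abbreviation "K \<equiv> jet_kernel m n L"
abbreviation "\<I> \<equiv> invariant_ideal m n L"

lemma L_W: "X \<in> L \<Longrightarrow> X \<in> W m n"
  and L_add: "X \<in> L \<Longrightarrow> Z \<in> L \<Longrightarrow> X + Z \<in> L"
  and L_smult: "X \<in> L \<Longrightarrow> (\<lambda>f. smult c (X f)) \<in> L"
  and L_bracket: "X \<in> L \<Longrightarrow> Z \<in> L \<Longrightarrow> s \<in> {0, 1} \<Longrightarrow> t \<in> {0, 1} \<Longrightarrow>
    cont_superderivation m n s X \<Longrightarrow> cont_superderivation m n t Z \<Longrightarrow>
    (\<lambda>f. X (Z f) - smult ((-1) ^ (s * t)) (Z (X f))) \<in> L"
  using lie unfolding lie_subalgebra_def by blast+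

lemmas L_closed = W_closed(1-4)[OF L_W]

lemma L_decomp:
  assumes "X \<in> L"
  obtains Y Z where "Y \<in> L" "Z \<in> L" "cont_superderivation m n 0 Y" "cont_superderivation m n 1 Z"
    "\<And>f. X f = Y f + Z f"
proof -
  have "\<exists>Y\<in>L. \<exists>Z\<in>L. cont_superderivation m n 0 Y \<and> cont_superderivation m n 1 Z \<and> X = Y + Z"
    using lie assms unfolding lie_subalgebra_def by blast
  then show ?thesis using that by (auto simp: plus_fun_def)
qed

lemma L_minus_sum:
  assumes "finite A" "X \<in> L" "\<And>a. a \<in> A \<Longrightarrow> Z a \<in> L"
  shows "(\<lambda>f. X f - (\<Sum>a\<in>A. smult (c a) (Z a f))) \<in> L"
  using assms(1,3)
proof (induction A)
  case empty
  then show ?case using assms(2) by simp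
next
  case (insert a A)
  then have "(\<lambda>f. X f - (\<Sum>a\<in>A. smult (c a) (Z a f))) + (\<lambda>f. smult (- c a) (Z a f)) \<in> L"
    by (intro L_add L_smult) auto
  moreover have "(\<lambda>f. X f - (\<Sum>a\<in>A. smult (c a) (Z a f))) + (\<lambda>f. smult (- c a) (Z a f))
      = (\<lambda>f. X f - (\<Sum>a\<in>insert a A. smult (c a) (Z a f)))"
    using insert(1,2) by (simp add: fun_eq_iff smult_minus_left algebra_simps)
  ultimately show ?case by simp
qed

lemma K_Lam: "f \<in> K k \<Longrightarrow> f \<in> Lam m n"
  by (induction k) auto

lemma K_add: "f \<in> K k \<Longrightarrow> g \<in> K k \<Longrightarrow> f + g \<in> K k"
proof (induction k arbitrary: f g)
  case (Suc k)
  then have "f \<in> Lam m n" "g \<in> Lam m n" using K_Lam by blast+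
  with Suc show ?case by (auto simp: L_closed)
qed (simp add: Lam_closed)

lemma K_smult: "f \<in> K k \<Longrightarrow> smult c f \<in> K k"
proof (induction k arbitrary: f)
  case (Suc k)
  then have "f \<in> Lam m n" using K_Lam by blast
  with Suc show ?case by (auto simp: L_closed)
qed (simp add: Lam_closed)

lemma K_diff: "f \<in> K k \<Longrightarrow> g \<in> K k \<Longrightarrow> f - g \<in> K k"
  using K_add[of f k "smult (-1) g"] K_smult[of g k "-1"] by (simp add: smult_minus_left)

text \<open>A field lowers the order by at most one, so fewer than \<open>k\<close> applications
  leave no constant term.\<close>

lemma order_ge_K: "f \<in> Lam m n \<Longrightarrow> order_ge k f \<Longrightarrow> f \<in> K k"
proof (induction k arbitrary: f)
  case (Suc k)
  then show ?case
    using order_ge_W[OF L_W] W_closed(1)[OF L_W] order_ge_mono[OF Suc.prems(2), of k]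
      order_ge_mono[OF Suc.prems(2), of "Suc 0"]
    by (auto simp: order_ge_1_iff)
qed simp

lemma K_zero: "0 \<in> K k"
  by (rule order_ge_K) (simp_all add: Lam_closed)

lemma K_sum: "(\<And>i. i \<in> I \<Longrightarrow> F i \<in> K k) \<Longrightarrow> (\<Sum>i\<in>I. F i) \<in> K k"
  by (induction I rule: infinite_finite_induct) (auto intro: K_add K_zero)

lemma K_SucI:
  assumes "f \<in> K k" "const_coeff f = 0"
    and "\<And>X s. X \<in> L \<Longrightarrow> s \<in> {0, 1} \<Longrightarrow> cont_superderivation m n s X \<Longrightarrow> X f \<in> K k"
  shows "f \<in> K (Suc k)"
proof -
  have "X f \<in> K k" if X: "X \<in> L" for X
  proof -
    obtain Y Z where YZ: "Y \<in> L" "Z \<in> L" "cont_superderivation m n 0 Y" "cont_superderivation m n 1 Z"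
      "\<And>f. X f = Y f + Z f"
      using L_decomp[OF X] by blast
    then show ?thesis
      using assms(3)[of Y 0] assms(3)[of Z 1] by (simp add: K_add)
  qed
  then show ?thesis using assms(1,2) by simp
qed

lemma K_parity_part: "f \<in> K k \<Longrightarrow> parity_part p f \<in> K k"
proof (induction k arbitrary: f p)
  case (Suc k)
  show ?case
  proof (rule K_SucI)
    fix X s assume X: "X \<in> L" "cont_superderivation m n s X"
    have "f \<in> Lam m n" using K_Lam Suc.prems by blast
    with X Suc show "X (parity_part p f) \<in> K k" by (simp add: csd_parity_part)
  qed (use Suc in \<open>auto simp: sps_nth_parity_part\<close>)
qed (simp add: Lam_closed)

text \<open>The Leibniz rule expresses \<open>X (g * f)\<close> by products with the factors
  \<open>f\<close> and \<open>X f\<close>, both in \<open>K k\<close>. It is available for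
  homogeneous \<open>g\<close> only, hence the detour through parity parts.\<close>

lemma K_mult_left: "f \<in> K k \<Longrightarrow> g \<in> Lam m n \<Longrightarrow> g * f \<in> K k"
proof (induction k arbitrary: f g)
  case (Suc k)
  have hom: "g * f \<in> K (Suc k)" if g: "g \<in> Lam m n" "has_parity q g" for g q
  proof (rule K_SucI)
    fix X s assume X: "X \<in> L" "cont_superderivation m n s X"
    have f: "f \<in> Lam m n" using K_Lam Suc.prems by blast
    have "X g * f \<in> K k" "g * X f \<in> K k"
      using Suc X g by (auto simp: csdD)
    then show "X (g * f) \<in> K k"
      unfolding csdD(6)[OF X(2) g(1) f g(2)] by (intro K_add K_smult)
  qed (use Suc g in \<open>auto simp: const_coeff_mult\<close>)
  have "parity_part 0 g * f + parity_part 1 g * f \<in> K (Suc k)"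
    using Suc.prems(2) by (intro K_add hom[OF Lam_closed(7) has_parity_parity_part])
  then show ?case by (simp only: distrib_right[symmetric] parity_decomp[symmetric])
qed (simp add: Lam_closed)

lemma K_mult_right:
  assumes f: "f \<in> K k" and g: "g \<in> Lam m n"
  shows "f * g \<in> K k"
proof -
  have "parity_part p f * parity_part q g \<in> K k" for p q
    unfolding supercommute[OF has_parity_parity_part has_parity_parity_part, of p f q g]
    using f g by (intro K_smult K_mult_left K_parity_part) (auto simp: Lam_closed)
  then have "parity_part 0 f * parity_part 0 g + parity_part 0 f * parity_part 1 g
      + (parity_part 1 f * parity_part 0 g + parity_part 1 f * parity_part 1 g) \<in> K k"
    by (intro K_add)
  then show ?thesis
    by (simp only: distrib_left[symmetric] distrib_right[symmetric] parity_decomp[symmetric])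
qed

lemma super_ideal_K: "super_ideal m n (K k)"
  unfolding super_ideal_def
  by (intro conjI ballI allI subsetI) (simp_all add: K_Lam K_zero K_add K_mult_left K_mult_right K_parity_part)

lemma super_ideal_invariant_ideal: "super_ideal m n \<I>"
proof -
  have K: "super_ideal m n (K k)" for k by (rule super_ideal_K)
  have "\<I> \<subseteq> Lam m n" using K_Lam by (auto simp: invariant_ideal_def)
  then show ?thesis
    unfolding super_ideal_def
    using super_idealD[OF K] by (simp add: invariant_ideal_def)
qed

lemma invariant_ideal_invariant: "X \<in> L \<Longrightarrow> f \<in> \<I> \<Longrightarrow> X f \<in> \<I>"
proof -
  assume X: "X \<in> L" and f: "f \<in> \<I>"
  have "f \<in> K (Suc k)" for k using f unfolding invariant_ideal_def by blast
  then show "X f \<in> \<I>" using X by (simp add: invariant_ideal_def)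
qed

lemma const_coeff_invariant_ideal: "f \<in> \<I> \<Longrightarrow> const_coeff f = 0"
proof -
  assume "f \<in> \<I>"
  then have "f \<in> K (Suc 0)" unfolding invariant_ideal_def by blast
  then show "const_coeff f = 0" by simp
qed

text \<open>Each \<open>K k\<close> is a subgroup that contains all series of order
  \<open>k\<close>; so it is open, and an open subgroup is closed. The invariant ideal is the
  intersection of these subgroups.\<close>

lemma closedin_invariant_ideal: "closedin (Lam_topology m n) \<I>"
  unfolding closedin_Lam_topology
proof (intro conjI ballI)
  show "\<I> \<subseteq> Lam m n" using super_ideal_invariant_ideal by (rule super_idealD)
  fix f assume "f \<in> Lam m n - \<I>"
  then obtain k where f: "f \<in> Lam m n" "f \<notin> K k" by (auto simp: invariant_ideal_def)
  have "\<not> order_ge k (g - f)" if "g \<in> \<I>" for g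
  proof
    assume "order_ge k (g - f)"
    moreover have "g \<in> K k" using that by (simp add: invariant_ideal_def)
    ultimately have "g - (g - f) \<in> K k"
      using K_diff[of g k "g - f"] order_ge_K[of "g - f" k] K_Lam f(1) by (simp only: Lam_closed)
    with f(2) show False by simp
  qed
  then show "\<exists>k. \<forall>g\<in>\<I>. \<not> order_ge k (g - f)" by blast
qed

lemma subset_invariant_ideal:
  assumes "J \<subseteq> Lam m n" "\<And>X f. X \<in> L \<Longrightarrow> f \<in> J \<Longrightarrow> X f \<in> J" "\<And>f. f \<in> J \<Longrightarrow> const_coeff f = 0"
  shows "J \<subseteq> \<I>"
proof -
  have "J \<subseteq> K k" for k
  proof (induction k)
    case (Suc k)
    then show ?case using assms(2,3) by auto
  qed (use assms(1) in simp)
  then show ?thesis by (auto simp: invariant_ideal_def)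
qed

lemma value_at_0_parts:
  assumes "Y \<in> L" "Z \<in> L" "cont_superderivation m n 0 Y" "cont_superderivation m n 1 Z"
    "\<And>f. X f = Y f + Z f" "v \<in> variables m n"
  shows "value_at_0 Y v = (if vpar v = 0 then value_at_0 X v else 0)"
    "value_at_0 Z v = (if vpar v = 1 then value_at_0 X v else 0)"
proof -
  have "value_at_0 X v = value_at_0 Y v + value_at_0 Z v"
    by (simp add: value_at_0_def assms(5))
  then show "value_at_0 Y v = (if vpar v = 0 then value_at_0 X v else 0)"
    "value_at_0 Z v = (if vpar v = 1 then value_at_0 X v else 0)"
    using value_at_0_parity[OF assms(3,6)] value_at_0_parity[OF assms(4,6)] vpar_cases[of v] by auto
qed

text \<open>
  Fields vanishing at the origin preserve \<open>K k\<close>: in \<open>X\<^sub>1 \<dots> X\<^sub>j D f\<close> the factor \<open>D\<close> can be moved to the front,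
  where it produces no constant term, and the commutators only have \<open>j\<close> factors.
\<close>

lemma K_stable:
  assumes "D \<in> L" "\<And>v. v \<in> variables m n \<Longrightarrow> value_at_0 D v = 0" "f \<in> K k"
  shows "D f \<in> K k"
proof -
  have hom: "D f \<in> K k"
    if D: "D \<in> L" "t \<in> {0, 1}" "cont_superderivation m n t D" "\<And>v. v \<in> variables m n \<Longrightarrow> value_at_0 D v = 0"
      and f: "f \<in> K k" for D t f k
    using f
  proof (induction k arbitrary: f)
    case 0
    then show ?case using D by (simp add: csdD)
  next
    case (Suc k)
    have fL: "f \<in> Lam m n" using Suc.prems K_Lam by blast
    show ?case
    proof (rule K_SucI)
      show "D f \<in> K k" using Suc by simp
      show "const_coeff (D f) = 0"
        using D(4) by (simp add: const_coeff_W[OF L_W[OF D(1)] fL])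
      fix X s assume X: "X \<in> L" "s \<in> {0, 1}" "cont_superderivation m n s X"
      have "X (D f) - smult ((-1) ^ (s * t)) (D (X f)) \<in> K k"
        using bspec[OF conjunct2[OF conjunct2[OF Suc.prems[simplified]]]
            L_bracket[OF X(1) D(1) X(2) D(2) X(3) D(3)]] .
      moreover have "D (X f) \<in> K k" using Suc X(1) by simp
      ultimately have "X (D f) - smult ((-1) ^ (s * t)) (D (X f)) + smult ((-1) ^ (s * t)) (D (X f)) \<in> K k"
        by (intro K_add K_smult)
      then show "X (D f) \<in> K k" by simp
    qed
  qed
  obtain Y Z where YZ: "Y \<in> L" "Z \<in> L" "cont_superderivation m n 0 Y" "cont_superderivation m n 1 Z"
    "\<And>f. D f = Y f + Z f"
    using L_decomp[OF assms(1)] by blast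
  have "Y f \<in> K k" "Z f \<in> K k"
    using hom[OF YZ(1) _ YZ(3) _ assms(3)] hom[OF YZ(2) _ YZ(4) _ assms(3)]
      value_at_0_parts[OF YZ] assms(2) by auto
  then show ?thesis by (simp add: YZ(5) K_add)
qed

end

section \<open>Adapted coordinates\<close>

text \<open>The last two conditions say that evaluation on \<open>Y\<close> maps the projection of
  \<open>L\<close> isomorphically onto the functions on \<open>Y\<close>: \<open>E_value\<close>
  provides a dual basis, and \<open>determined\<close> is injectivity. Each \<open>E a\<close> has
  the parity of \<open>a\<close>, so that brackets of these fields are available.\<close>

locale adapted = subalgebra +
  fixes Y :: "var set" and E :: "var \<Rightarrow> sps \<Rightarrow> sps"
  assumes Y: "Y \<subseteq> variables m n"
    and E_L: "\<And>a. a \<in> Y \<Longrightarrow> E a \<in> L"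
    and E_csd: "\<And>a. a \<in> Y \<Longrightarrow> cont_superderivation m n (vpar a) (E a)"
    and E_value: "\<And>a b. a \<in> Y \<Longrightarrow> b \<in> Y \<Longrightarrow> value_at_0 (E a) b = (if a = b then 1 else 0)"
    and determined: "\<And>X v. X \<in> L \<Longrightarrow> (\<And>b. b \<in> Y \<Longrightarrow> value_at_0 X b = 0) \<Longrightarrow>
      v \<in> variables m n \<Longrightarrow> value_at_0 X v = 0"

text \<open>This is Gaussian elimination on the values at the origin, phrased as the choice of a set
  \<open>Y\<close> of largest cardinality that admits dual fields; maximality yields
  \<open>determined\<close>.\<close>

lemma (in subalgebra) adapted_exists: "\<exists>Y E. adapted m n L Y E"
proof -
  define Q where "Q = (\<lambda>Y. Y \<subseteq> variables m n \<and>
    (\<exists>E. \<forall>a\<in>Y. E a \<in> L \<and> (\<forall>b\<in>Y. value_at_0 (E a) b = (if a = b then 1 else 0))))"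
  have "Q {}" by (simp add: Q_def)
  moreover have "\<forall>Y. Q Y \<longrightarrow> card Y < Suc (card (variables m n))"
    by (auto simp: Q_def less_Suc_eq_le intro!: card_mono)
  ultimately have "\<exists>Y. Q Y \<and> (\<forall>Z. Q Z \<longrightarrow> card Z \<le> card Y)"
    by (rule ex_has_greatest_nat)
  then obtain Y where "Q Y" and max: "\<And>Z. Q Z \<Longrightarrow> card Z \<le> card Y" by blast
  then obtain E where Y: "Y \<subseteq> variables m n" and E: "\<And>a. a \<in> Y \<Longrightarrow> E a \<in> L"
    "\<And>a b. a \<in> Y \<Longrightarrow> b \<in> Y \<Longrightarrow> value_at_0 (E a) b = (if a = b then 1 else 0)"
    unfolding Q_def by blast
  have "finite Y" using Y by (rule finite_subset) simp
  \<comment> \<open>The part of \<open>E a\<close> with the parity of \<open>a\<close> has the same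
    values on \<open>Y\<close>, since the values at variables of the other parity are
    \<open>0\<close> already.\<close>
  have "\<exists>F. F \<in> L \<and> cont_superderivation m n (vpar a) F \<and> (\<forall>b\<in>Y. value_at_0 F b = (if a = b then 1 else 0))"
    if a: "a \<in> Y" for a
  proof -
    obtain G H where GH: "G \<in> L" "H \<in> L" "cont_superderivation m n 0 G" "cont_superderivation m n 1 H"
      "\<And>f. E a f = G f + H f"
      using L_decomp[OF E(1)[OF a]] by blast
    have val: "value_at_0 G b = (if vpar b = 0 then if a = b then 1 else 0 else 0)"
      "value_at_0 H b = (if vpar b = 1 then if a = b then 1 else 0 else 0)" if "b \<in> Y" for b
      using value_at_0_parts[OF GH, of b] E(2)[OF a that] that Y by auto
    show ?thesis
    proof (cases "vpar a = 0")
      case True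
      then show ?thesis using GH val by (intro exI[of _ G]) auto
    next
      case False
      then have "vpar a = 1" using vpar_cases[of a] by simp
      then show ?thesis using GH val by (intro exI[of _ H]) auto
    qed
  qed
  then obtain F where F: "\<And>a. a \<in> Y \<Longrightarrow> F a \<in> L" "\<And>a. a \<in> Y \<Longrightarrow> cont_superderivation m n (vpar a) (F a)"
    "\<And>a b. a \<in> Y \<Longrightarrow> b \<in> Y \<Longrightarrow> value_at_0 (F a) b = (if a = b then 1 else 0)"
    by metis
  have determined: "value_at_0 X v = 0"
    if X: "X \<in> L" "\<And>b. b \<in> Y \<Longrightarrow> value_at_0 X b = 0" and v: "v \<in> variables m n" for X v
  proof (rule ccontr)
    assume nz: "value_at_0 X v \<noteq> 0"
    then have "v \<notin> Y" using X(2) by blast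
    \<comment> \<open>A field that vanishes on \<open>Y\<close> but not at \<open>v\<close> serves
      as a pivot: it is normalised at \<open>v\<close>, and its multiples clear the entry
      \<open>v\<close> of the other fields. The sum over the singleton \<open>{X}\<close> only fits
      the form of \<open>L_minus_sum\<close>.\<close>
    define E' where "E' = (\<lambda>a. if a = v then (\<lambda>f. smult (1 / value_at_0 X v) (X f))
      else (\<lambda>f. E a f - (\<Sum>x\<in>{X}. smult (value_at_0 (E a) v / value_at_0 X v) (x f))))"
    have "E' a \<in> L" if "a \<in> insert v Y" for a
    proof (cases "a = v")
      case True
      then show ?thesis using L_smult[OF X(1)] by (simp add: E'_def)
    next
      case False
      then have "(\<lambda>f. E a f - (\<Sum>x\<in>{X}. smult (value_at_0 (E a) v / value_at_0 X v) (x f))) \<in> L"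
        using that X(1) E(1) by (intro L_minus_sum) auto
      then show ?thesis using False by (simp add: E'_def)
    qed
    moreover have "value_at_0 (E' a) b = (if a = b then 1 else 0)"
      if "a \<in> insert v Y" "b \<in> insert v Y" for a b
    proof -
      have 1: "value_at_0 (E' v) b = value_at_0 X b / value_at_0 X v"
        by (simp add: E'_def value_at_0_def)
      have 2: "value_at_0 (E' a) b = value_at_0 (E a) b - value_at_0 (E a) v / value_at_0 X v * value_at_0 X b"
        if "a \<noteq> v"
        using that by (simp add: E'_def value_at_0_def)
      show ?thesis
        using that nz \<open>v \<notin> Y\<close> E(2) X(2) 1 2 by (cases "a = v"; cases "b = v") auto
    qed
    ultimately have "Q (insert v Y)"
      using Y v unfolding Q_def by blast
    then have "card (insert v Y) \<le> card Y" by (rule max)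
    then show False using \<open>v \<notin> Y\<close> \<open>finite Y\<close> by simp
  qed
  have "adapted m n L Y F"
  proof unfold_locales
    show "value_at_0 X v = 0" if "X \<in> L" "\<And>b. b \<in> Y \<Longrightarrow> value_at_0 X b = 0" "v \<in> variables m n" for X v
      by (rule determined[OF that])
  qed (use Y F in auto)
  then show ?thesis by blast
qed

context adapted
begin

lemma finite_Y: "finite Y"
  using Y by (rule finite_subset) simp

lemma Lam_on_Y: "f \<in> Lam_on Y \<Longrightarrow> f \<in> Lam m n"
  using Lam_on_mono[OF Y] by (auto simp: Lam_eq_Lam_on)

lemma E_leading_part:
  assumes "a \<in> Y" "p \<in> Lam_on Y" "order_ge k p"
  shows "order_ge k (E a p - pd a p)"
proof -
  have "(\<Sum>v\<in>variables m n. smult (value_at_0 (E a) v) (pd v p))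
      = (\<Sum>v\<in>Y. smult (value_at_0 (E a) v) (pd v p))"
    using Y pd_Lam_on_eq_0[OF assms(2)] by (intro sum.mono_neutral_right) auto
  also have "\<dots> = (\<Sum>v\<in>Y. if a = v then pd v p else 0)"
    using E_value[OF assms(1)] by (intro sum.cong) auto
  also have "\<dots> = pd a p" using finite_Y assms(1) by simp
  finally show ?thesis
    using W_leading_part[OF L_W[OF E_L[OF assms(1)]] Lam_on_Y[OF assms(2)] assms(3)] by simp
qed

lemma E_leading_part_K:
  assumes "a \<in> Y" "p \<in> Lam_on Y" "homogeneous k p"
  shows "E a p - pd a p \<in> K k"
  using assms by (intro order_ge_K E_leading_part order_ge_homogeneous Lam_closed
      L_closed(1)[OF E_L] Lam_on_Y pd_Lam_on)

text \<open>The values on \<open>Y\<close> cancel by duality; \<open>determined\<close> takes care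
  of the remaining variables.\<close>

lemma reduce:
  assumes X: "X \<in> L"
  defines "D \<equiv> \<lambda>f. X f - (\<Sum>a\<in>Y. smult (value_at_0 X a) (E a f))"
  shows "D \<in> L" "v \<in> variables m n \<Longrightarrow> value_at_0 D v = 0"
proof -
  show D: "D \<in> L" unfolding D_def by (intro L_minus_sum finite_Y X E_L)
  have "value_at_0 D b = 0" if b: "b \<in> Y" for b
  proof -
    have "value_at_0 D b = value_at_0 X b - (\<Sum>a\<in>Y. value_at_0 X a * value_at_0 (E a) b)"
      by (simp add: D_def value_at_0_def sps_nth_sum)
    also have "(\<Sum>a\<in>Y. value_at_0 X a * value_at_0 (E a) b)
        = (\<Sum>a\<in>Y. if a = b then value_at_0 X a else 0)"
      using E_value b by (intro sum.cong) auto
    finally show ?thesis using finite_Y b by simp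
  qed
  then show "v \<in> variables m n \<Longrightarrow> value_at_0 D v = 0"
    by (rule determined[OF D])
qed

lemma value_expansion:
  assumes "X \<in> L" "v \<in> variables m n"
  shows "value_at_0 X v = (\<Sum>a\<in>Y. value_at_0 X a * value_at_0 (E a) v)"
  using reduce(2)[OF assms] by (simp add: value_at_0_def sps_nth_sum)

text \<open>By \<open>reduce\<close> every field of \<open>L\<close> is a combination of the
  \<open>E a\<close> up to a field that vanishes at the origin, and the latter preserves
  \<open>K k\<close>. So only the finitely many \<open>E a\<close> have to be tested.\<close>

lemma K_SucI_Y:
  assumes f: "f \<in> K k" "const_coeff f = 0" and E: "\<And>a. a \<in> Y \<Longrightarrow> E a f \<in> K k"
  shows "f \<in> K (Suc k)"
proof (rule K_SucI[OF f])
  fix X assume X: "X \<in> L"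
  have "X f - (\<Sum>a\<in>Y. smult (value_at_0 X a) (E a f)) \<in> K k"
    using K_stable[OF reduce[OF X] f(1)] .
  moreover have "(\<Sum>a\<in>Y. smult (value_at_0 X a) (E a f)) \<in> K k"
    by (intro K_sum K_smult E)
  ultimately have "X f - (\<Sum>a\<in>Y. smult (value_at_0 X a) (E a f))
      + (\<Sum>a\<in>Y. smult (value_at_0 X a) (E a f)) \<in> K k"
    by (rule K_add)
  then show "X f \<in> K k" by simp
qed

text \<open>Up to terms of \<open>K k\<close> the field \<open>E a\<close> acts on \<open>p\<close>
  as \<open>pd a\<close>. Hence the partial derivatives of \<open>p\<close> lie in
  \<open>K k\<close> and vanish by induction on the degree; Euler's formula then gives
  \<open>p = 0\<close> in positive degree.\<close>

lemma homogeneous_K_eq_0: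
  "p \<in> Lam_on Y \<Longrightarrow> homogeneous k p \<Longrightarrow> p \<in> K (Suc k) \<Longrightarrow> p = 0"
proof (induction k arbitrary: p)
  case 0
  then show ?case using homogeneous_0_eq[of p] by simp
next
  case (Suc k)
  have "pd a p = 0" if a: "a \<in> Y" for a
  proof (rule Suc.IH)
    have "E a p \<in> K (Suc k)" using Suc.prems(3) E_L[OF a] by simp
    then have "E a p - (E a p - pd a p) \<in> K (Suc k)"
      using E_leading_part_K[OF a Suc.prems(1,2)] by (rule K_diff)
    then show "pd a p \<in> K (Suc k)" by simp
  qed (use Suc.prems in \<open>auto intro: pd_Lam_on homogeneous_pd\<close>)
  then have "smult (of_nat (Suc k)) p = 0"
    using euler_homogeneous[OF finite_Y Suc.prems(1,2)] by simp
  then have "smult (1 / of_nat (Suc k)) (smult (of_nat (Suc k)) p) = 0" by (simp only: smult_simps)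
  then show ?case by (simp del: of_nat_Suc)
qed

text \<open>The homogeneous components below degree \<open>k\<close> vanish one after the other: the
  lowest one left differs from \<open>p\<close> by terms of higher order, so
  \<open>homogeneous_K_eq_0\<close> applies to it. On \<open>Lam_on Y\<close> this is the converse
  of \<open>order_ge_K\<close>.\<close>

lemma order_ge_of_K: "p \<in> Lam_on Y \<Longrightarrow> p \<in> K k \<Longrightarrow> order_ge k p"
proof (induction k)
  case (Suc k)
  let ?d = "degree_part (int k) p"
  have o: "order_ge (Suc k) (p - ?d)"
    using Suc by (intro order_ge_diff_degree_part) simp
  have d: "?d \<in> Lam_on Y" using Suc.prems by (intro Lam_on_degree_part)
  have "p - (p - ?d) \<in> K (Suc k)"
    using Suc.prems d by (intro K_diff order_ge_K[OF _ o]) (auto simp: Lam_closed Lam_on_Y)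
  then have "?d = 0"
    using d by (intro homogeneous_K_eq_0[of _ k] homogeneous_degree_part) auto
  with o show ?case by simp
qed simp

lemma Lam_on_invariant_ideal: "p \<in> Lam_on Y \<Longrightarrow> p \<in> \<I> \<Longrightarrow> p = 0"
  using order_ge_of_K by (intro order_ge_eq_zero) (auto simp: invariant_ideal_def)

text \<open>
  The induction step is Poincare's lemma: the leading parts \<open>p a\<close> of \<open>E a f\<close> satisfy the integrability
  condition because \<open>L\<close> is closed under brackets, so they are the partial derivatives of the Euler
  integral \<open>g\<close>.
\<close>

lemma leading_part_exists:
  "f \<in> K k \<Longrightarrow> \<exists>p\<in>Lam_on Y. homogeneous k p \<and> f - p \<in> K (Suc k)"
proof (induction k arbitrary: f)
  case 0
  have "homogeneous 0 (smult (const_coeff f) 1)"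
    by (auto simp: homogeneous_def sps_nth_one fcard_fempty)
  moreover have "f - smult (const_coeff f) 1 \<in> K (Suc 0)"
    using 0 by (auto simp: sps_nth_one Lam_closed L_closed)
  ultimately show ?case by (intro bexI[of _ "smult (const_coeff f) 1"]) (auto simp: Lam_on_smult)
next
  case (Suc k)
  have fL: "f \<in> Lam m n" using Suc.prems K_Lam by blast
  have "\<exists>p\<in>Lam_on Y. homogeneous k p \<and> E a f - p \<in> K (Suc k)" if "a \<in> Y" for a
    using Suc that E_L by simp
  then obtain p where p: "\<And>a. a \<in> Y \<Longrightarrow> p a \<in> Lam_on Y" "\<And>a. a \<in> Y \<Longrightarrow> homogeneous k (p a)"
    "\<And>a. a \<in> Y \<Longrightarrow> E a f - p a \<in> K (Suc k)"
    by metis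
  have compat: "pd a (p b) = smult ((-1) ^ (vpar a * vpar b)) (pd b (p a))" (is "_ = smult ?s _")
    if a: "a \<in> Y" and b: "b \<in> Y" for a b
  proof (cases k)
    \<comment> \<open>In degree \<open>0\<close> the \<open>p a\<close> are constants and both sides
      vanish; there is no degree \<open>k - 1\<close> in which to compare them.\<close>
    case 0
    have "pd c (p d) = 0" if "d \<in> Y" for c d
      using homogeneous_0_eq[of "p d"] p(2)[OF that] pd_smult[of c _ 1] by (metis 0 pd_one smult_simps(1))
    then show ?thesis using a b by simp
  next
    case (Suc j)
    \<comment> \<open>\<open>E c\<close> maps \<open>K (Suc k)\<close> to \<open>K k\<close>, so it
      may be applied to the approximation of \<open>E d f\<close> by \<open>p d\<close>; on
      \<open>p d\<close> itself it acts as \<open>pd c\<close> up to terms of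
      \<open>K k\<close>.\<close>
    have *: "E c (E d f) - pd c (p d) \<in> K k" if c: "c \<in> Y" and d: "d \<in> Y" for c d
    proof -
      have "E c (E d f - p d) \<in> K k" using p(3)[OF d] E_L[OF c] by simp
      then have "E c (E d f) - E c (p d) \<in> K k"
        using fL by (simp add: L_closed E_L c d Lam_on_Y p)
      then have "(E c (E d f) - E c (p d)) + (E c (p d) - pd c (p d)) \<in> K k"
        by (intro K_add E_leading_part_K c p d)
      then show ?thesis by simp
    qed
    have br: "E a (E b f) - smult ?s (E b (E a f)) \<in> K k"
      using L_bracket[OF E_L[OF a] E_L[OF b] _ _ E_csd[OF a] E_csd[OF b]] Suc.prems vpar_cases by auto
    have "E a (E b f) - smult ?s (E b (E a f)) - (E a (E b f) - pd a (p b))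
        + smult ?s (E b (E a f) - pd b (p a)) \<in> K k"
      by (rule K_add[OF K_diff[OF br *[OF a b]] K_smult[OF *[OF b a]]])
    then have "pd a (p b) - smult ?s (pd b (p a)) \<in> K (Suc j)"
      by (simp add: smult_diff Suc)
    moreover have "homogeneous j (pd a (p b) - smult ?s (pd b (p a)))"
      using p(2)[OF a] p(2)[OF b] unfolding Suc by (intro homogeneous_diff homogeneous_smult homogeneous_pd)
    moreover have "pd a (p b) - smult ?s (pd b (p a)) \<in> Lam_on Y"
      using p(1)[OF a] p(1)[OF b] by (intro Lam_on_diff Lam_on_smult pd_Lam_on)
    ultimately show ?thesis
      using homogeneous_K_eq_0 by (metis right_minus_eq)
  qed
  \<comment> \<open>The factor is the inverse of the degree of \<open>g\<close>: under
    \<open>pd b\<close>, integrability and Euler's formula for \<open>p b\<close> yield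
    \<open>k\<close> copies of \<open>p b\<close>, and the derivative of \<open>gen b\<close> yields
    one more.\<close>
  define g where "g = smult (1 / of_nat (Suc k)) (\<Sum>a\<in>Y. gen a * p a)"
  have g: "g \<in> Lam_on Y" "homogeneous (Suc k) g"
    unfolding g_def using homogeneous_mult[OF homogeneous_gen, of k]
    by (auto intro!: Lam_on_smult Lam_on_sum Lam_on_mult gen_Lam_on p homogeneous_smult homogeneous_sum)
  have pd_g: "pd b g = p b" if b: "b \<in> Y" for b
  proof -
    have "pd b (\<Sum>a\<in>Y. gen a * p a) = (\<Sum>a\<in>Y. (if b = a then p a else 0) + gen a * pd a (p b))"
      unfolding pd_sum
    proof (rule sum.cong[OF refl])
      fix a assume a: "a \<in> Y"
      show "pd b (gen a * p a) = (if b = a then p a else 0) + gen a * pd a (p b)"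
        unfolding pd_mult[OF has_parity_gen] compat[OF a b] by (simp add: pd_gen mult.commute)
    qed
    also have "\<dots> = smult (of_nat (Suc k)) (p b)"
      using euler_homogeneous[OF finite_Y p(1,2)[OF b]] finite_Y b
      by (simp add: sum.distrib smult_add_left)
    finally show ?thesis by (simp add: g_def pd_smult del: of_nat_Suc)
  qed
  have gK: "g \<in> K (Suc k)"
    using g by (intro order_ge_K Lam_on_Y order_ge_homogeneous)
  have "f - g \<in> K (Suc (Suc k))"
  proof (rule K_SucI_Y)
    show "f - g \<in> K (Suc k)" using Suc.prems gK by (rule K_diff)
    then show "const_coeff (f - g) = 0" by simp
    fix b assume b: "b \<in> Y"
    have "(E b f - p b) - (E b g - pd b g) \<in> K (Suc k)"
      by (intro K_diff p(3) E_leading_part_K b g)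
    then show "E b (f - g) \<in> K (Suc k)"
      using fL g(1) b by (simp add: pd_g L_closed E_L Lam_on_Y)
  qed
  with g show ?case by blast
qed

text \<open>Leading parts are split off successively, with remainders \<open>r k\<close> in
  \<open>K k\<close>. The tail of the assembled series has order \<open>k\<close> and lies in
  \<open>K k\<close> as well, so \<open>f - assemble p\<close> lies in every
  \<open>K k\<close>.\<close>

lemma decomposition:
  assumes "f \<in> Lam m n"
  shows "\<exists>h\<in>Lam_on Y. f - h \<in> \<I>"
proof -
  have "\<exists>p. f \<in> K k \<longrightarrow> p \<in> Lam_on Y \<and> homogeneous k p \<and> f - p \<in> K (Suc k)" for k f
    using leading_part_exists by blast
  then have "\<exists>P. \<forall>k f. f \<in> K k \<longrightarrow>
      P k f \<in> Lam_on Y \<and> homogeneous k (P k f) \<and> f - P k f \<in> K (Suc k)"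
    by (intro choice allI)
  then obtain P where P: "\<And>k f. f \<in> K k \<Longrightarrow>
      P k f \<in> Lam_on Y \<and> homogeneous k (P k f) \<and> f - P k f \<in> K (Suc k)"
    by blast
  define r where "r = rec_nat f (\<lambda>k g. g - P k g)"
  have r: "r 0 = f" "r (Suc k) = r k - P k (r k)" for k by (simp_all add: r_def)
  have rK: "r k \<in> K k" for k
  proof (induction k)
    case (Suc k)
    then show ?case using P r(2) by metis
  qed (use assms r in simp)
  define p where "p = (\<lambda>k. P k (r k))"
  have p: "p k \<in> Lam_on Y" "homogeneous k (p k)" for k
    using P[OF rK] by (simp_all add: p_def)
  have "f = r k + (\<Sum>i<k. p i)" for k
    by (induction k) (simp_all add: r p_def)
  then have "f - assemble p = r k - (assemble p - (\<Sum>i<k. p i))" for k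
    by (metis (no_types, lifting) add_diff_cancel_right' diff_diff_eq2)
  moreover have "assemble p - (\<Sum>i<k. p i) \<in> K k" for k
    using p by (intro order_ge_K order_ge_assemble_diff Lam_closed Lam_on_Y assemble_Lam_on Lam_on_sum)
  ultimately have "f - assemble p \<in> K k" for k
    using K_diff[OF rK] by metis
  then show ?thesis
    using assemble_Lam_on[of p Y] p(1) by (auto simp: invariant_ideal_def)
qed

end

section \<open>Exponentials of derivations of positive degree\<close>

locale raising_operator =
  fixes D :: "sps \<Rightarrow> sps"
  assumes D_add: "D (f + g) = D f + D g"
    and D_smult: "D (smult c f) = smult c (D f)"
    and D_raise: "order_ge k f \<Longrightarrow> order_ge (Suc k) (D f)"
begin

definition divided_power :: "nat \<Rightarrow> sps \<Rightarrow> sps" where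
  "divided_power k f = smult (1 / fact k) ((D ^^ k) f)"

text \<open>The term with index \<open>k\<close> has order at least \<open>k\<close> and does not
  contribute to monomials of smaller degree. So the finite sum is the whole exponential series at
  the given monomial.\<close>

definition expo :: "sps \<Rightarrow> sps" where
  "expo f = Sps (\<lambda>A S. \<Sum>k\<le>size A + fcard S. sps_nth (divided_power k f) A S)"

lemma D_zero [simp]: "D 0 = 0"
  using D_smult[of 0 0] by simp

lemma D_sum: "D (\<Sum>i\<in>I. F i) = (\<Sum>i\<in>I. D (F i))"
  by (induction I rule: infinite_finite_induct) (simp_all add: D_add)

lemma divided_power_0 [simp]: "divided_power 0 f = f"
  by (simp add: divided_power_def)

lemma D_divided_power: "D (divided_power k f) = smult (of_nat (Suc k)) (divided_power (Suc k) f)"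
  by (simp add: divided_power_def D_smult field_simps del: of_nat_Suc)

lemma divided_power_Suc: "divided_power (Suc k) f = smult (1 / of_nat (Suc k)) (D (divided_power k f))"
  by (simp add: D_divided_power del: of_nat_Suc)

lemma divided_power_add: "divided_power k (f + g) = divided_power k f + divided_power k g"
  by (induction k) (simp_all add: divided_power_Suc D_add smult_add del: of_nat_Suc)

lemma divided_power_smult: "divided_power k (smult c f) = smult c (divided_power k f)"
  by (induction k) (simp_all add: divided_power_Suc D_smult mult.commute del: of_nat_Suc)

lemma divided_power_diff: "divided_power k (f - g) = divided_power k f - divided_power k g"
  using divided_power_add[of k f "- g"] divided_power_smult[of k "-1" g] by (simp add: smult_minus_left)

lemma divided_power_sum: "divided_power k (\<Sum>i\<in>I. F i) = (\<Sum>i\<in>I. divided_power k (F i))"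
  using divided_power_smult[of k 0 0]
  by (induction I rule: infinite_finite_induct) (simp_all add: divided_power_add)

lemma order_ge_divided_power: "order_ge j f \<Longrightarrow> order_ge (j + k) (divided_power k f)"
  by (induction k) (simp_all add: divided_power_Suc order_ge_smult D_raise del: of_nat_Suc)

lemma order_ge_divided_power': "order_ge k (divided_power k f)"
  using order_ge_divided_power[of 0 f k] by simp

lemma expo_approx: "order_ge N (expo f - (\<Sum>k<N. divided_power k f))"
  unfolding order_ge_iff
proof (intro allI impI)
  fix A :: "nat multiset" and S :: "nat fset"
  assume N: "size A + fcard S < N"
  have "(\<Sum>k<N. sps_nth (divided_power k f) A S) = (\<Sum>k\<le>size A + fcard S. sps_nth (divided_power k f) A S)"
    using N order_ge_divided_power' by (intro sum.mono_neutral_right) (auto simp: order_ge_iff)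
  then show "sps_nth (expo f - (\<Sum>k<N. divided_power k f)) A S = 0"
    by (simp add: expo_def sps_nth_sum)
qed

text \<open>A series is determined by approximations of every order. The form \<open>Suc N\<close>
  makes the term for \<open>k = 0\<close> present in every partial sum, so that it can be split
  off.\<close>

lemma expo_eqI:
  assumes "\<And>N. order_ge (Suc N) (g - (\<Sum>k<Suc N. divided_power k f))"
  shows "expo f = g"
proof -
  have "order_ge N (expo f - g)" for N
  proof -
    have "order_ge (Suc N) ((expo f - (\<Sum>k<Suc N. divided_power k f)) - (g - (\<Sum>k<Suc N. divided_power k f)))"
      by (intro order_ge_diff expo_approx assms)
    then have "order_ge (Suc N) (expo f - g)" by (simp only: diff_diff_eq2 diff_add_cancel)
    then show ?thesis by (rule order_ge_mono) simp
  qed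
  then show ?thesis using order_ge_eq_zero by (metis right_minus_eq)
qed

lemma expo_add: "expo (f + g) = expo f + expo g"
  and expo_diff: "expo (f - g) = expo f - expo g"
  and expo_smult: "expo (smult c f) = smult c (expo f)"
  by (rule sps_eqI; simp add: expo_def divided_power_add divided_power_diff divided_power_smult
      sum.distrib sum_subtractf sum_distrib_left)+

lemma order_ge_expo: "order_ge k f \<Longrightarrow> order_ge k (expo f)"
  using order_ge_divided_power[of k f] order_ge_mono
  by (auto simp: order_ge_iff expo_def intro!: sum.neutral)

lemma expo_eq_self: "D f = 0 \<Longrightarrow> expo f = f"
proof (rule expo_eqI)
  fix N assume "D f = 0"
  then have "divided_power (Suc k) f = 0" for k
    by (induction k) (simp_all add: divided_power_Suc)
  then show "order_ge (Suc N) (f - (\<Sum>k<Suc N. divided_power k f))"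
    by (simp add: sum.lessThan_Suc_shift del: sum.lessThan_Suc)
qed

lemma expo_eq_add: "D (D f) = 0 \<Longrightarrow> expo f = f + D f"
proof (rule expo_eqI)
  fix N assume D: "D (D f) = 0"
  have "divided_power (Suc (Suc k)) f = 0" for k
    by (induction k) (simp_all add: divided_power_Suc D D_smult)
  \<comment> \<open>For \<open>N = 0\<close> the partial sum is \<open>f\<close> alone; the rest
    \<open>D f\<close> has order \<open>1\<close> because \<open>D\<close> raises the order.\<close>
  then show "order_ge (Suc N) (f + D f - (\<Sum>k<Suc N. divided_power k f))"
    using D_raise[of 0 f]
    by (cases N) (simp_all add: sum.lessThan_Suc_shift divided_power_Suc del: sum.lessThan_Suc)
qed

lemma expo_Lam_on:
  assumes "\<And>f. f \<in> Lam_on V \<Longrightarrow> D f \<in> Lam_on V" "f \<in> Lam_on V"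
  shows "expo f \<in> Lam_on V"
proof -
  have "divided_power k f \<in> Lam_on V" for k
    by (induction k) (simp_all add: divided_power_Suc assms Lam_on_smult del: of_nat_Suc)
  then show ?thesis by (auto simp: Lam_on_iff expo_def intro!: sum.neutral)
qed

lemma has_parity_expo:
  assumes "\<And>f. has_parity p f \<Longrightarrow> has_parity p (D f)" "has_parity p f"
  shows "has_parity p (expo f)"
proof -
  have "has_parity p (divided_power k f)" for k
    by (induction k) (simp_all add: divided_power_Suc assms has_parity_smult del: of_nat_Suc)
  then show ?thesis by (auto simp: has_parity_iff expo_def intro!: sum.neutral)
qed

lemma divided_power_divided_power:
  "divided_power i (divided_power j f) = smult (of_nat ((i + j) choose i)) (divided_power (i + j) f)"
proof -
  have "divided_power i (divided_power j f) = smult (1 / fact i * (1 / fact j)) ((D ^^ (i + j)) f)"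
  proof -
    have "(D ^^ i) (smult c g) = smult c ((D ^^ i) g)" for c g
      by (induction i) (simp_all add: D_smult)
    then show ?thesis by (simp add: divided_power_def funpow_add)
  qed
  also have "1 / fact i * (1 / fact j) = of_nat ((i + j) choose i) * (1 / fact (i + j) :: complex)"
    by (simp add: binomial_fact[of i "i + j"])
  finally show ?thesis by (simp add: divided_power_def)
qed

end

text \<open>The sums over the square and over the triangle \<open>i + j < N\<close> differ by terms
  with \<open>i + j \<ge> N\<close>. This replaces the rearrangement of an infinite double
  series.\<close>

lemma order_ge_double_sum:
  assumes "\<And>i j. order_ge (i + j) (T i j)"
  shows "order_ge N ((\<Sum>i<N. \<Sum>j<N. T i j) - (\<Sum>k<N. \<Sum>i\<le>k. T i (k - i)))"
proof -
  let ?B = "{(i, j). i + j < N}"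
  have sub: "?B \<subseteq> {..<N} \<times> {..<N}" by auto
  have "(\<Sum>k<N. \<Sum>i\<le>k. T i (k - i)) = (\<Sum>(i, j)\<in>?B. T i j)"
    by (rule sum.triangle_reindex[symmetric])
  moreover have "(\<Sum>i<N. \<Sum>j<N. T i j) = (\<Sum>(i, j)\<in>{..<N} \<times> {..<N}. T i j)"
    by (rule sum.cartesian_product)
  moreover have "\<dots> = (\<Sum>(i, j)\<in>{..<N} \<times> {..<N} - ?B. T i j) + (\<Sum>(i, j)\<in>?B. T i j)"
    by (rule sum.subset_diff[OF sub]) simp
  moreover have "order_ge N (\<Sum>(i, j)\<in>{..<N} \<times> {..<N} - ?B. T i j)"
    by (intro order_ge_sum) (clarsimp, metis assms not_less order_ge_mono)
  ultimately show ?thesis by simp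
qed

locale raising_derivation = raising_operator +
  assumes leibniz: "D (f * g) = D f * g + f * D g"
begin

text \<open>With the factorials absorbed, the iterated Leibniz rule has no binomial coefficients. In
  the induction step both sides are multiplied by \<open>Suc k\<close>; the two weights of a term,
  \<open>i\<close> and \<open>Suc k - i\<close>, add up to this factor.\<close>

lemma divided_power_mult:
  "divided_power k (f * g) = (\<Sum>i\<le>k. divided_power i f * divided_power (k - i) g)"
proof (induction k)
  case (Suc k)
  let ?T = "\<lambda>i. divided_power i f * divided_power (Suc k - i) g"
  have "smult (of_nat (Suc k)) (divided_power (Suc k) (f * g)) = D (divided_power k (f * g))"
    by (simp only: D_divided_power)
  also have "\<dots> = (\<Sum>i\<le>k. smult (of_nat (Suc i)) (?T (Suc i))) + (\<Sum>i\<le>k. smult (of_nat (Suc k - i)) (?T i))"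
    unfolding Suc D_sum leibniz D_divided_power sum.distrib
    by (intro arg_cong2[where f = "(+)"] sum.cong) (simp_all add: Suc_diff_le)
  also have "(\<Sum>i\<le>k. smult (of_nat (Suc i)) (?T (Suc i))) = (\<Sum>i\<le>Suc k. smult (of_nat i) (?T i))"
    by (subst sum.atMost_Suc_shift) simp
  also have "(\<Sum>i\<le>k. smult (of_nat (Suc k - i)) (?T i)) = (\<Sum>i\<le>Suc k. smult (of_nat (Suc k - i)) (?T i))"
    by simp
  also have "(\<Sum>i\<le>Suc k. smult (of_nat i) (?T i)) + (\<Sum>i\<le>Suc k. smult (of_nat (Suc k - i)) (?T i))
      = smult (of_nat (Suc k)) (\<Sum>i\<le>Suc k. ?T i)"
    unfolding smult_sum sum.distrib[symmetric] smult_add_left[symmetric] of_nat_add[symmetric]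
    by (intro sum.cong) (auto simp del: of_nat_Suc of_nat_add)
  finally have "smult (1 / of_nat (Suc k)) (smult (of_nat (Suc k)) (divided_power (Suc k) (f * g)))
      = smult (1 / of_nat (Suc k)) (smult (of_nat (Suc k)) (\<Sum>i\<le>Suc k. ?T i))"
    by (rule arg_cong)
  then show ?case by (simp del: of_nat_Suc sum.atMost_Suc)
qed simp

text \<open>Both factors are replaced by partial sums up to order \<open>M\<close>, and the product
  of the partial sums by its Cauchy triangle, which \<open>divided_power_mult\<close> identifies
  with the partial sum for \<open>f * g\<close>.\<close>

lemma expo_mult: "expo (f * g) = expo f * expo g"
proof (rule expo_eqI)
  fix N :: nat
  define M where "M = Suc N"
  let ?F = "\<Sum>i<M. divided_power i f" and ?G = "\<Sum>j<M. divided_power j g"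
  have "order_ge (M + 0) ((expo f - ?F) * expo g)" "order_ge (0 + M) (?F * (expo g - ?G))"
    by (intro order_ge_mult expo_approx order_ge_0)+
  then have "order_ge M ((expo f - ?F) * expo g + ?F * (expo g - ?G))"
    by (intro order_ge_add) simp_all
  then have 1: "order_ge M (expo f * expo g - ?F * ?G)"
    by (simp add: algebra_simps)
  have "?F * ?G = (\<Sum>i<M. \<Sum>j<M. divided_power i f * divided_power j g)"
    by (rule sum_product)
  then have "order_ge M (?F * ?G - (\<Sum>k<M. divided_power k (f * g)))"
    unfolding divided_power_mult
    by (simp only:) (intro order_ge_double_sum order_ge_mult order_ge_divided_power')
  then have "order_ge M ((expo f * expo g - ?F * ?G) + (?F * ?G - (\<Sum>k<M. divided_power k (f * g))))"
    by (intro order_ge_add 1)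
  then show "order_ge (Suc N) (expo f * expo g - (\<Sum>k<Suc N. divided_power k (f * g)))"
    by (simp only: M_def[symmetric] diff_add_cancel add_diff_eq)
qed

end

lemma (in raising_operator) raising_operator_uminus: "raising_operator (\<lambda>f. - D f)"
  by unfold_locales (simp_all add: D_add D_smult smult_minus D_raise order_ge_uminus)

lemma (in raising_derivation) raising_derivation_uminus: "raising_derivation (\<lambda>f. - D f)"
  using raising_operator_uminus
  by (intro raising_derivation.intro raising_derivation_axioms.intro) (simp_all add: leibniz)

text \<open>The terms of total index \<open>k\<close> carry the alternating sum of the binomial
  coefficients, that is \<open>(1 - 1) ^ k\<close>, and only \<open>k = 0\<close> survives.\<close>

lemma (in raising_operator) expo_expo_uminus: "expo (raising_operator.expo (\<lambda>f. - D f) f) = f"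
proof (rule expo_eqI)
  interpret N: raising_operator "\<lambda>f. - D f" by (rule raising_operator_uminus)
  have pow: "((\<lambda>f. - D f) ^^ k) f = smult ((-1) ^ k) ((D ^^ k) f)" for k
    by (induction k) (simp_all add: D_smult smult_minus_left)
  have neg: "N.divided_power k f = smult ((-1) ^ k) (divided_power k f)" for k
    by (simp add: N.divided_power_def divided_power_def pow mult.commute)
  fix K :: nat
  define M where "M = Suc K"
  let ?G = "\<Sum>j<M. N.divided_power j f"
  \<comment> \<open>Divided powers do not lower the order, so the inner exponential may also be cut
    off at \<open>M\<close>.\<close>
  have 1: "order_ge M (\<Sum>k<M. divided_power k (N.expo f - ?G))"
    using order_ge_divided_power[OF N.expo_approx] order_ge_mono by (intro order_ge_sum) (meson le_add1)
  let ?T = "\<lambda>i j. smult ((-1) ^ j) (divided_power i (divided_power j f))"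
  have "(\<Sum>k<M. divided_power k ?G) = (\<Sum>i<M. \<Sum>j<M. ?T i j)"
    by (simp add: divided_power_sum neg divided_power_smult)
  moreover have "order_ge M ((\<Sum>i<M. \<Sum>j<M. ?T i j) - (\<Sum>k<M. \<Sum>i\<le>k. ?T i (k - i)))"
  proof (intro order_ge_double_sum order_ge_smult)
    show "order_ge (i + j) (divided_power i (divided_power j f))" for i j
      using order_ge_divided_power[OF order_ge_divided_power'[of j f], of i] by (simp add: add.commute)
  qed
  moreover have "(\<Sum>k<M. \<Sum>i\<le>k. ?T i (k - i)) = f"
  proof -
    have "(\<Sum>i\<le>k. ?T i (k - i)) = (if k = 0 then f else 0)" for k
    proof -
      have "(\<Sum>i\<le>k. ?T i (k - i)) = smult (\<Sum>i\<le>k. of_nat (k choose i) * 1 ^ i * (-1) ^ (k - i)) (divided_power k f)"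
        unfolding smult_sum_left
        by (intro sum.cong) (auto simp: divided_power_divided_power mult.commute)
      also have "(\<Sum>i\<le>k. of_nat (k choose i) * 1 ^ i * (-1) ^ (k - i)) = (1 + - 1 :: complex) ^ k"
        by (rule binomial_ring[symmetric])
      also have "smult ((1 + - 1) ^ k) (divided_power k f) = (if k = 0 then f else 0)"
        by (cases k) simp_all
      finally show ?thesis .
    qed
    then show ?thesis by (simp add: M_def)
  qed
  ultimately have "order_ge M ((\<Sum>k<M. divided_power k ?G) - f)" by simp
  then have "order_ge M (- ((\<Sum>k<M. divided_power k ?G) - f) - (\<Sum>k<M. divided_power k (N.expo f - ?G)))"
    by (rule order_ge_diff[OF order_ge_uminus 1])
  then show "order_ge (Suc K) (f - (\<Sum>k<Suc K. divided_power k (N.expo f)))"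
    by (simp add: divided_power_diff sum_subtractf flip: M_def)
qed

lemma (in raising_operator) expo_uminus_expo: "raising_operator.expo (\<lambda>f. - D f) (expo f) = f"
  using raising_operator.expo_expo_uminus[OF raising_operator_uminus] by simp

section \<open>The annihilator and division by its elements\<close>

context adapted
begin

text \<open>
  The linear form \<open>lam v\<close> in the variables of \<open>Y\<close> has the same derivative as \<open>v\<close> along all fields in the
  projection of \<open>L\<close>.
\<close>

definition lam :: "var \<Rightarrow> sps" where
  "lam v = (\<Sum>a\<in>Y. smult (value_at_0 (E a) v) (gen a))"

definition z :: "var \<Rightarrow> sps" where
  "z v = gen v - lam v"

lemma lam_Lam_on: "lam v \<in> Lam_on Y"
  unfolding lam_def by (intro Lam_on_sum Lam_on_smult gen_Lam_on)

lemma homogeneous_lam: "homogeneous 1 (lam v)"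
  unfolding lam_def by (intro homogeneous_sum homogeneous_smult homogeneous_gen)

text \<open>\<open>E a\<close> has the parity of \<open>a\<close>, so its value at a variable of the
  other parity vanishes; only variables with the parity of \<open>v\<close> occur in
  \<open>lam v\<close>.\<close>

lemma has_parity_lam: "v \<in> variables m n \<Longrightarrow> has_parity (vpar v) (lam v)"
  unfolding lam_def
proof (rule has_parity_sum)
  fix a assume v: "v \<in> variables m n" and a: "a \<in> Y"
  show "has_parity (vpar v) (smult (value_at_0 (E a) v) (gen a))"
  proof (cases "vpar a = vpar v")
    case True
    then show ?thesis using has_parity_gen[of a] by (simp add: has_parity_smult)
  next
    case False
    then have "value_at_0 (E a) v = 0"
      using vpar_cases[of a] by (intro value_at_0_parity[OF E_csd[OF a] v]) auto
    then show ?thesis by simp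
  qed
qed

lemma z_Lam: "v \<in> variables m n \<Longrightarrow> z v \<in> Lam m n"
  by (simp add: z_def Lam_closed lam_Lam_on Lam_on_Y)

lemma has_parity_z: "v \<in> variables m n \<Longrightarrow> has_parity (vpar v) (z v)"
  by (simp add: z_def has_parity_diff has_parity_gen has_parity_lam)

lemma order_ge_z: "order_ge (Suc 0) (z v)"
  using order_ge_homogeneous[OF homogeneous_lam] by (simp add: z_def order_ge_diff order_ge_gen)

lemma z_Y: "a \<in> Y \<Longrightarrow> z a = 0"
proof -
  assume a: "a \<in> Y"
  have "lam a = (\<Sum>b\<in>Y. if b = a then gen b else 0)"
    unfolding lam_def using a E_value by (intro sum.cong) auto
  then show ?thesis using a finite_Y by (simp add: z_def)
qed

text \<open>By \<open>value_expansion\<close> the constant term of \<open>E a (z v)\<close> is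
  \<open>0\<close>. Membership in \<open>K 2\<close> is what later identifies \<open>lam v\<close>
  as the linear part of \<open>eta v\<close>.\<close>

lemma z_K: "v \<in> variables m n \<Longrightarrow> z v \<in> K 2"
  unfolding numeral_2_eq_2
proof (rule K_SucI_Y)
  assume v: "v \<in> variables m n"
  show "z v \<in> K (Suc 0)" by (intro order_ge_K z_Lam v order_ge_z)
  show "const_coeff (z v) = 0" using order_ge_z by (simp only: order_ge_1_iff)
  fix a assume a: "a \<in> Y"
  have "E a (z v) = E a (gen v) - (\<Sum>b\<in>Y. smult (value_at_0 (E b) v) (E a (gen b)))"
    unfolding z_def using v a Y lam_Lam_on
    by (simp add: L_closed E_L Lam_closed Lam_on_Y)
      (simp add: lam_def W_sum[OF L_W[OF E_L]] L_closed E_L Lam_closed subset_iff)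
  then have "const_coeff (E a (z v)) = value_at_0 (E a) v - (\<Sum>b\<in>Y. value_at_0 (E b) v * value_at_0 (E a) b)"
    by (simp add: sps_nth_sum value_at_0_def)
  also have "\<dots> = 0"
    by (subst value_expansion[OF E_L[OF a] v]) (simp add: mult.commute)
  finally show "E a (z v) \<in> K (Suc 0)"
    using a v by (intro order_ge_K L_closed(1)[OF E_L] z_Lam) (simp_all add: order_ge_1_iff)
qed

lemma annihilator_eq_span:
  "annihilator m n (W_proj m n (-1) ` L) = {\<Sum>v\<in>variables m n. smult (c v) (z v) | c. True}"
proof (intro equalityI subsetI)
  fix l assume "l \<in> annihilator m n (W_proj m n (-1) ` L)"
  then obtain c where l: "l = (\<Sum>v\<in>variables m n. smult (c v) (gen v))"
    and c: "\<And>X. X \<in> L \<Longrightarrow> (\<Sum>v\<in>variables m n. value_at_0 X v * c v) = 0"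
    unfolding annihilator_eq by blast
  \<comment> \<open>The coefficient of \<open>gen a\<close> is the constant \<open>E a\<close>
    produces from \<open>l\<close> at the origin, which vanishes. So the variables in
    \<open>l\<close> may be replaced by the forms \<open>z v\<close> with the same
    coefficients.\<close>
  have "(\<Sum>v\<in>variables m n. smult (c v) (lam v))
      = (\<Sum>a\<in>Y. smult (\<Sum>v\<in>variables m n. value_at_0 (E a) v * c v) (gen a))"
    unfolding lam_def smult_sum smult_sum_left by (subst sum.swap) (simp add: mult.commute)
  also have "\<dots> = 0" using c E_L by simp
  finally have "l = (\<Sum>v\<in>variables m n. smult (c v) (z v))"
    by (simp add: z_def l smult_diff sum_subtractf)
  then show "l \<in> {\<Sum>v\<in>variables m n. smult (c v) (z v) | c. True}" by blast
next
  fix l assume "l \<in> {\<Sum>v\<in>variables m n. smult (c v) (z v) | c. True}"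
  then obtain c where l: "l = (\<Sum>v\<in>variables m n. smult (c v) (z v))" by blast
  \<comment> \<open>These are the coefficients of \<open>l\<close> with respect to the variables;
    each \<open>lam v\<close> contributes to variables in \<open>Y\<close> only.\<close>
  define d where "d = (\<lambda>w. c w - (if w \<in> Y then \<Sum>v\<in>variables m n. c v * value_at_0 (E w) v else 0))"
  have lam: "(\<Sum>v\<in>variables m n. smult (c v) (lam v))
      = (\<Sum>w\<in>variables m n. smult (if w \<in> Y then \<Sum>v\<in>variables m n. c v * value_at_0 (E w) v else 0) (gen w))"
  proof -
    have "(\<Sum>v\<in>variables m n. smult (c v) (lam v))
        = (\<Sum>w\<in>Y. smult (\<Sum>v\<in>variables m n. c v * value_at_0 (E w) v) (gen w))"
      unfolding lam_def smult_sum smult_sum_left by (subst sum.swap) simp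
    also have "\<dots> = (\<Sum>w\<in>variables m n. smult (if w \<in> Y then \<Sum>v\<in>variables m n. c v * value_at_0 (E w) v else 0) (gen w))"
      using Y by (intro sum.mono_neutral_cong_left) auto
    finally show ?thesis .
  qed
  have "l = (\<Sum>w\<in>variables m n. smult (d w) (gen w))"
    by (simp add: l z_def smult_diff sum_subtractf lam d_def smult_diff_left)
  moreover have "(\<Sum>w\<in>variables m n. value_at_0 X w * d w) = 0" if X: "X \<in> L" for X
  proof -
    have "(\<Sum>w\<in>variables m n. value_at_0 X w * (if w \<in> Y then \<Sum>v\<in>variables m n. c v * value_at_0 (E w) v else 0))
        = (\<Sum>w\<in>Y. value_at_0 X w * (\<Sum>v\<in>variables m n. c v * value_at_0 (E w) v))"
      using Y by (intro sum.mono_neutral_cong_right) auto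
    also have "\<dots> = (\<Sum>v\<in>variables m n. c v * (\<Sum>w\<in>Y. value_at_0 X w * value_at_0 (E w) v))"
      unfolding sum_distrib_left by (subst sum.swap) (simp add: mult_ac)
    also have "\<dots> = (\<Sum>v\<in>variables m n. c v * value_at_0 X v)"
      using value_expansion[OF X] by (intro sum.cong) auto
    finally show ?thesis
      by (simp add: d_def right_diff_distrib sum_subtractf mult.commute)
  qed
  ultimately show "l \<in> annihilator m n (W_proj m n (-1) ` L)"
    unfolding annihilator_eq by blast
qed

text \<open>The quotients of a form of degree \<open>d\<close> have degree \<open>d - 1\<close>.
  Natural subtraction would admit constants for \<open>d = 0\<close>, so there the quotients are
  required to vanish.\<close>

definition is_division :: "nat \<Rightarrow> sps \<Rightarrow> (var \<Rightarrow> sps) \<Rightarrow> sps \<Rightarrow> bool" where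
  "is_division d f q p \<longleftrightarrow>
    (\<forall>v. q v \<in> Lam m n \<and> homogeneous (d - 1) (q v) \<and> (d = 0 \<longrightarrow> q v = 0)) \<and>
    p \<in> Lam_on Y \<and> homogeneous d p \<and> f = (\<Sum>v\<in>variables m n. z v * q v) + p"

lemma is_divisionD:
  assumes "is_division d f q p"
  shows "q v \<in> Lam m n" "homogeneous (d - 1) (q v)" "d = 0 \<Longrightarrow> q v = 0"
    "p \<in> Lam_on Y" "homogeneous d p" "f = (\<Sum>v\<in>variables m n. z v * q v) + p"
  using assms unfolding is_division_def by auto

text \<open>In Euler's formula each \<open>gen w\<close> is written as \<open>z w + lam w\<close>,
  and the derivatives are divided by induction. Moving \<open>lam w\<close> behind
  \<open>z v\<close> costs the sign \<open>s w v\<close>, and \<open>lam w\<close> times a remainder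
  is again a remainder.\<close>

lemma homogeneous_division:
  "f \<in> Lam m n \<Longrightarrow> homogeneous d f \<Longrightarrow> \<exists>q p. is_division d f q p"
proof (induction d arbitrary: f)
  case 0
  then have "f \<in> Lam_on Y"
    using homogeneous_0_eq[of f] Lam_on_smult[OF Lam_on_one] by metis
  with 0 show ?case
    by (intro exI[of _ "\<lambda>v. 0"] exI[of _ f]) (simp add: is_division_def Lam_closed)
next
  case (Suc d)
  let ?V = "variables m n"
  have "\<forall>w. \<exists>q p. is_division d (pd w f) q p"
    using Suc.IH Lam_closed(8)[OF Suc.prems(1)] homogeneous_pd[OF Suc.prems(2)] by blast
  then obtain q p where div: "\<And>w. is_division d (pd w f) (q w) (p w)"
    by metis
  note q = is_divisionD(1-3)[OF div] and p = is_divisionD(4,5)[OF div] and pd = is_divisionD(6)[OF div]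
  define s where "s = (\<lambda>w v. (-1 :: complex) ^ (vpar w * vpar v))"
  define R where "R = (\<lambda>v. pd v f + (\<Sum>w\<in>?V. smult (s w v) (lam w * q w v)))"
  define Q where "Q = (\<lambda>v. smult (1 / of_nat (Suc d)) (R v))"
  define P where "P = smult (1 / of_nat (Suc d)) (\<Sum>w\<in>?V. lam w * p w)"
  \<comment> \<open>The degree \<open>1 + (d - 1)\<close> is \<open>d\<close> except for
    \<open>d = 0\<close>, where the quotient vanishes.\<close>
  have lam_q: "homogeneous d (lam w * q w v)" for w v
    using homogeneous_mult[OF homogeneous_lam q(2), of w w v] q(3)[of w v] by (cases "d = 0") simp_all
  have "homogeneous d (Q v)" for v
    unfolding Q_def R_def by (intro homogeneous_smult homogeneous_add homogeneous_sum lam_q homogeneous_pd Suc.prems)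
  moreover have "Q v \<in> Lam m n" for v
    unfolding Q_def R_def using Suc.prems q lam_Lam_on by (intro Lam_closed Lam_sum) (auto simp: Lam_on_Y)
  moreover have "P \<in> Lam_on Y"
    unfolding P_def by (intro Lam_on_smult Lam_on_sum Lam_on_mult lam_Lam_on p)
  moreover have "homogeneous (Suc d) P"
    unfolding P_def using homogeneous_mult[OF homogeneous_lam p(2)]
    by (intro homogeneous_smult homogeneous_sum) simp
  moreover have "f = (\<Sum>v\<in>?V. z v * Q v) + P"
  proof -
    have "gen w * pd w f = z w * pd w f + (\<Sum>v\<in>?V. z v * smult (s w v) (lam w * q w v)) + lam w * p w"
      if w: "w \<in> ?V" for w
    proof -
      have "lam w * (z v * q w v) = z v * smult (s w v) (lam w * q w v)" if "v \<in> ?V" for v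
        using supercommute[OF has_parity_lam[OF w] has_parity_z[OF that]]
        by (simp add: s_def flip: mult.assoc)
      then have "lam w * pd w f = (\<Sum>v\<in>?V. z v * smult (s w v) (lam w * q w v)) + lam w * p w"
        unfolding pd distrib_left sum_distrib_left by simp
      then show ?thesis by (simp add: z_def left_diff_distrib)
    qed
    then have "smult (of_nat (Suc d)) f = (\<Sum>w\<in>?V. z w * pd w f)
        + (\<Sum>w\<in>?V. \<Sum>v\<in>?V. z v * smult (s w v) (lam w * q w v)) + (\<Sum>w\<in>?V. lam w * p w)"
      using euler_homogeneous[OF finite_variables, of f m n "Suc d"] Suc.prems
      by (simp add: Lam_eq_Lam_on sum.distrib)
    also have "(\<Sum>w\<in>?V. \<Sum>v\<in>?V. z v * smult (s w v) (lam w * q w v))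
        = (\<Sum>v\<in>?V. z v * (\<Sum>w\<in>?V. smult (s w v) (lam w * q w v)))"
      unfolding sum_distrib_left by (rule sum.swap)
    finally have "smult (1 / of_nat (Suc d)) (smult (of_nat (Suc d)) f)
        = smult (1 / of_nat (Suc d)) ((\<Sum>v\<in>?V. z v * R v) + (\<Sum>w\<in>?V. lam w * p w))"
      by (simp add: R_def distrib_left sum.distrib)
    then show ?thesis
      by (simp add: Q_def P_def smult_add smult_sum del: of_nat_Suc)
  qed
  ultimately show ?case by (intro exI[of _ Q] exI[of _ P]) (simp add: is_division_def)
qed

lemma division:
  assumes f: "f \<in> Lam m n"
  obtains q p where "\<And>v. q v \<in> Lam m n" "p \<in> Lam_on Y" "f = (\<Sum>v\<in>variables m n. z v * q v) + p"
proof -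
  let ?V = "variables m n"
  let ?d = "\<lambda>d. degree_part (int d) f"
  have "?d d \<in> Lam m n" for d
    using f by (simp add: Lam_eq_Lam_on Lam_on_degree_part)
  then have "\<forall>d. \<exists>q p. is_division d (?d d) q p"
    using homogeneous_division homogeneous_degree_part by blast
  then obtain q p where div: "\<And>d. is_division d (?d d) (q d) (p d)"
    by metis
  note q = is_divisionD(1,2)[OF div] is_divisionD(3)[OF div refl]
    and p = is_divisionD(4,5)[OF div] and d = is_divisionD(6)[OF div]
  \<comment> \<open>The index is shifted because quotients of the component of degree
    \<open>k + 1\<close> have degree \<open>k\<close>; those of the component of degree
    \<open>0\<close> are zero.\<close>
  define Q where "Q = (\<lambda>v. assemble (\<lambda>k. q (Suc k) v))"
  define P where "P = assemble p"
  have Q: "Q v \<in> Lam m n" for v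
    using q(1) unfolding Q_def Lam_eq_Lam_on by (intro assemble_Lam_on)
  have "order_ge N (f - ((\<Sum>v\<in>?V. z v * Q v) + P))" for N
  proof -
    have "order_ge (Suc N) (assemble ?d - (\<Sum>i<Suc N. ?d i))"
      by (intro order_ge_assemble_diff homogeneous_degree_part)
    moreover have "assemble ?d = f"
      by (rule sps_eqI) (simp add: sps_nth_assemble sps_nth_degree_part)
    ultimately have 1: "order_ge (Suc N) (f - (\<Sum>i<Suc N. ?d i))" by simp
    have 2: "order_ge (Suc N) (P - (\<Sum>i<Suc N. p i))"
      unfolding P_def by (intro order_ge_assemble_diff p)
    have "order_ge (Suc 0 + N) (z v * (Q v - (\<Sum>i<N. q (Suc i) v)))" for v
      unfolding Q_def using q(2)[of "Suc _"]
      by (intro order_ge_mult order_ge_z order_ge_assemble_diff) simp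
    then have 3: "order_ge (Suc N) (\<Sum>v\<in>?V. z v * (Q v - (\<Sum>i<N. q (Suc i) v)))"
      by (intro order_ge_sum) simp
    have "(\<Sum>i<Suc N. ?d i) = (\<Sum>v\<in>?V. z v * (\<Sum>i<N. q (Suc i) v)) + (\<Sum>i<Suc N. p i)"
    proof -
      have "(\<Sum>i<Suc N. \<Sum>v\<in>?V. z v * q i v) = (\<Sum>v\<in>?V. z v * (\<Sum>i<Suc N. q i v))"
        unfolding sum_distrib_left by (rule sum.swap)
      then show ?thesis
        unfolding d sum.distrib by (simp add: sum.lessThan_Suc_shift q(3) del: sum.lessThan_Suc)
    qed
    then have eq: "f - ((\<Sum>v\<in>?V. z v * Q v) + P) = (f - (\<Sum>i<Suc N. ?d i))
        - (\<Sum>v\<in>?V. z v * (Q v - (\<Sum>i<N. q (Suc i) v))) - (P - (\<Sum>i<Suc N. p i))"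
      by (simp add: right_diff_distrib sum_subtractf del: sum.lessThan_Suc)
    have "order_ge (Suc N) (f - ((\<Sum>v\<in>?V. z v * Q v) + P))"
      unfolding eq by (rule order_ge_diff[OF order_ge_diff[OF 1 3] 2])
    then show ?thesis by (rule order_ge_mono) simp
  qed
  then have "f - ((\<Sum>v\<in>?V. z v * Q v) + P) = 0" by (rule order_ge_eq_zero)
  then show ?thesis
    using that[of Q P] Q assemble_Lam_on[of p Y] p(1) by (simp add: P_def)
qed

end

section \<open>The straightening automorphism\<close>

context adapted
begin

text \<open>The ideal is graded by parity, so the component with the parity of \<open>v\<close> may
  be taken. This makes the derivation \<open>shear\<close> even.\<close>

lemma eta_exists:
  assumes v: "v \<in> variables m n"
  shows "\<exists>h. h \<in> Lam_on Y \<and> has_parity (vpar v) h \<and> gen v - h \<in> \<I>"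
proof -
  obtain h where h: "h \<in> Lam_on Y" "gen v - h \<in> \<I>"
    using decomposition[OF Lam_closed(9)[OF v]] by blast
  have "parity_part (vpar v) (gen v - h) \<in> \<I>"
    using super_ideal_invariant_ideal h(2) by (rule super_idealD)
  then have "gen v - parity_part (vpar v) h \<in> \<I>"
    using parity_part_eq[OF has_parity_gen, of "vpar v" v] by (simp add: parity_part_simps)
  then show ?thesis
    using h(1) by (intro exI[of _ "parity_part (vpar v) h"]) (simp add: Lam_on_parity_part)
qed

definition eta :: "var \<Rightarrow> sps" where
  "eta v = (SOME h. h \<in> Lam_on Y \<and> has_parity (vpar v) h \<and> gen v - h \<in> \<I>)"

lemma eta:
  assumes "v \<in> variables m n"
  shows "eta v \<in> Lam_on Y" "has_parity (vpar v) (eta v)" "gen v - eta v \<in> \<I>"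
  using someI_ex[OF eta_exists[OF assms]] unfolding eta_def by blast+

definition shear :: "sps \<Rightarrow> sps" where
  "shear f = (\<Sum>v\<in>variables m n - Y. (eta v - lam v) * pd v f)"

text \<open>Both \<open>z v\<close> and \<open>gen v - eta v\<close> lie in \<open>K 2\<close>.
  Their difference is a series in the variables of \<open>Y\<close>, for which membership in
  \<open>K 2\<close> means order \<open>2\<close>.\<close>

lemma order_ge_eta_lam:
  assumes v: "v \<in> variables m n"
  shows "order_ge 2 (eta v - lam v)"
proof (rule order_ge_of_K)
  show "eta v - lam v \<in> Lam_on Y" by (intro Lam_on_diff eta lam_Lam_on v)
  have "gen v - eta v \<in> K 2" using eta(3)[OF v] by (simp add: invariant_ideal_def)
  then have "z v - (gen v - eta v) \<in> K 2" by (rule K_diff[OF z_K[OF v]])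
  then show "eta v - lam v \<in> K 2" by (simp add: z_def)
qed

lemma has_parity_eta_lam: "v \<in> variables m n \<Longrightarrow> has_parity (vpar v) (eta v - lam v)"
  by (intro has_parity_diff eta has_parity_lam)

sublocale straighten: raising_derivation shear
proof
  fix f g :: sps and c k
  show add: "shear (f + g) = shear f + shear g" for f g
    unfolding shear_def by (rule vector_field_add)
  show "shear (smult c f) = smult c (shear f)"
    unfolding shear_def by (rule vector_field_smult)
  show "order_ge (Suc k) (shear f)" if "order_ge k f"
    unfolding shear_def
  proof (rule order_ge_sum)
    fix v assume "v \<in> variables m n - Y"
    then have "order_ge 2 (eta v - lam v)" by (simp add: order_ge_eta_lam)
    \<comment> \<open>For \<open>k = 0\<close> the truncated difference claims nothing; the
      coefficient of order \<open>2\<close> alone suffices.\<close>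
    moreover have "order_ge (k - 1) (pd v f)"
      using that by (cases k) (simp_all add: order_ge_pd)
    ultimately have "order_ge (2 + (k - 1)) ((eta v - lam v) * pd v f)" by (rule order_ge_mult)
    then show "order_ge (Suc k) ((eta v - lam v) * pd v f)" by (rule order_ge_mono) simp
  qed
  have hom: "shear (f * g) = shear f * g + f * shear g" if "has_parity p f" for f g p
    using vector_field_mult[of "variables m n - Y" 0 "\<lambda>v. eta v - lam v", OF _ that] has_parity_eta_lam
    unfolding shear_def by simp
  \<comment> \<open>The field is even, so its Leibniz rule carries no sign and extends from
    homogeneous to arbitrary \<open>f\<close>.\<close>
  have "shear (parity_part 0 f * g + parity_part 1 f * g)
      = shear (parity_part 0 f + parity_part 1 f) * g + (parity_part 0 f + parity_part 1 f) * shear g"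
    unfolding add hom[OF has_parity_parity_part] by (simp add: algebra_simps)
  then show "shear (f * g) = shear f * g + f * shear g"
    by (simp only: distrib_right[symmetric] parity_decomp[symmetric])
qed

sublocale unstraighten: raising_derivation "\<lambda>f. - shear f"
  by (rule straighten.raising_derivation_uminus)

abbreviation "\<phi> \<equiv> straighten.expo"
abbreviation "\<psi> \<equiv> unstraighten.expo"

lemma shear_Lam: "f \<in> Lam m n \<Longrightarrow> shear f \<in> Lam m n"
  unfolding shear_def by (intro Lam_sum Lam_closed) (auto intro: Lam_on_Y eta lam_Lam_on)

lemma has_parity_shear: "has_parity p f \<Longrightarrow> has_parity p (shear f)"
  unfolding shear_def
proof (rule has_parity_sum)
  fix v assume f: "has_parity p f" and v: "v \<in> variables m n - Y"
  have "has_parity (vpar v + (vpar v + p)) ((eta v - lam v) * pd v f)"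
    using v by (intro has_parity_mult has_parity_pd f has_parity_eta_lam) simp
  moreover have "(vpar v + (vpar v + p)) mod 2 = p mod 2" by presburger
  ultimately show "has_parity p ((eta v - lam v) * pd v f)"
    using has_parity_mod by blast
qed

lemma shear_Lam_on_Y: "p \<in> Lam_on Y \<Longrightarrow> shear p = 0"
  unfolding shear_def by (simp add: pd_Lam_on_eq_0)

lemma \<phi>_Lam: "f \<in> Lam m n \<Longrightarrow> \<phi> f \<in> Lam m n"
  using straighten.expo_Lam_on[of "variables m n"] shear_Lam by (simp add: Lam_eq_Lam_on)

lemma \<psi>_Lam: "f \<in> Lam m n \<Longrightarrow> \<psi> f \<in> Lam m n"
  using unstraighten.expo_Lam_on[of "variables m n"] shear_Lam Lam_closed(4)[OF Lam_closed(1)]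
  by (simp add: Lam_eq_Lam_on)

lemma has_parity_\<phi>: "has_parity p f \<Longrightarrow> has_parity p (\<phi> f)"
  by (intro straighten.has_parity_expo has_parity_shear)

lemma has_parity_\<psi>: "has_parity p f \<Longrightarrow> has_parity p (\<psi> f)"
  using has_parity_diff[OF has_parity_zero has_parity_shear]
  by (intro unstraighten.has_parity_expo) simp_all

lemmas \<phi>_\<psi> = straighten.expo_expo_uminus
lemmas \<psi>_\<phi> = straighten.expo_uminus_expo

lemma \<psi>_parity_part: "\<psi> (parity_part p f) = parity_part p (\<psi> f)"
proof -
  have "f = parity_part p f + parity_part (Suc p) f"
    by (rule sps_eqI) (auto simp: sps_nth_parity_part mod_Suc)
  then have "\<psi> f = \<psi> (parity_part p f) + \<psi> (parity_part (Suc p) f)"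
    by (metis unstraighten.expo_add)
  moreover have "has_parity q (\<psi> (parity_part q f))" for q
    by (intro has_parity_\<psi> has_parity_parity_part)
  moreover have "Suc p mod 2 \<noteq> p mod 2" by presburger
  ultimately show ?thesis
    using parity_part_eq[of p "\<psi> (parity_part p f)" p]
      parity_part_eq[of "Suc p" "\<psi> (parity_part (Suc p) f)" p]
    by (simp only: parity_part_simps if_False simp_thms if_True add_0_right)
qed

lemma continuous_\<phi>: "continuous_map (Lam_topology m n) (Lam_topology m n) \<phi>"
  by (intro continuous_map_Lam \<phi>_Lam straighten.expo_diff straighten.order_ge_expo)

lemma continuous_\<psi>: "continuous_map (Lam_topology m n) (Lam_topology m n) \<psi>"
  by (intro continuous_map_Lam \<psi>_Lam unstraighten.expo_diff unstraighten.order_ge_expo)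

lemma cont_automorphism_\<phi>: "cont_automorphism m n \<phi>"
  unfolding cont_automorphism_def
proof (intro conjI ballI allI impI)
  show "bij_betw \<phi> (Lam m n) (Lam m n)"
    by (rule bij_betw_byWitness[where f' = \<psi>]) (auto simp: \<phi>_\<psi> \<psi>_\<phi> \<phi>_Lam \<psi>_Lam)
qed (simp_all add: straighten.expo_add straighten.expo_mult straighten.expo_smult has_parity_\<phi> continuous_\<phi>)

lemma inv_into_\<phi>: "f \<in> Lam m n \<Longrightarrow> inv_into (Lam m n) \<phi> f = \<psi> f"
  using cont_automorphism_\<phi> unfolding cont_automorphism_def
  by (intro inv_into_f_eq) (auto simp: bij_betw_def \<phi>_\<psi> \<psi>_Lam)

lemma \<psi>_Lam_on: "p \<in> Lam_on Y \<Longrightarrow> \<psi> p = p"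
  by (rule unstraighten.expo_eq_self) (simp add: shear_Lam_on_Y)

text \<open>For \<open>v\<close> outside \<open>Y\<close>, \<open>shear (z v)\<close> is a series in
  the variables of \<open>Y\<close> and is killed by \<open>shear\<close>. So the exponential ends
  with its linear term and gives \<open>gen v - eta v\<close> exactly.\<close>

lemma \<psi>_z:
  assumes v: "v \<in> variables m n"
  shows "\<psi> (z v) \<in> \<I>"
proof (cases "v \<in> Y")
  case True
  then show ?thesis
    using unstraighten.expo_eq_self[of 0] super_idealD(2)[OF super_ideal_invariant_ideal]
    by (simp add: z_Y)
next
  case False
  have "shear (gen v) = eta v - lam v"
    using False v by (simp add: shear_def pd_gen if_distrib[where f = "\<lambda>x. _ * x"] cong: if_cong)
  then have "shear (z v) = eta v - lam v"
    using straighten.D_add[of "z v" "lam v"] shear_Lam_on_Y[OF lam_Lam_on] by (simp add: z_def)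
  moreover have "eta v - lam v \<in> Lam_on Y"
    by (intro Lam_on_diff eta lam_Lam_on v)
  ultimately have "\<psi> (z v) = z v + - (eta v - lam v)"
    using unstraighten.expo_eq_add[of "z v"] straighten.D_smult[of "-1" "shear (z v)"]
    by (simp add: shear_Lam_on_Y smult_minus_left)
  also have "\<dots> = gen v - eta v" by (simp add: z_def)
  finally show ?thesis using eta(3)[OF v] by simp
qed

section \<open>The image of the invariant ideal under the exponential\<close>

abbreviation "J \<equiv> ideal_gen m n (annihilator m n (W_proj m n (-1) ` L))"

lemma annihilator_Lam: "annihilator m n (W_proj m n (-1) ` L) \<subseteq> Lam m n"
  unfolding annihilator_eq_span by (auto intro!: Lam_sum Lam_closed z_Lam)

lemma z_J: "v \<in> variables m n \<Longrightarrow> z v \<in> J"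
proof -
  assume "v \<in> variables m n"
  then have "z v = (\<Sum>w\<in>variables m n. smult (if w = v then 1 else 0) (z w))"
    by (simp add: if_distrib[where f = "\<lambda>c. smult c _"] cong: if_cong)
  then have "z v \<in> annihilator m n (W_proj m n (-1) ` L)"
    unfolding annihilator_eq_span by (intro CollectI exI conjI TrueI)
  then show ?thesis
    by (auto simp: ideal_gen_def)
qed

text \<open>The preimage of \<open>\<I>\<close> under \<open>\<psi>\<close> is an ideal graded by
  parity that contains the generators of \<open>J\<close>.\<close>

lemma \<psi>_J: "f \<in> J \<Longrightarrow> \<psi> f \<in> \<I>"
proof -
  note I = super_idealD[OF super_ideal_invariant_ideal]
  have "super_ideal m n {f \<in> Lam m n. \<psi> f \<in> \<I>}"
    unfolding super_ideal_def
  proof (intro conjI ballI allI)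
    show "0 \<in> {f \<in> Lam m n. \<psi> f \<in> \<I>}"
      using unstraighten.expo_eq_self[of 0] I(2) by (simp add: Lam_closed)
  qed (auto simp: Lam_closed unstraighten.expo_add unstraighten.expo_mult \<psi>_parity_part
      intro: I(3-6) \<psi>_Lam)
  moreover have "annihilator m n (W_proj m n (-1) ` L) \<subseteq> {f \<in> Lam m n. \<psi> f \<in> \<I>}"
  proof
    fix l assume l: "l \<in> annihilator m n (W_proj m n (-1) ` L)"
    then obtain c where c: "l = (\<Sum>v\<in>variables m n. smult (c v) (z v))"
      unfolding annihilator_eq_span by blast
    have sum: "\<psi> (\<Sum>i\<in>A. F i) = (\<Sum>i\<in>A. \<psi> (F i))" for A :: "var set" and F
      using unstraighten.expo_eq_self[of 0]
      by (induction A rule: infinite_finite_induct) (simp_all add: unstraighten.expo_add)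
    have "\<psi> l \<in> \<I>"
      unfolding c sum unstraighten.expo_smult
      by (intro super_ideal_sum[OF super_ideal_invariant_ideal] I(7) \<psi>_z)
    then show "l \<in> {f \<in> Lam m n. \<psi> f \<in> \<I>}"
      using l annihilator_Lam by blast
  qed
  ultimately show "f \<in> J \<Longrightarrow> \<psi> f \<in> \<I>"
    using ideal_gen_least by blast
qed

text \<open>The remainder of \<open>\<phi> f\<close> on division lies in \<open>Lam_on Y\<close> and
  is fixed by \<open>\<psi>\<close>. Applying \<open>\<psi>\<close> shows that it also lies in
  \<open>\<I>\<close>, hence is \<open>0\<close>. Division yields a finite combination of the
  \<open>z v\<close>, so no closure of \<open>J\<close> has to be taken.\<close>

lemma \<phi>_invariant_ideal:
  assumes f: "f \<in> \<I>"
  shows "\<phi> f \<in> J"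
proof -
  note I = super_idealD[OF super_ideal_invariant_ideal]
  note J = super_idealD[OF super_ideal_ideal_gen[OF annihilator_Lam]]
  have "\<phi> f \<in> Lam m n" using f I(1) by (intro \<phi>_Lam) blast
  then obtain q p where q: "\<And>v. q v \<in> Lam m n" and p: "p \<in> Lam_on Y"
    and \<phi>: "\<phi> f = (\<Sum>v\<in>variables m n. z v * q v) + p"
    using division by blast
  have j: "(\<Sum>v\<in>variables m n. z v * q v) \<in> J"
    by (intro super_ideal_sum[OF super_ideal_ideal_gen[OF annihilator_Lam]] J(5) z_J q)
  have "\<psi> (\<phi> f) = \<psi> (\<Sum>v\<in>variables m n. z v * q v) + p"
    unfolding \<phi> unstraighten.expo_add \<psi>_Lam_on[OF p] ..
  then have "p = f - \<psi> (\<Sum>v\<in>variables m n. z v * q v)"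
    by (simp add: \<psi>_\<phi>)
  then have "p \<in> \<I>" using I(8)[OF f \<psi>_J[OF j]] by simp
  then have "p = 0" using p by (intro Lam_on_invariant_ideal)
  then show ?thesis using j \<phi> by simp
qed

lemma cont_superderivation_induced:
  assumes X: "cont_superderivation m n s X"
  shows "cont_superderivation m n s (induced_aut m n \<phi> X)"
proof -
  have ind: "induced_aut m n \<phi> X f = \<phi> (X (\<psi> f))" if "f \<in> Lam m n" for f
    using that by (simp add: induced_aut_def inv_into_\<phi>)
  have "continuous_map (Lam_topology m n) (Lam_topology m n) (\<phi> \<circ> (X \<circ> \<psi>))"
    by (intro continuous_map_compose[OF _ continuous_\<phi>] continuous_map_compose[OF continuous_\<psi>] csdD(7)[OF X])
  then have "continuous_map (Lam_topology m n) (Lam_topology m n) (induced_aut m n \<phi> X)"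
    by (rule continuous_map_eq) (simp add: ind)
  moreover have "\<phi> (X (\<psi> f * \<psi> g)) = \<phi> (X (\<psi> f)) * g + smult ((-1) ^ (s * p)) (f * \<phi> (X (\<psi> g)))"
    if "f \<in> Lam m n" "g \<in> Lam m n" "has_parity p f" for f g p
    unfolding csdD(6)[OF X \<psi>_Lam[OF that(1)] \<psi>_Lam[OF that(2)] has_parity_\<psi>[OF that(3)]]
      straighten.expo_add straighten.expo_smult straighten.expo_mult \<phi>_\<psi> ..
  moreover have "induced_aut m n \<phi> X f = 0" if "f \<notin> Lam m n" for f
    using that by (simp add: induced_aut_def)
  ultimately show ?thesis
    unfolding cont_superderivation_def
    by (simp add: ind Lam_closed \<psi>_Lam \<phi>_Lam csdD(1-5)[OF X]
        unstraighten.expo_add unstraighten.expo_smult unstraighten.expo_mult has_parity_\<psi> has_parity_\<phi>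
        straighten.expo_add straighten.expo_smult straighten.expo_mult \<phi>_\<psi>)
qed

text \<open>Conjugation follows the chain \<open>\<psi>\<close> from \<open>J\<close> to
  \<open>\<I>\<close>, then \<open>X\<close> inside \<open>\<I>\<close>, then \<open>\<phi>\<close>
  back to \<open>J\<close>.\<close>

lemma induced_in_W_stab:
  assumes X: "X \<in> L"
  shows "induced_aut m n \<phi> X \<in> W_stab m n (annihilator m n (W_proj m n (-1) ` L))"
  unfolding W_stab_def
proof (intro CollectI conjI image_subsetI)
  obtain Z1 Z2 where Z: "Z1 \<in> L" "Z2 \<in> L" "cont_superderivation m n 0 Z1" "cont_superderivation m n 1 Z2"
    "\<And>f. X f = Z1 f + Z2 f"
    using L_decomp[OF X] by blast
  have "induced_aut m n \<phi> X = induced_aut m n \<phi> Z1 + induced_aut m n \<phi> Z2"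
    by (rule ext) (simp add: induced_aut_def Z(5) straighten.expo_add plus_fun_def)
  then show "induced_aut m n \<phi> X \<in> W m n"
    unfolding W_def using cont_superderivation_induced Z(3,4) by blast
  fix f assume f: "f \<in> J"
  then have "f \<in> Lam m n"
    using super_idealD(1)[OF super_ideal_ideal_gen[OF annihilator_Lam]] by blast
  then have "induced_aut m n \<phi> X f = \<phi> (X (\<psi> f))"
    by (simp add: induced_aut_def inv_into_\<phi>)
  also have "\<dots> \<in> J"
    by (rule \<phi>_invariant_ideal[OF invariant_ideal_invariant[OF X \<psi>_J[OF f]]])
  finally show "induced_aut m n \<phi> X f \<in> J" .
qed

section \<open>Transitivity and closed invariant ideals\<close>

lemma transitive_iff_Y: "transitive m n L \<longleftrightarrow> Y = variables m n"
proof
  assume trans: "transitive m n L"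
  have "v \<in> Y" if v: "v \<in> variables m n" for v
  proof (rule ccontr)
    assume "v \<notin> Y"
    obtain X where X: "X \<in> L" "\<And>w. w \<in> variables m n \<Longrightarrow> value_at_0 X w = (if w = v then 1 else 0)"
      using trans[unfolded transitive_iff, rule_format, of "\<lambda>w. if w = v then 1 else 0"] by blast
    have "value_at_0 X v = 0"
      using X(2) Y \<open>v \<notin> Y\<close> by (intro determined[OF X(1) _ v]) auto
    with X(2)[OF v] show False by simp
  qed
  with Y show "Y = variables m n" by blast
next
  assume all: "Y = variables m n"
  show "transitive m n L"
    unfolding transitive_iff
  proof
    fix c :: "var \<Rightarrow> complex"
    have "0 \<in> L" using lie unfolding lie_subalgebra_def by blast
    \<comment> \<open>The zero field and the negated coefficients bring a combination of the
      \<open>E a\<close> into the form of \<open>L_minus_sum\<close>.\<close>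
    then have "(\<lambda>f. 0 f - (\<Sum>a\<in>Y. smult (- c a) (E a f))) \<in> L" (is "?X \<in> L")
      by (intro L_minus_sum finite_Y E_L)
    moreover have "value_at_0 ?X v = c v" if "v \<in> Y" for v
    proof -
      have "value_at_0 ?X v = (\<Sum>a\<in>Y. if a = v then c a else 0)"
        using that E_value by (simp add: value_at_0_def sps_nth_sum sum_negf zero_fun_def)
          (intro sum.cong, auto simp: value_at_0_def)
      then show ?thesis using finite_Y that by simp
    qed
    ultimately show "\<exists>X\<in>L. \<forall>v\<in>variables m n. value_at_0 X v = c v"
      using all by blast
  qed
qed

end

text \<open>For \<open>u = 1 - g / const_coeff g\<close> the elements \<open>1 - u ^ k\<close> are
  multiples of \<open>1 - u\<close> and lie in \<open>I\<close>, while \<open>u ^ k\<close> tends to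
  \<open>0\<close>. Closedness gives \<open>1 \<in> I\<close>; this replaces the inversion of
  \<open>g\<close> by a geometric series.\<close>

lemma closed_ideal_with_unit:
  assumes I: "super_ideal m n I" and closed: "closedin (Lam_topology m n) I"
    and g: "g \<in> I" "const_coeff g \<noteq> 0"
  shows "I = Lam m n"
proof -
  note D = super_idealD[OF I]
  define u where "u = 1 - smult (1 / const_coeff g) g"
  have gI: "smult (1 / const_coeff g) g \<in> I" by (intro D(7) g)
  then have u: "u \<in> Lam m n" using D(1) by (auto simp: u_def intro: Lam_closed)
  have "order_ge (Suc 0) u"
    using g(2) by (simp add: order_ge_1_iff u_def sps_nth_one)
  then have ord: "order_ge k (u ^ k)" for k
    using order_ge_mult[of "Suc 0" u] by (induction k) simp_all
  have pow: "1 - u ^ k \<in> I" for k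
  proof (induction k)
    case (Suc k)
    have "1 - u ^ Suc k = u * (1 - u ^ k) + smult (1 / const_coeff g) g"
      by (simp add: u_def algebra_simps)
    then show ?case using D(3)[OF D(4)[OF Suc u] gI] by simp
  qed (use D(2) in simp)
  have "1 \<in> I"
  proof (rule ccontr)
    assume "1 \<notin> I"
    then have "1 \<in> Lam m n - I" by (simp add: Lam_closed)
    then obtain k where "\<And>y. y \<in> I \<Longrightarrow> \<not> order_ge k (y - 1)"
      using closed unfolding closedin_Lam_topology by blast
    from this[OF pow[of k]] show False using ord[of k] by (simp add: order_ge_uminus)
  qed
  then have "f * 1 \<in> I" if "f \<in> Lam m n" for f
    using that by (intro D(4))
  then show ?thesis using D(1) by auto
qed

theorem theorem1p1:
  fixes m n :: nat and L :: "(sps \<Rightarrow> sps) set"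
  assumes "lie_subalgebra m n L"
    and "closedin (W_topology m n) L"
  shows "(\<exists>\<phi>. cont_automorphism m n \<phi> \<and>
            induced_aut m n \<phi> ` L \<subseteq> W_stab m n (annihilator m n (W_proj m n (-1) ` L))) \<and>
         ((\<nexists>I. super_ideal m n I \<and> closedin (Lam_topology m n) I \<and>
              (\<forall>X\<in>L. X ` I \<subseteq> I) \<and> I \<noteq> {0} \<and> I \<noteq> Lam m n)
            \<longleftrightarrow> transitive m n L)"
proof -
  have sub: "subalgebra m n L" using assms(1) by (rule subalgebra.intro)
  then obtain Y E where "adapted m n L Y E" using subalgebra.adapted_exists by blast
  then interpret adapted m n L Y E .
  have a: "\<exists>\<phi>. cont_automorphism m n \<phi> \<and>
      induced_aut m n \<phi> ` L \<subseteq> W_stab m n (annihilator m n (W_proj m n (-1) ` L))"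
    using cont_automorphism_\<phi> induced_in_W_stab by blast
  have trivial: "I = {0} \<or> I = Lam m n"
    if trans: "transitive m n L" and I: "super_ideal m n I" "closedin (Lam_topology m n) I" "\<forall>X\<in>L. X ` I \<subseteq> I" for I
  proof (cases "\<exists>g\<in>I. const_coeff g \<noteq> 0")
    case True
    then show ?thesis using closed_ideal_with_unit[OF I(1,2)] by blast
  next
    case False
    \<comment> \<open>An invariant ideal without constant terms is contained in \<open>\<I>\<close>.
      For transitive \<open>L\<close> all of \<open>Lam m n\<close> is \<open>Lam_on Y\<close>,
      which meets \<open>\<I>\<close> only in \<open>0\<close>.\<close>
    then have "I \<subseteq> \<I>"
      using super_idealD(1)[OF I(1)] I(3) by (intro subset_invariant_ideal) blast+
    moreover have "f = 0" if "f \<in> \<I>" for f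
    proof (rule Lam_on_invariant_ideal[OF _ that])
      show "f \<in> Lam_on Y"
        using that trans super_idealD(1)[OF super_ideal_invariant_ideal]
        by (auto simp: transitive_iff_Y Lam_eq_Lam_on)
    qed
    ultimately show ?thesis using super_idealD(2)[OF I(1)] by blast
  qed
  have nontrivial: "\<exists>I. super_ideal m n I \<and> closedin (Lam_topology m n) I \<and>
      (\<forall>X\<in>L. X ` I \<subseteq> I) \<and> I \<noteq> {0} \<and> I \<noteq> Lam m n" if "\<not> transitive m n L"
  proof (intro exI[of _ \<I>] conjI)
    obtain v where v: "v \<in> variables m n" "v \<notin> Y"
      using \<open>\<not> transitive m n L\<close> Y unfolding transitive_iff_Y by blast
    \<comment> \<open>For \<open>v\<close> outside \<open>Y\<close> the series \<open>eta v\<close>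
      does not involve \<open>v\<close>, so the element \<open>gen v - eta v\<close> of
      \<open>\<I>\<close> cannot be zero.\<close>
    have "pd v (gen v - eta v) = 1"
      using eta(1)[OF v(1)] v(2) by (simp add: pd_diff pd_gen pd_Lam_on_eq_0)
    then have "gen v - eta v \<noteq> 0" by (metis pd_zero zero_neq_one)
    then show "\<I> \<noteq> {0}" using eta(3)[OF v(1)] by blast
    have "1 \<notin> \<I>" using const_coeff_invariant_ideal[of 1] by (auto simp: sps_nth_one)
    then show "\<I> \<noteq> Lam m n" using Lam_closed(2) by blast
    show "\<forall>X\<in>L. X ` \<I> \<subseteq> \<I>" using invariant_ideal_invariant by blast
  qed (rule super_ideal_invariant_ideal closedin_invariant_ideal)+
  show ?thesis
  proof (rule conjI[OF a], rule iffI)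
    assume "\<nexists>I. super_ideal m n I \<and> closedin (Lam_topology m n) I \<and>
      (\<forall>X\<in>L. X ` I \<subseteq> I) \<and> I \<noteq> {0} \<and> I \<noteq> Lam m n"
    then show "transitive m n L" by (rule contrapos_np) (rule nontrivial)
  next
    assume "transitive m n L"
    then show "\<nexists>I. super_ideal m n I \<and> closedin (Lam_topology m n) I \<and>
      (\<forall>X\<in>L. X ` I \<subseteq> I) \<and> I \<noteq> {0} \<and> I \<noteq> Lam m n"
      using trivial by metis
  qed
qed

end
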